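(* Let $b_1,b_2,b_3$ be distinct integers with highest common factor $1$ and $b_1+b_2+b_3=0$. Let $G\cong\mathrm U(1)$ be the subgroup of $\mathrm{SU}(3)$ consisting of the transformations $(z_1,z_2,z_3)\mapsto(e^{ib_1s}z_1,e^{ib_2s}z_2,e^{ib_3s}z_3)$ for $s\in\mathbb R$. Then there is a countably infinite family of special Lagrangian cones $N$ in $\mathbb C^3$ with the following properties: - the cones are pairwise distinct, in the sense that no two are identified by a $G$-equivariant isometric isomorphism of $\mathbb C^3$; - each $N$ is closed and embedded, and $\mathrm{Sym}^0(N)=G$; - each $N$ is topologically a cone on $T^2$, with exactly one singular point, at $0$.
   Context: $\mathbb C^3$ carries the metric $g=\sum_j|dz_j|^2$, the Kähler form $\omega=\frac i2\sum_j dz_j\wedge d\bar z_j$ and $\Omega=dz_1\wedge dz_2\wedge dz_3$. An oriented real $3$-dimensional submanifold $L$ is special Lagrangian with phase $e^{i\theta}$ if $(\cos\theta\,\mathrm{Re}\,\Omega+\sin\theta\,\mathrm{Im}\,\Omega)|_L$ equals the induced volume form. When no phase is specified, phase $1$ is meant. A cone is a set $C$ with $0\in C$ and $tC=C$ for all $t>0$. $\mathrm{Sym}(N)$ is the Lie subgroup of $\mathrm{SU}(3)\ltimes\mathbb C^3$ (with $\mathbb C^3$ acting by translations) preserving $N$. $\mathrm{Sym}^0(N)$ is its identity component. *)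

theory Defs
  imports "HOL-Analysis.Analysis"
begin

text \<open>C^3 is modelled as complex^3, viewed as a real inner product space
(real part of the hermitian product = the metric g).\<close>

type_synonym C3 = "complex^3"
type_synonym M3 = "complex^3^3"

text \<open>C-infinity maps between real normed spaces on a set W: f lies in a class of
maps, each of which is differentiable at every point of W with all its
directional derivatives x |-> Dg(x) v again in the class.  (Existence of all
iterated derivatives is the usual notion of a smooth map.)\<close>
definition smooth_on :: "'a::real_normed_vector set \<Rightarrow> ('a \<Rightarrow> 'b::real_normed_vector) \<Rightarrow> bool" where
  "smooth_on W f \<longleftrightarrow>
     (\<exists>F. f \<in> F \<and> (\<forall>g\<in>F. \<exists>g'. (\<forall>x\<in>W. (g has_derivative g' x) (at x)) \<and>
                                 (\<forall>v. (\<lambda>x. g' x v) \<in> F)))"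

definition chart3 :: "C3 set \<Rightarrow> C3 \<Rightarrow> C3 set \<Rightarrow> (real^3) set \<Rightarrow> (real^3 \<Rightarrow> C3) \<Rightarrow> bool" where
  "chart3 S p U W \<phi> \<longleftrightarrow>
     open U \<and> p \<in> U \<and> open W \<and> smooth_on W \<phi> \<and> \<phi> ` W = S \<inter> U \<and> inj_on \<phi> W \<and>
     continuous_on (S \<inter> U) (inv_into W \<phi>) \<and>
     (\<forall>x\<in>W. \<exists>\<phi>'. (\<phi> has_derivative \<phi>') (at x) \<and> inj \<phi>')"

definition smooth_point3 :: "C3 set \<Rightarrow> C3 \<Rightarrow> bool" where
  "smooth_point3 S p \<longleftrightarrow> (\<exists>U W \<phi>. chart3 S p U W \<phi>)"

text \<open>Omega = dz1 /\ dz2 /\ dz3 evaluated on three vectors.\<close>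
definition Omega :: "C3 \<Rightarrow> C3 \<Rightarrow> C3 \<Rightarrow> complex" where
  "Omega u v w = det (vector [u, v, w] :: M3)"

text \<open>An oriented 3-plane with oriented orthonormal basis e1 e2 e3 is special Lagrangian
(phase 1) iff Re Omega (e1,e2,e3) = 1 = vol(e1,e2,e3).  S is special Lagrangian near p
if S is smooth near p and its tangent space there admits an orientation for which
Re Omega restricts to the volume form.\<close>
definition SL_point :: "C3 set \<Rightarrow> C3 \<Rightarrow> bool" where
  "SL_point S p \<longleftrightarrow>
     (\<exists>U W \<phi> \<phi>'. chart3 S p U W \<phi> \<and> (\<phi> has_derivative \<phi>') (at (inv_into W \<phi> p)) \<and>
        (\<exists>e1 e2 e3. span {e1, e2, e3} = range \<phi>' \<and>
           e1 \<bullet> e1 = 1 \<and> e2 \<bullet> e2 = 1 \<and> e3 \<bullet> e3 = 1 \<and>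
           e1 \<bullet> e2 = 0 \<and> e1 \<bullet> e3 = 0 \<and> e2 \<bullet> e3 = 0 \<and>
           Re (Omega e1 e2 e3) = 1))"

definition is_cone :: "C3 set \<Rightarrow> bool" where
  "is_cone C \<longleftrightarrow> 0 \<in> C \<and> (\<forall>t>0. (\<lambda>z. t *\<^sub>R z) ` C = C)"

definition SL_cone :: "C3 set \<Rightarrow> bool" where
  "SL_cone N \<longleftrightarrow> is_cone N \<and> (\<forall>p\<in>N - {0}. SL_point N p)"

definition adjoint3 :: "M3 \<Rightarrow> M3" where
  "adjoint3 A = (\<chi> i j. cnj (A $ j $ i))"

definition unitary3 :: "M3 \<Rightarrow> bool" where
  "unitary3 A \<longleftrightarrow> A ** adjoint3 A = mat 1"

definition SU3 :: "M3 set" where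
  "SU3 = {A. unitary3 A \<and> det A = 1}"

definition Sym :: "C3 set \<Rightarrow> (M3 \<times> C3) set" where
  "Sym N = {(A, c). A \<in> SU3 \<and> (\<lambda>z. A *v z + c) ` N = N}"

definition Sym0 :: "C3 set \<Rightarrow> (M3 \<times> C3) set" where
  "Sym0 N = connected_component_set (Sym N) (mat 1, 0)"

definition Gmat :: "int \<Rightarrow> int \<Rightarrow> int \<Rightarrow> real \<Rightarrow> M3" where
  "Gmat b1 b2 b3 s =
     (\<chi> i j. if i = j then exp (\<i> * complex_of_real (real_of_int ((vector [b1, b2, b3] :: int^3) $ i) * s))
             else 0)"

definition Ggroup :: "int \<Rightarrow> int \<Rightarrow> int \<Rightarrow> (M3 \<times> C3) set" where
  "Ggroup b1 b2 b3 = {(Gmat b1 b2 b3 s, 0) | s. True}"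

definition G_equiv_identified :: "int \<Rightarrow> int \<Rightarrow> int \<Rightarrow> C3 set \<Rightarrow> C3 set \<Rightarrow> bool" where
  "G_equiv_identified b1 b2 b3 N N' \<longleftrightarrow>
     (\<exists>A. unitary3 A \<and> (\<forall>s. A ** Gmat b1 b2 b3 s = Gmat b1 b2 b3 s ** A) \<and>
          (\<lambda>z. A *v z) ` N = N')"

definition cone_T2 :: "(complex \<times> complex) set" where
  "cone_T2 = {(z, w). norm z = norm w}"

end

theory Submission
  imports Defs
begin

text \<open>A cone that is invariant under the circle group with generator \<open>X z = (\<i> b\<^sub>j z\<^sub>j)\<close> is
  special Lagrangian as soon as its link lies in the zero set of the moment map
  \<open>\<Sum> b\<^sub>j |z\<^sub>j|\<^sup>2\<close> and is swept out by the group from an integral curve of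
  \<open>Y z\<close>, the conjugate of the complex cross product of \<open>z\<close> and \<open>X z\<close>. This flow is integrable: with \<open>c = (b\<^sub>2 - b\<^sub>3, b\<^sub>3 - b\<^sub>1, b\<^sub>1 - b\<^sub>2)\<close> one
  has \<open>|w\<^sub>j|\<^sup>2 = 1 + c\<^sub>j v\<close>, the real part \<open>A\<close> of \<open>w\<^sub>1 w\<^sub>2 w\<^sub>3\<close> is constant, and \<open>v\<close>
  oscillates between two roots of a cubic minus \<open>A\<^sup>2\<close>. Parametrizing the oscillation by an angle
  makes the curve explicit up to quadratures for the phases. After one period the curve returns
  up to a diagonal matrix, and it closes up modulo the circle group iff a certain period
  \<open>\<Phi>(A)\<close> is a rational multiple of \<open>2 \<pi>\<close>. The function \<open>\<Phi>\<close> is continuous and, by a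
  second order expansion at the homogeneous torus \<open>v = 0\<close>, not constant, so this happens
  for infinitely many \<open>A\<close>; and \<open>A\<close> is recovered from the cone as the minimum of
  \<open>|z\<^sub>1 z\<^sub>2 z\<^sub>3|\<close> on the link.

  Any unitary symmetry maps the moment map to a Hermitian form that vanishes on the cone.
  Fourier analysis along the circle orbits shows that such forms are multiples of the moment map, hence a
  symmetry near the identity is diagonal, and the diagonal symmetries are finitely many
  cosets of the circle group.\<close>

section \<open>Preliminaries\<close>

text \<open>The vectors \<open>(1,1,1)\<close>, \<open>b\<close> and \<open>c\<close> are mutually
  orthogonal. Hence fixing the norm and the moment map leaves one parameter \<open>v\<close> for the
  moduli. The phases gained in one period sum to zero, so modulo the circle group only their
  component along \<open>c\<close> counts; this is why a single number decides whether the curve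
  closes.

  The roots of the cubic are not explicit in terms of \<open>A\<close>. The auxiliary parameter
  \<open>e\<close> makes them explicit, at the price of working only for small \<open>e\<close>. By
  continuity one strict inequality \<open>Phi e < Phi 0\<close> already yields infinitely many
  rational values, so a polynomial upper bound for the integrand replaces its exact expansion. The
  homogeneous torus \<open>e = 0\<close> itself is left out: \<open>v\<close> is constant there,
  while the Hermitian forms vanishing on the cone are determined by letting \<open>v\<close> vary.

  Smoothness asks for a class of maps stable under differentiation. The differential equation
  supplies it, because the derivatives of the curve are polynomials in finitely many
  functions.\<close>

lemma inverse_sqrt_upper:
  fixes s :: real
  assumes "\<bar>s\<bar> \<le> 1/4"
  shows "1 / sqrt (1 - s) \<le> 1 + s/2 + s\<^sup>2/2"
proof -
  have p: "1 - s > 0" "1 + s/2 + s\<^sup>2/2 \<ge> 0" using assms zero_le_power2[of s] by linarith+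
  \<comment> \<open>The difference begins with \<open>s^2/4\<close>, twice the gap between the
    coefficient 1/2 used here and the Taylor coefficient 3/8; this slack absorbs the higher terms
    for either sign of \<open>s\<close>.\<close>
  have "(1 + s/2 + s\<^sup>2/2)\<^sup>2 * (1 - s) - 1 = s\<^sup>2 * (1/4 - 3/4 * s - s\<^sup>2/4 - s\<^sup>2 * s/4)"
    by (simp add: field_simps power2_eq_square)
  moreover have "1/4 - 3/4 * s - s\<^sup>2/4 - s\<^sup>2 * s/4 \<ge> 0"
  proof -
    have a: "s\<^sup>2 \<le> 1/16" using power_mono[of "\<bar>s\<bar>" "1/4" 2] assms by (simp add: power_divide)
    have "s\<^sup>2 * s \<le> s\<^sup>2 * (1/4)" using assms by (intro mult_left_mono) auto
    then show ?thesis using a assms by linarith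
  qed
  ultimately have "(1 + s/2 + s\<^sup>2/2)\<^sup>2 * (1 - s) \<ge> 1"
    by (metis diff_ge_0_iff_ge mult_nonneg_nonneg zero_le_power2)
  then have "sqrt ((1 + s/2 + s\<^sup>2/2)\<^sup>2 * (1 - s)) \<ge> sqrt 1" by (rule real_sqrt_le_mono)
  then have "(1 + s/2 + s\<^sup>2/2) * sqrt (1 - s) \<ge> 1"
    using p(2) unfolding real_sqrt_mult real_sqrt_abs by simp
  then show ?thesis using p(1) by (simp only: divide_le_eq real_sqrt_gt_0_iff if_True)
qed

text \<open>The remainder is kept as an explicit expression instead of an order symbol, so that
  compactness can bound it later.\<close>

lemma second_order_remainder_mult:
  fixes e :: real
  assumes "f = a + e\<^sup>2 * al + e^3 * r" "g = b + e\<^sup>2 * be + e^3 * s"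
  shows "f * g = a * b + e\<^sup>2 * (a * be + b * al)
     + e^3 * (a * s + b * r + e * al * be + e\<^sup>2 * (al * s + be * r) + e^3 * r * s)"
  unfolding assms by (simp add: algebra_simps power2_eq_square power3_eq_cube)

lemma cos_integrals:
  "(cos has_integral 0) {0..2*pi}" "((\<lambda>t::real. (cos t)\<^sup>2) has_integral pi) {0..2*pi}"
proof -
  have "(cos has_integral sin (2*pi) - sin 0) {0..2*pi}"
    by (intro fundamental_theorem_of_calculus)
       (auto intro!: derivative_eq_intros simp flip: has_real_derivative_iff_has_vector_derivative)
  then show "(cos has_integral 0) {0..2*pi}" by simp
  have "((\<lambda>t. (cos t)\<^sup>2) has_integral (2*pi/2 + sin (2*pi) * cos (2*pi) / 2) - (0/2 + sin 0 * cos 0 / 2)) {0..2*pi}"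
  proof (rule fundamental_theorem_of_calculus)
    fix t :: real
    have "((\<lambda>t. t/2 + sin t * cos t / 2) has_real_derivative (cos t)\<^sup>2) (at t within {0..2*pi})"
      by (auto intro!: derivative_eq_intros simp: sin_squared_eq field_simps simp flip: power2_eq_square)
    then show "((\<lambda>t. t/2 + sin t * cos t / 2) has_vector_derivative (cos t)\<^sup>2) (at t within {0..2*pi})"
      by (simp add: has_real_derivative_iff_has_vector_derivative)
  qed simp
  then show "((\<lambda>t. (cos t)\<^sup>2) has_integral pi) {0..2*pi}" by simp
qed

lemma cis_eq_iff: "cis s = cis t \<longleftrightarrow> (\<exists>k::int. s = t + 2 * pi * k)"
  using sin_cos_eq_iff[of s t] by (auto simp: complex_eq_iff)

text \<open>For charts centred at the angle \<open>s\<close>: rotating by \<open>- s\<close> moves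
  the branch cut of \<open>Arg\<close> opposite to the centre.\<close>

lemma cis_Arg_rotate:
  assumes "z \<noteq> 0"
  shows "of_real (norm z) * cis (s + Arg (z * cis (- s))) = z"
proof -
  have "of_real (norm z) * cis (s + Arg (z * cis (- s))) = of_real (norm z) * (cis s * sgn (z * cis (- s)))"
    using assms by (simp add: cis_mult[symmetric] cis_Arg)
  also have "\<dots> = of_real (norm z) * sgn z * (cis s * cis (- s))" by (simp add: sgn_mult sgn_cis)
  also have "\<dots> = z" using assms by (simp add: cis_mult sgn_div_norm scaleR_conv_of_real)
  finally show ?thesis .
qed

text \<open>Closure of the generators under differentiation yields the witness class required by \<open>smooth_on\<close>.\<close>
inductive_set generated_algebra :: "('a \<Rightarrow> complex) set \<Rightarrow> ('a \<Rightarrow> complex) set" for S where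
  gen: "f \<in> S \<Longrightarrow> f \<in> generated_algebra S"
| const: "(\<lambda>x. k) \<in> generated_algebra S"
| add: "f \<in> generated_algebra S \<Longrightarrow> g \<in> generated_algebra S \<Longrightarrow> (\<lambda>x. f x + g x) \<in> generated_algebra S"
| mult: "f \<in> generated_algebra S \<Longrightarrow> g \<in> generated_algebra S \<Longrightarrow> (\<lambda>x. f x * g x) \<in> generated_algebra S"

lemma generated_algebra_derivative:
  fixes S :: "('a::real_normed_vector \<Rightarrow> complex) set"
  assumes "\<And>f. f \<in> S \<Longrightarrow> \<exists>f'. (\<forall>x. (f has_derivative f' x) (at x)) \<and> (\<forall>v. (\<lambda>x. f' x v) \<in> generated_algebra S)"
    and "f \<in> generated_algebra S"
  shows "\<exists>f'. (\<forall>x. (f has_derivative f' x) (at x)) \<and> (\<forall>v. (\<lambda>x. f' x v) \<in> generated_algebra S)"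
  using assms(2)
proof induction
  case (gen f)
  then show ?case by (rule assms(1))
next
  case (const k)
  show ?case
    by (rule exI[of _ "\<lambda>x v. 0"]) (auto intro: generated_algebra.const)
next
  case (add f g)
  then obtain f' g' where d: "\<forall>x. (f has_derivative f' x) (at x)" "\<forall>v. (\<lambda>x. f' x v) \<in> generated_algebra S"
    "\<forall>x. (g has_derivative g' x) (at x)" "\<forall>v. (\<lambda>x. g' x v) \<in> generated_algebra S" by blast
  show ?case
    by (rule exI[of _ "\<lambda>x v. f' x v + g' x v"])
       (use d in \<open>auto intro!: generated_algebra.add has_derivative_add\<close>)
next
  case (mult f g)
  then obtain f' g' where d: "\<forall>x. (f has_derivative f' x) (at x)" "\<forall>v. (\<lambda>x. f' x v) \<in> generated_algebra S"
    "\<forall>x. (g has_derivative g' x) (at x)" "\<forall>v. (\<lambda>x. g' x v) \<in> generated_algebra S" by blast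
  show ?case
    by (rule exI[of _ "\<lambda>x v. f x * g' x v + f' x v * g x"])
       (use d mult.hyps in \<open>auto intro!: generated_algebra.add generated_algebra.mult has_derivative_mult\<close>)
qed

lemma has_derivative_vec_componentwise:
  fixes f :: "'a::real_normed_vector \<Rightarrow> 'b::euclidean_space^'n"
  assumes "\<And>i. ((\<lambda>x. f x $ i) has_derivative (\<lambda>v. f' v $ i)) (at x)"
  shows "(f has_derivative f') (at x)"
  unfolding has_derivative_componentwise_within[of f]
  using has_derivative_inner_left[OF assms] by (auto simp: Basis_vec_def inner_axis)

lemma smooth_on_generated_algebra:
  fixes S :: "('a::real_normed_vector \<Rightarrow> complex) set" and \<phi> :: "'a \<Rightarrow> complex^'n"
  assumes "\<And>f. f \<in> S \<Longrightarrow> \<exists>f'. (\<forall>x. (f has_derivative f' x) (at x)) \<and> (\<forall>v. (\<lambda>x. f' x v) \<in> generated_algebra S)"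
    and "\<And>i. (\<lambda>x. \<phi> x $ i) \<in> generated_algebra S"
  shows "smooth_on W \<phi>"
  unfolding smooth_on_def
proof (intro exI[of _ "{g. \<forall>i. (\<lambda>x. g x $ i) \<in> generated_algebra S}"] conjI ballI)
  show "\<phi> \<in> {g. \<forall>i. (\<lambda>x. g x $ i) \<in> generated_algebra S}" using assms(2) by simp
next
  fix g :: "'a \<Rightarrow> complex^'n" assume "g \<in> {g. \<forall>i. (\<lambda>x. g x $ i) \<in> generated_algebra S}"
  then have "\<forall>i. \<exists>f'. (\<forall>x. ((\<lambda>x. g x $ i) has_derivative f' x) (at x)) \<and> (\<forall>v. (\<lambda>x. f' x v) \<in> generated_algebra S)"
    using generated_algebra_derivative[OF assms(1)] by blast
  then obtain d where d: "\<And>i x. ((\<lambda>x. g x $ i) has_derivative d i x) (at x)"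
    "\<And>i v. (\<lambda>x. d i x v) \<in> generated_algebra S" by metis
  have "(g has_derivative (\<lambda>v. \<chi> i. d i x v)) (at x)" for x
    by (rule has_derivative_vec_componentwise) (simp add: d(1))
  then show "\<exists>g'. (\<forall>x\<in>W. (g has_derivative g' x) (at x)) \<and>
      (\<forall>v. (\<lambda>x. g' x v) \<in> {g. \<forall>i. (\<lambda>x. g x $ i) \<in> generated_algebra S})"
    using d(2) by (intro exI[of _ "\<lambda>x v. \<chi> i. d i x v"]) simp
qed

lemma has_vector_derivative_cis:
  assumes "(f has_real_derivative d) (at t)"
  shows "((\<lambda>t. cis (f t)) has_vector_derivative d *\<^sub>R (\<i> * cis (f t))) (at t)"
  using has_derivative_cis[of f "(*) d" t UNIV] assms
  unfolding has_vector_derivative_def has_field_derivative_def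
  by (simp add: mult.commute)

text \<open>Differentiating the sum and subtracting \<open>\<i> k0\<close> times the sum removes the
  frequency \<open>k0\<close>; the induction hypothesis then applies to the coefficients
  \<open>\<i> (k - k0) C k\<close>.\<close>

lemma exponential_sum_zero:
  fixes C :: "int \<Rightarrow> complex"
  assumes "finite S" and "\<And>s::real. (\<Sum>k\<in>S. C k * cis (of_int k * s)) = 0"
  shows "\<forall>k\<in>S. C k = 0"
  using assms
proof (induction S arbitrary: C rule: finite_induct)
  case empty
  then show ?case by simp
next
  case (insert k0 S)
  have v: "((\<lambda>s. cis (of_int k * s)) has_vector_derivative \<i> * of_int k * cis (of_int k * s)) (at s)" for k s
    using has_vector_derivative_cis[OF DERIV_cmult_Id[of "real_of_int k" s UNIV]]
    by (simp add: scaleR_conv_of_real mult_ac)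
  have "(\<Sum>k\<in>S. (\<i> * of_int (k - k0) * C k) * cis (of_int k * s)) = 0" for s
  proof -
    have "((\<lambda>s. \<Sum>k\<in>insert k0 S. C k * cis (of_int k * s)) has_vector_derivative
        (\<Sum>k\<in>insert k0 S. C k * (\<i> * of_int k * cis (of_int k * s)))) (at s)"
      by (intro has_vector_derivative_sum has_vector_derivative_mult_right v)
    then have "((\<lambda>s::real. 0) has_vector_derivative
        (\<Sum>k\<in>insert k0 S. C k * (\<i> * of_int k * cis (of_int k * s)))) (at s)"
      unfolding insert.prems .
    then have "(\<Sum>k\<in>insert k0 S. C k * (\<i> * of_int k * cis (of_int k * s))) = 0"
      using vector_derivative_unique_at has_vector_derivative_const by blast
    then have "(\<Sum>k\<in>insert k0 S. C k * (\<i> * of_int k * cis (of_int k * s)))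
        - \<i> * of_int k0 * (\<Sum>k\<in>insert k0 S. C k * cis (of_int k * s)) = 0"
      unfolding insert.prems by simp
    then show ?thesis
      using insert.hyps by (simp add: sum_distrib_left sum_subtractf[symmetric] algebra_simps)
  qed
  then have z: "\<forall>k\<in>S. \<i> * of_int (k - k0) * C k = 0" by (rule insert.IH)
  have "C k = 0" if "k \<in> S" for k
    using z that insert.hyps by (metis eq_iff_diff_eq_0 complex_i_not_zero mult_eq_0_iff of_int_eq_0_iff)
  moreover from this have "C k0 = 0"
    using insert.prems[of 0] insert.hyps by simp
  ultimately show ?case by simp
qed

lemma generator_compose_linear:
  fixes l :: "'a::real_normed_vector \<Rightarrow> real"
  assumes "bounded_linear l" "\<And>t. (f has_vector_derivative f' t) (at t)"
    and "(\<lambda>p. f' (l p)) \<in> generated_algebra S"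
  shows "\<exists>d. (\<forall>x. ((\<lambda>p. f (l p)) has_derivative d x) (at x)) \<and> (\<forall>v. (\<lambda>x. d x v) \<in> generated_algebra S)"
proof (intro exI[of _ "\<lambda>x v. of_real (l v) * f' (l x)"] conjI allI)
  fix x
  have "((\<lambda>p. f (l p)) has_derivative (\<lambda>v. l v *\<^sub>R f' (l x))) (at x)"
    using has_derivative_compose[OF bounded_linear_imp_has_derivative[OF assms(1)], of f] assms(2)[of "l x"]
    by (simp add: has_vector_derivative_def)
  then show "((\<lambda>p. f (l p)) has_derivative (\<lambda>v. of_real (l v) * f' (l x))) (at x)"
    by (simp add: scaleR_conv_of_real)
next
  fix v
  show "(\<lambda>x. of_real (l v) * f' (l x)) \<in> generated_algebra S"
    by (intro generated_algebra.mult generated_algebra.const assms(3))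
qed

section \<open>Linear algebra of complex 3-space, unitary matrices and tangent spaces\<close>

lemma norm_C3: "(norm (z :: C3))\<^sup>2 = (cmod (z $ 1))\<^sup>2 + (cmod (z $ 2))\<^sup>2 + (cmod (z $ 3))\<^sup>2"
  unfolding norm_vec_def L2_set_def by (simp add: sum_3)

lemma inner_C3: "(u::C3) \<bullet> v = Re (u $ 1 * cnj (v $ 1)) + Re (u $ 2 * cnj (v $ 2)) + Re (u $ 3 * cnj (v $ 3))"
  by (simp add: inner_vec_def sum_3 inner_complex_def)

lemma C3_eq_iff: "(u::C3) = v \<longleftrightarrow> u $ 1 = v $ 1 \<and> u $ 2 = v $ 2 \<and> u $ 3 = v $ 3"
  by (simp add: vec_eq_iff forall_3)

lemma Omega_scaleR: "Omega (p *\<^sub>R u) (q *\<^sub>R v) (r *\<^sub>R z) = of_real (p * q * r) * Omega u v z"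
proof -
  have s: "(k *\<^sub>R (y::C3)) $ i = of_real k * y $ i" for k y i
    unfolding vector_scaleR_component by (rule scaleR_conv_of_real)
  show ?thesis unfolding Omega_def det_3 by (simp add: s algebra_simps del: vector_scaleR_component)
qed

lemma unitary3_rows:
  assumes "unitary3 A"
  shows "(\<Sum>i\<in>UNIV. A $ k $ i * cnj (A $ l $ i)) = (if k = l then 1 else 0)"
proof -
  have "(A ** adjoint3 A) $ k $ l = (mat 1 :: M3) $ k $ l" using assms by (simp add: unitary3_def)
  then show ?thesis by (simp add: matrix_matrix_mult_def adjoint3_def mat_def)
qed

lemma unitary3_columns:
  assumes "unitary3 A"
  shows "(\<Sum>i\<in>UNIV. cnj (A $ i $ k) * A $ i $ l) = (if k = l then 1 else 0)"
proof -
  have "adjoint3 A ** A = mat 1"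
    using assms matrix_left_right_inverse unfolding unitary3_def by blast
  then have "(adjoint3 A ** A) $ k $ l = (mat 1 :: M3) $ k $ l" by simp
  then show ?thesis by (simp add: matrix_matrix_mult_def adjoint3_def mat_def)
qed

lemma unitary3_diagonal_entry:
  assumes "unitary3 A" and diag: "\<And>k j. k \<noteq> j \<Longrightarrow> A $ k $ j = 0"
  shows "cmod (A $ j $ j) = 1"
proof -
  have "(\<Sum>i\<in>UNIV. A $ j $ i * cnj (A $ j $ i)) = (\<Sum>i\<in>UNIV. if i = j then A $ j $ j * cnj (A $ j $ j) else 0)"
    by (intro sum.cong refl) (use diag in auto)
  then have "A $ j $ j * cnj (A $ j $ j) = 1" using unitary3_rows[OF assms(1), of j j] by simp
  then have "of_real ((cmod (A $ j $ j))\<^sup>2) = (1::complex)" unfolding complex_norm_square .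
  then show ?thesis by (metis norm_ge_zero of_real_eq_1_iff one_power2 power2_eq_imp_eq zero_le_one)
qed

lemma diagonal_mult_nth:
  fixes A :: M3
  assumes "\<And>k j. k \<noteq> j \<Longrightarrow> A $ k $ j = 0"
  shows "(A *v z) $ j = A $ j $ j * z $ j"
proof -
  have "(A *v z) $ j = (\<Sum>i\<in>UNIV. if i = j then A $ j $ j * z $ j else 0)"
    unfolding matrix_vector_mult_def vec_lambda_beta by (intro sum.cong refl) (use assms in auto)
  then show ?thesis by simp
qed

text \<open>The map has the triangular shape of the derivative of the cone parametrization: its
  third column mixes the orbit direction \<open>v\<close> with the curve direction
  \<open>z\<close>.\<close>

lemma range_three:
  fixes u v z :: "'a::real_vector"
  assumes "p \<noteq> 0" "r \<noteq> 0"
  shows "range (\<lambda>x::real^3. (x $ 1) *\<^sub>R u + (x $ 2) *\<^sub>R (p *\<^sub>R v) + (x $ 3) *\<^sub>R (q *\<^sub>R v + r *\<^sub>R z)) = span {u, v, z}"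
proof
  show "range (\<lambda>x::real^3. (x $ 1) *\<^sub>R u + (x $ 2) *\<^sub>R (p *\<^sub>R v) + (x $ 3) *\<^sub>R (q *\<^sub>R v + r *\<^sub>R z)) \<subseteq> span {u, v, z}"
    by (rule image_subsetI, intro span_add span_scale span_base) simp_all
  show "span {u, v, z} \<subseteq> range (\<lambda>x::real^3. (x $ 1) *\<^sub>R u + (x $ 2) *\<^sub>R (p *\<^sub>R v) + (x $ 3) *\<^sub>R (q *\<^sub>R v + r *\<^sub>R z))"
  proof
    fix y assume "y \<in> span {u, v, z}"
    then obtain k l m where "y - k *\<^sub>R u - l *\<^sub>R v = m *\<^sub>R z"
      by (auto simp: span_breakdown_eq)
    then have y: "y = k *\<^sub>R u + l *\<^sub>R v + m *\<^sub>R z" by (simp add: algebra_simps)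
    have "y = k *\<^sub>R u + ((l - m / r * q) / p) *\<^sub>R (p *\<^sub>R v) + (m / r) *\<^sub>R (q *\<^sub>R v + r *\<^sub>R z)"
      unfolding y using assms by (simp add: scaleR_add_right scaleR_diff_left)
    then show "y \<in> range (\<lambda>x::real^3. (x $ 1) *\<^sub>R u + (x $ 2) *\<^sub>R (p *\<^sub>R v) + (x $ 3) *\<^sub>R (q *\<^sub>R v + r *\<^sub>R z))"
      by (intro image_eqI[of _ _ "vector [k, (l - m / r * q) / p, m / r]"]) auto
  qed
qed

lemma inj_three:
  fixes u v z :: "'a::real_inner"
  assumes "p \<noteq> 0" "r \<noteq> 0" "u \<noteq> 0" "v \<noteq> 0" "z \<noteq> 0" "u \<bullet> v = 0" "u \<bullet> z = 0" "v \<bullet> z = 0"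
  shows "inj (\<lambda>x::real^3. (x $ 1) *\<^sub>R u + (x $ 2) *\<^sub>R (p *\<^sub>R v) + (x $ 3) *\<^sub>R (q *\<^sub>R v + r *\<^sub>R z))" (is "inj ?f")
proof -
  have "linear ?f" by (intro linearI) (simp_all add: algebra_simps)
  moreover have "x = 0" if "?f x = 0" for x
  proof -
    have o: "z \<bullet> u = 0" "z \<bullet> v = 0" "v \<bullet> u = 0" using assms by (simp_all add: inner_commute)
    have "z \<bullet> ?f x = x $ 3 * r * (z \<bullet> z)" "v \<bullet> ?f x = (x $ 2 * p + x $ 3 * q) * (v \<bullet> v)"
      "u \<bullet> ?f x = x $ 1 * (u \<bullet> u)"
      using assms o by (simp_all add: inner_add_right distrib_right)
    then have "x $ 3 = 0" "x $ 2 * p + x $ 3 * q = 0" "x $ 1 = 0"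
      using assms unfolding that by auto
    then show ?thesis using assms by (simp add: vec_eq_iff forall_3)
  qed
  ultimately show ?thesis by (simp add: linear_injective_0)
qed

text \<open>A chart at the vertex approximates the points \<open>t z\<close> for small
  \<open>t\<close> by values of its derivative \<open>D\<close>, with an error small relative to
  \<open>t\<close>. Rescaling by \<open>1/t\<close> brings \<open>t z\<close> back to
  \<open>z\<close>, so \<open>z\<close> is a limit of points of \<open>range D\<close>, which is
  closed.\<close>

lemma cone_subset_tangent:
  assumes cone: "is_cone S" and chart: "chart3 S 0 U V \<phi>"
  shows "\<exists>D :: real^3 \<Rightarrow> C3. linear D \<and> S \<subseteq> range D"
proof -
  have ch: "open U" "0 \<in> U" "open V" "\<phi> ` V = S \<inter> U" "inj_on \<phi> V" "continuous_on (S \<inter> U) (inv_into V \<phi>)"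
    "\<And>x. x \<in> V \<Longrightarrow> \<exists>\<phi>'. (\<phi> has_derivative \<phi>') (at x) \<and> inj \<phi>'"
    using chart unfolding chart3_def by auto
  have S0: "0 \<in> S" using cone by (simp add: is_cone_def)
  define x0 where "x0 = inv_into V \<phi> 0"
  have im: "x \<in> \<phi> ` V" if "x \<in> S" "x \<in> U" for x using ch(4) that by blast
  have x0: "x0 \<in> V" "\<phi> x0 = 0" unfolding x0_def using im[OF S0 ch(2)] by (auto intro: inv_into_into f_inv_into_f)
  obtain D where D: "(\<phi> has_derivative D) (at x0)" "inj D" using ch(7)[OF x0(1)] by blast
  have lin: "linear D" using D(1) by (rule has_derivative_linear)
  obtain B where B: "B > 0" "\<And>x. B * norm x \<le> norm (D x)" using linear_inj_bounded_below_pos[OF lin D(2)] by metis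
  have "z \<in> range D" if z: "z \<in> S" for z
  proof -
    have "\<exists>v\<in>range D. dist v z < \<epsilon>" if "\<epsilon> > 0" for \<epsilon> :: real
    proof -
      \<comment> \<open>The bound \<open>B / 2\<close> lets the error be absorbed into the lower
        bound for \<open>D\<close>, which gives \<open>norm u\<close> of order \<open>t\<close>; the
        other bound then pushes the error below \<open>t * \<epsilon>\<close>.\<close>
      define \<eta> where "\<eta> = min (B / 2) (\<epsilon> * B / (4 * (norm z + 1)))"
      have nz: "norm z + 1 > 0" using norm_ge_zero[of z] by linarith
      have \<eta>: "\<eta> > 0" "\<eta> \<le> B / 2" "\<eta> \<le> \<epsilon> * B / (4 * (norm z + 1))"
      proof -
        show "\<eta> > 0" unfolding \<eta>_def using B(1) that nz by simp
      qed (unfold \<eta>_def, rule min.cobounded1, rule min.cobounded2)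
      obtain d where d: "d > 0" "\<And>y. norm (y - x0) < d \<Longrightarrow> norm (\<phi> y - \<phi> x0 - D (y - x0)) \<le> \<eta> * norm (y - x0)"
        using D(1) \<eta>(1) unfolding has_derivative_at_alt by blast
      obtain \<delta> where \<delta>: "\<delta> > 0" "\<And>x. x \<in> S \<inter> U \<Longrightarrow> dist x 0 < \<delta> \<Longrightarrow> dist (inv_into V \<phi> x) (inv_into V \<phi> 0) < d"
        using ch(6) S0 ch(2) d(1) unfolding continuous_on_iff by (metis IntI)
      obtain \<rho> where \<rho>: "\<rho> > 0" "ball 0 \<rho> \<subseteq> U" using ch(1,2) openE by blast
      define t where "t = min \<delta> \<rho> / (norm z + 1)"
      have t: "t > 0" unfolding t_def using \<delta>(1) \<rho>(1) nz by simp
      have "norm (t *\<^sub>R z) < min \<delta> \<rho>"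
      proof -
        have "norm (t *\<^sub>R z) = min \<delta> \<rho> * (norm z / (norm z + 1))" using t \<delta>(1) \<rho>(1) by (simp add: t_def)
        also have "\<dots> < min \<delta> \<rho> * 1" using \<delta>(1) \<rho>(1) nz by (intro mult_strict_left_mono) auto
        finally show ?thesis by simp
      qed
      then have small: "dist (t *\<^sub>R z) 0 < \<delta>" "t *\<^sub>R z \<in> U" using \<rho>(2) by (auto simp: dist_norm)
      have tS: "t *\<^sub>R z \<in> S" using cone z t unfolding is_cone_def by blast
      define y where "y = inv_into V \<phi> (t *\<^sub>R z)"
      have \<phi>y: "\<phi> y = t *\<^sub>R z" unfolding y_def using im[OF tS small(2)] by (rule f_inv_into_f)
      define u where "u = y - x0"
      have "norm u < d" using \<delta>(2)[of "t *\<^sub>R z"] tS small unfolding u_def y_def x0_def dist_norm by blast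
      then have est: "norm (t *\<^sub>R z - D u) \<le> \<eta> * norm u" using d(2)[of y] \<phi>y x0(2) unfolding u_def by simp
      have "B * norm u \<le> norm (D u)" by (rule B(2))
      also have "\<dots> \<le> norm (t *\<^sub>R z) + norm (t *\<^sub>R z - D u)"
        using norm_triangle_sub[of "D u" "t *\<^sub>R z"] by (simp add: norm_minus_commute)
      also have "\<dots> \<le> t * norm z + B / 2 * norm u"
        using est \<eta>(2) t mult_right_mono[OF \<eta>(2) norm_ge_zero[of u]] by simp
      finally have "norm u \<le> 2 * t * norm z / B" using B(1) by (simp add: field_simps)
      then have "norm (t *\<^sub>R z - D u) \<le> \<eta> * (2 * t * norm z / B)"
        using est \<eta>(1) mult_left_mono[of "norm u" "2 * t * norm z / B" \<eta>] by linarith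
      also have "\<dots> \<le> \<epsilon> * B / (4 * (norm z + 1)) * (2 * t * norm z / B)"
        using \<eta>(3) t B(1) by (intro mult_right_mono) auto
      also have "\<dots> = t * (\<epsilon> / 2 * (norm z / (norm z + 1)))" using B(1) nz by (simp add: field_simps)
      also have "\<dots> < t * \<epsilon>"
      proof -
        have "norm z / (norm z + 1) \<le> 1" using nz by simp
        then have "\<epsilon> / 2 * (norm z / (norm z + 1)) \<le> \<epsilon> / 2 * 1" using that by (intro mult_left_mono) auto
        also have "\<dots> < \<epsilon>" using that by simp
        finally show ?thesis using t by (rule mult_strict_left_mono)
      qed
      finally have "norm (t *\<^sub>R z - D u) < t * \<epsilon>" .
      moreover have "t *\<^sub>R z - D u = t *\<^sub>R (z - D ((1 / t) *\<^sub>R u))"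
        using t by (simp add: linear_scale[OF lin] algebra_simps)
      ultimately have "norm (z - D ((1 / t) *\<^sub>R u)) < \<epsilon>" using t by simp
      then show ?thesis by (intro bexI[of _ "D ((1 / t) *\<^sub>R u)"]) (auto simp: dist_norm norm_minus_commute)
    qed
    then have "z \<in> closure (range D)" unfolding closure_approachable by blast
    moreover have "closed (range D)" using lin by (intro closed_subspace linear_subspace_image) auto
    ultimately show ?thesis by (simp add: closure_closed)
  qed
  then show ?thesis using lin by blast
qed

text \<open>Pairing \<open>f\<close> with the component \<open>z\<close> of \<open>d\<close>
  orthogonal to \<open>V\<close> gives a function that vanishes identically, so \<open>z\<close> is
  orthogonal to \<open>d\<close> and hence zero.\<close>

lemma derivative_in_subspace:
  fixes f :: "real \<Rightarrow> 'a::euclidean_space"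
  assumes V: "subspace V" and f: "\<And>s. f s \<in> V" and d: "(f has_vector_derivative d) (at s)"
  shows "d \<in> V"
proof -
  obtain y z where yz: "y \<in> span V" "\<And>x. x \<in> span V \<Longrightarrow> orthogonal z x" "d = y + z"
    using orthogonal_subspace_decomp_exists[of V d] by metis
  have V': "span V = V" using V by (simp add: span_eq_iff)
  have "((\<lambda>s. z \<bullet> f s) has_vector_derivative z \<bullet> d) (at s)"
    by (rule bounded_linear.has_vector_derivative[OF bounded_linear_inner_right d])
  moreover have "(\<lambda>s. z \<bullet> f s) = (\<lambda>s. 0)" using yz(2) f unfolding V' orthogonal_def by auto
  ultimately have "z \<bullet> d = 0"
    by (metis has_vector_derivative_const vector_derivative_unique_at)
  moreover have "z \<bullet> y = 0" using yz(1,2) unfolding orthogonal_def by blast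
  ultimately have "z = 0" unfolding yz(3) by (simp add: inner_add_right)
  then show ?thesis using yz(1,3) V' by simp
qed

section \<open>Polar coordinates on the model cone over the torus\<close>

lemma closed_cone_T2: "closed cone_T2"
  unfolding cone_T2_def case_prod_beta' by (intro closed_Collect_eq continuous_intros)

lemma cone_T2_polar:
  assumes "p \<in> cone_T2"
  obtains r s t where "r \<ge> 0" "p = (of_real r * cis s, of_real r * cis t)" "r = norm (fst p)"
proof (rule that)
  show "p = (of_real (norm (fst p)) * cis (Arg (fst p)), of_real (norm (fst p)) * cis (Arg (snd p)))"
  proof (rule prod_eqI)
    have "norm (fst p) = norm (snd p)" using assms by (auto simp: cone_T2_def)
    then show "snd p = snd (of_real (norm (fst p)) * cis (Arg (fst p)), of_real (norm (fst p)) * cis (Arg (snd p)))"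
      using rcis_cmod_Arg[of "snd p", unfolded rcis_def] unfolding snd_conv by (simp only:)
    show "fst p = fst (of_real (norm (fst p)) * cis (Arg (fst p)), of_real (norm (fst p)) * cis (Arg (snd p)))"
      unfolding fst_conv by (rule rcis_cmod_Arg[of "fst p", unfolded rcis_def, symmetric])
  qed
  show "0 \<le> norm (fst p)" by (rule norm_ge_zero)
qed (rule refl)

lemma polar_in_cone_T2: "(of_real r * cis s, of_real r * cis t) \<in> cone_T2"
  by (simp add: cone_T2_def norm_mult)

section \<open>The reduced system and its period map\<close>

locale zero_sum_triple =
  fixes c :: "3 \<Rightarrow> real"
  assumes sum_c: "c 1 + c 2 + c 3 = 0"
    and c_nz: "c 1 \<noteq> 0" "c 2 \<noteq> 0" "c 3 \<noteq> 0"
begin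

text \<open>With \<open>x\<^sub>j = 1 + c\<^sub>j v\<close> the reduced equation is \<open>v'\<^sup>2 = 4 (Q(v) - A\<^sup>2)\<close>, where
  \<open>Q(v) = x\<^sub>1 x\<^sub>2 x\<^sub>3 = 1 - E v\<^sup>2 + K v\<^sup>3\<close>. The level \<open>A\<^sup>2\<close> is parametrized by \<open>e\<close> in such a way that
  all three roots of \<open>Q - A\<^sup>2\<close> are explicit: the motion takes place between \<open>K e\<^sup>2 \<plusminus> hh e\<close>, and
  \<open>LL\<close> is the remaining linear factor.\<close>
definition E :: real where "E = ((c 1)\<^sup>2 + (c 2)\<^sup>2 + (c 3)\<^sup>2) / 2"
definition K :: real where "K = c 1 * c 2 * c 3"
definition hh :: "real \<Rightarrow> real" where "hh e = e * sqrt (2 * E - 3 * K\<^sup>2 * e\<^sup>2)"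
definition vv :: "real \<Rightarrow> real \<Rightarrow> real" where "vv e t = K * e\<^sup>2 + hh e * cos t"
definition LL :: "real \<Rightarrow> real \<Rightarrow> real" where "LL e t = E - 3 * K\<^sup>2 * e\<^sup>2 - K * hh e * cos t"
definition A2 :: "real \<Rightarrow> real" where
  "A2 e = 1 - 2 * E\<^sup>2 * e\<^sup>2 + 8 * E * K\<^sup>2 * e^4 - 8 * K^4 * e^6"
definition AA :: "real \<Rightarrow> real" where "AA e = sqrt (A2 e)"
definition xx :: "real \<Rightarrow> 3 \<Rightarrow> real \<Rightarrow> real" where "xx e j t = 1 + c j * vv e t"
definition QQ :: "real \<Rightarrow> real" where "QQ v = 1 - E * v\<^sup>2 + K * v^3"
text \<open>Both \<open>c j\<close> and \<open>hh e / e\<close> are at most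
  \<open>sqrt (2 * E)\<close> in modulus, so \<open>E * e\<close> measures the relative oscillation
  of the moduli. Keeping it below 1/100 makes \<open>xx\<close> and \<open>A2\<close> at least 1/2
  and \<open>LL\<close> at least \<open>E / 2\<close>.\<close>

definition emax :: real where "emax = 1 / (100 * E)"

lemma E_pos: "E > 0"
  unfolding E_def using c_nz by (simp add: sum_power2_gt_zero_iff add_pos_nonneg)

lemma K_nz: "K \<noteq> 0"
  unfolding K_def using c_nz by simp

lemma emax_pos: "emax > 0"
  unfolding emax_def using E_pos by simp

lemma c3_eq: "c 3 = - c 1 - c 2"
  using sum_c by simp

lemma c_sq_le: "(c j)\<^sup>2 \<le> 2 * E"
  using exhaust_3[of j] unfolding E_def by auto

lemma K_sq_le: "K\<^sup>2 \<le> 8 * E^3"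
proof -
  have "K\<^sup>2 = (c 1)\<^sup>2 * (c 2)\<^sup>2 * (c 3)\<^sup>2"
    unfolding K_def by (simp add: power_mult_distrib)
  also have "\<dots> \<le> (2 * E) * (2 * E) * (2 * E)"
    using c_sq_le E_pos by (intro mult_mono mult_nonneg_nonneg) auto
  finally show ?thesis by (simp add: power3_eq_cube)
qed

lemma prod_xx_poly: "(1 + c 1 * v) * (1 + c 2 * v) * (1 + c 3 * v) = QQ v"
  unfolding QQ_def E_def K_def c3_eq by (simp add: field_simps power2_eq_square power3_eq_cube)

context
  fixes e :: real
  assumes e0: "0 \<le> e" and e1: "e \<le> emax"
begin

lemma Ee_le: "E * e \<le> 1/100"
  using e1 E_pos unfolding emax_def by (simp add: field_simps)

lemma Ee2_le: "E\<^sup>2 * e\<^sup>2 \<le> 1/10000"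
proof -
  have "(E * e)\<^sup>2 \<le> (1/100)\<^sup>2" using Ee_le e0 E_pos by (intro power_mono) auto
  then show ?thesis by (simp add: power_mult_distrib power_divide)
qed

lemma Ke2_le: "K\<^sup>2 * e\<^sup>2 \<le> E / 1000"
proof -
  have "K\<^sup>2 * e\<^sup>2 \<le> 8 * E^3 * e\<^sup>2" using K_sq_le by (intro mult_right_mono) auto
  also have "\<dots> = 8 * E * (E\<^sup>2 * e\<^sup>2)" by (simp add: power2_eq_square power3_eq_cube)
  also have "\<dots> \<le> 8 * E * (1/10000)" using Ee2_le E_pos by (intro mult_left_mono) auto
  finally show ?thesis using E_pos by simp
qed

lemma hh_sq: "(hh e)\<^sup>2 = e\<^sup>2 * (2 * E - 3 * K\<^sup>2 * e\<^sup>2)"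
proof -
  have "2 * E - 3 * K\<^sup>2 * e\<^sup>2 \<ge> 0" using Ke2_le E_pos by (simp add: mult.assoc)
  then show ?thesis unfolding hh_def by (simp add: power_mult_distrib)
qed

lemma hh_pos: "e > 0 \<Longrightarrow> hh e > 0"
  unfolding hh_def using Ke2_le E_pos by (simp add: mult.assoc)

lemma hh_sq_le: "(hh e)\<^sup>2 \<le> 2 * E * e\<^sup>2"
  unfolding hh_sq by (simp add: algebra_simps)

lemma K_hh_le: "\<bar>K * hh e\<bar> \<le> E / 10"
proof -
  have "(K * hh e)\<^sup>2 \<le> (K\<^sup>2 * e\<^sup>2) * (2 * E)"
    using mult_left_mono[OF hh_sq_le, of "K\<^sup>2"] by (simp add: power_mult_distrib algebra_simps)
  also have "\<dots> \<le> (E/1000) * (2 * E)" using Ke2_le E_pos by (intro mult_right_mono) auto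
  also have "\<dots> \<le> (E/10)\<^sup>2" by (simp add: power2_eq_square)
  finally show ?thesis using E_pos by (metis abs_le_square_iff abs_of_pos divide_pos_pos zero_less_numeral)
qed

lemma LL_lower: "LL e t \<ge> E / 2"
proof -
  have "\<bar>K * hh e * cos t\<bar> \<le> E / 10"
    using K_hh_le mult_mono[OF K_hh_le abs_cos_le_one[of t]] E_pos by (simp add: abs_mult)
  then show ?thesis unfolding LL_def using Ke2_le E_pos by linarith
qed

lemma LL_pos: "LL e t > 0"
  using LL_lower[of t] E_pos by linarith

lemma c_hh_le: "\<bar>c j * hh e\<bar> \<le> 1/10"
proof -
  have "(c j * hh e)\<^sup>2 \<le> (2 * E) * (2 * E * e\<^sup>2)"
    unfolding power_mult_distrib using c_sq_le hh_sq_le E_pos by (intro mult_mono) auto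
  also have "\<dots> = 4 * (E\<^sup>2 * e\<^sup>2)" by (simp add: power2_eq_square)
  also have "\<dots> \<le> (1/10)\<^sup>2" using Ee2_le by (simp add: power_divide)
  finally show ?thesis by (metis abs_le_square_iff abs_of_pos zero_less_divide_1_iff zero_less_numeral)
qed

lemma c_K_le: "\<bar>c j * (K * e\<^sup>2)\<bar> \<le> 1/10"
proof -
  have "(c j * (K * e\<^sup>2))\<^sup>2 = (c j)\<^sup>2 * (K\<^sup>2 * e\<^sup>2) * e\<^sup>2" by (simp add: power_mult_distrib power2_eq_square)
  also have "\<dots> \<le> (2 * E) * (E/1000) * e\<^sup>2"
    using c_sq_le Ke2_le E_pos by (intro mult_mono) auto
  also have "\<dots> = (E\<^sup>2 * e\<^sup>2) / 500" by (simp add: power2_eq_square)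
  also have "\<dots> \<le> 1/100" using Ee2_le by linarith
  also have "\<dots> = (1/10)\<^sup>2" by (simp add: power_divide)
  finally show ?thesis by (metis abs_le_square_iff abs_of_pos zero_less_divide_1_iff zero_less_numeral)
qed

lemma xx_lower: "xx e j t \<ge> 1/2"
proof -
  have "\<bar>c j * hh e * cos t\<bar> \<le> 1/10"
    using mult_mono[OF c_hh_le[of j] abs_cos_le_one[of t]] by (simp add: abs_mult)
  then show ?thesis using c_K_le[of j] unfolding xx_def vv_def by (simp add: algebra_simps abs_le_iff)
qed

lemma xx_pos: "xx e j t > 0"
  using xx_lower[of j t] by linarith

lemma A2_lower: "A2 e \<ge> 1/2"
proof -
  have "K^4 * e^6 = (K\<^sup>2 * e\<^sup>2) * (K\<^sup>2 * e\<^sup>2) * e\<^sup>2" by (simp add: power_def)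
  also have "\<dots> \<le> (E/1000) * (E/1000) * e\<^sup>2"
    using Ke2_le E_pos by (intro mult_mono) auto
  also have "\<dots> = (E\<^sup>2 * e\<^sup>2) / 1000000" by (simp add: power2_eq_square)
  finally have "K^4 * e^6 \<le> 1/1000" using Ee2_le by linarith
  moreover have "8 * E * K\<^sup>2 * e^4 \<ge> 0" using E_pos by simp
  ultimately show ?thesis unfolding A2_def using Ee2_le by linarith
qed

lemma AA_pos: "AA e > 0"
  unfolding AA_def using A2_lower by simp

lemma AA_sq: "(AA e)\<^sup>2 = A2 e"
  unfolding AA_def using A2_lower by simp

lemma QQ_vv: "QQ (vv e t) = (AA e)\<^sup>2 + (hh e)\<^sup>2 * (sin t)\<^sup>2 * LL e t"
proof -
  define y where "y = hh e * cos t"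
  have s: "(hh e)\<^sup>2 * (sin t)\<^sup>2 = (hh e)\<^sup>2 - y\<^sup>2"
    unfolding y_def sin_squared_eq by (simp add: power_mult_distrib algebra_simps)
  have "QQ (K * e\<^sup>2 + y) = A2 e + (e\<^sup>2 * (2 * E - 3 * K\<^sup>2 * e\<^sup>2) - y\<^sup>2) * (E - 3 * K\<^sup>2 * e\<^sup>2 - K * y)"
    unfolding QQ_def A2_def by algebra
  then have "QQ (K * e\<^sup>2 + y) = A2 e + ((hh e)\<^sup>2 - y\<^sup>2) * (E - 3 * K\<^sup>2 * e\<^sup>2 - K * y)"
    unfolding hh_sq .
  then show ?thesis unfolding AA_sq s vv_def LL_def by (simp add: y_def mult.assoc)
qed

end

text \<open>As a polynomial in \<open>e\<^sup>2\<close>, the level \<open>A2\<close> has a divided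
  difference dominated by \<open>- 2 * E\<^sup>2\<close> in the permitted range, so it cannot take a
  value twice.\<close>

lemma AA_inj:
  assumes "0 \<le> e" "e \<le> emax" "0 \<le> e'" "e' \<le> emax" "AA e = AA e'"
  shows "e = e'"
proof (rule ccontr)
  assume ne: "e \<noteq> e'"
  define p q where "p = e\<^sup>2" and "q = e'\<^sup>2"
  have pq: "p \<noteq> q" using ne assms by (simp add: p_def q_def)
  have "A2 e = A2 e'" using AA_sq assms by metis
  then have "(p - q) * (- 2 * E\<^sup>2 + 8 * E * K\<^sup>2 * (p + q) - 8 * K^4 * (p\<^sup>2 + p * q + q\<^sup>2)) = 0"
    unfolding A2_def p_def q_def by algebra
  then have "2 * E\<^sup>2 + 8 * K^4 * (p\<^sup>2 + p * q + q\<^sup>2) = 8 * E * (K\<^sup>2 * p + K\<^sup>2 * q)"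
    using pq by (simp add: distrib_left[of "8 * E"] mult.assoc) argo
  moreover have "8 * E * (K\<^sup>2 * p + K\<^sup>2 * q) \<le> 8 * E * (E/1000 + E/1000)"
    using Ke2_le assms E_pos unfolding p_def q_def by (intro mult_left_mono add_mono) auto
  moreover have "8 * K^4 * (p\<^sup>2 + p * q + q\<^sup>2) \<ge> 0" unfolding p_def q_def by simp
  moreover have "E\<^sup>2 > 0" using E_pos by simp
  ultimately show False by (simp add: power2_eq_square)
qed

text \<open>Along the flow of \<open>Y\<close> one has \<open>v' = - 2 FF\<close>, whereas
  \<open>vv\<close> has derivative \<open>- hh sin t\<close>; passing from time to the angle
  \<open>t\<close> thus costs the factor \<open>1 / (2 sqrt LL)\<close>. Up to this factor the rate
  is the phase speed \<open>c j AA / xx\<close> of the \<open>j\<close>-th coordinate.\<close>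

definition rate :: "real \<Rightarrow> 3 \<Rightarrow> real \<Rightarrow> real" where
  "rate e j t = c j * AA e / (2 * xx e j t * sqrt (LL e t))"
definition beta :: "real \<Rightarrow> 3 \<Rightarrow> real" where
  "beta e j = integral {0..2*pi} (rate e j)"
text \<open>An antiderivative on the whole line instead of an integral from 0, since negative angles
  occur too.\<close>

definition theta :: "real \<Rightarrow> 3 \<Rightarrow> real \<Rightarrow> real" where
  "theta e j = (SOME f. f 0 = 0 \<and> (\<forall>t. (f has_real_derivative rate e j t) (at t)))"
text \<open>Minus the imaginary part of \<open>w\<^sub>1 w\<^sub>2 w\<^sub>3\<close>: the smooth
  square root of \<open>Q - A\<^sup>2\<close> that changes sign at the turning points of
  \<open>v\<close>.\<close>

definition FF :: "real \<Rightarrow> real \<Rightarrow> real" where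
  "FF e t = hh e * sin t * sqrt (LL e t)"

section \<open>Phases along the oscillation and their sum\<close>

lemma vv_deriv: "(vv e has_real_derivative - (hh e * sin t)) (at t)"
  unfolding vv_def by (auto intro!: derivative_eq_intros)

lemma LL_deriv: "(LL e has_real_derivative K * hh e * sin t) (at t)"
  unfolding LL_def by (auto intro!: derivative_eq_intros)

lemma xx_deriv: "(xx e j has_real_derivative - (c j * hh e * sin t)) (at t)"
  unfolding xx_def by (auto intro!: derivative_eq_intros vv_deriv)

lemma xx_periodic: "xx e j (t + 2 * pi) = xx e j t"
  by (simp add: xx_def vv_def)

lemma LL_periodic: "LL e (t + 2 * pi) = LL e t"
  by (simp add: LL_def)

lemma rate_periodic: "rate e j (t + 2 * pi) = rate e j t"
  by (simp add: rate_def xx_periodic LL_periodic)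

text \<open>The left side is the derivative in \<open>v\<close> of the product in
  \<open>prod_xx_poly\<close>, so this is the formula for \<open>Q'\<close>.\<close>

lemma sum_c_prod: "c 1 * ((1 + c 2 * v) * (1 + c 3 * v)) + c 2 * ((1 + c 1 * v) * (1 + c 3 * v))
    + c 3 * ((1 + c 1 * v) * (1 + c 2 * v)) = - (v * (2 * E - 3 * K * v))"
  unfolding E_def K_def c3_eq by (simp add: field_simps power2_eq_square)

lemma sum_c2_prod: "(c 1)\<^sup>2 * ((1 + c 2 * v) * (1 + c 3 * v)) + (c 2)\<^sup>2 * ((1 + c 1 * v) * (1 + c 3 * v))
    + (c 3)\<^sup>2 * ((1 + c 1 * v) * (1 + c 2 * v)) = 2 * E - 3 * K * v"
  unfolding E_def K_def c3_eq by (simp add: field_simps power2_eq_square)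

context
  fixes e :: real
  assumes e0: "0 \<le> e" and e1: "e \<le> emax"
begin

lemma rate_continuous: "continuous_on S (rate e j)"
proof -
  have "LL e t \<noteq> 0" "xx e j t \<noteq> 0" for t
    using LL_pos[OF e0 e1, of t] xx_pos[OF e0 e1, of j t] by simp_all
  moreover have "continuous_on S (LL e)" "continuous_on S (xx e j)"
    unfolding LL_def xx_def vv_def by (intro continuous_intros)+
  ultimately show ?thesis unfolding rate_def by (auto intro!: continuous_intros)
qed

lemma theta_ex: "\<exists>f. f 0 = 0 \<and> (\<forall>t. (f has_real_derivative rate e j t) (at t))"
proof -
  have "\<And>t. isCont (rate e j) t"
    using rate_continuous[of UNIV] by (simp add: continuous_on_eq_continuous_at)
  then obtain F where F: "\<And>t. (F has_vector_derivative rate e j t) (at t)"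
    using einterval_antiderivative[of "-\<infinity>" "\<infinity>" "rate e j"] by auto
  have "((\<lambda>t. F t - F 0) has_real_derivative rate e j t) (at t)" for t
    using F[of t] by (auto intro!: derivative_eq_intros simp: has_real_derivative_iff_has_vector_derivative)
  then show ?thesis by (intro exI[of _ "\<lambda>t. F t - F 0"]) simp
qed

lemma theta_0: "theta e j 0 = 0" and theta_deriv: "(theta e j has_real_derivative rate e j t) (at t)"
  using someI_ex[OF theta_ex[of j]] unfolding theta_def by auto

lemma theta_2pi: "theta e j (2 * pi) = beta e j"
proof -
  have "(rate e j has_integral theta e j (2*pi) - theta e j 0) {0..2*pi}"
    by (intro fundamental_theorem_of_calculus)
       (auto intro: has_field_derivative_at_within theta_deriv simp flip: has_real_derivative_iff_has_vector_derivative)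
  then show ?thesis unfolding beta_def by (simp add: theta_0 integral_unique)
qed

lemma theta_shift: "theta e j (t + 2 * pi) = theta e j t + beta e j"
proof -
  have "((\<lambda>t. theta e j (t + 2*pi) - theta e j t) has_real_derivative 0) (at t)" for t
    using DERIV_diff[OF theta_deriv[of j "t + 2*pi", unfolded DERIV_shift] theta_deriv[of j t]]
    by (simp add: rate_periodic)
  then have "theta e j (t + 2*pi) - theta e j t = theta e j (0 + 2*pi) - theta e j 0"
    by (rule DERIV_isconst_all[rule_format, of "\<lambda>t. theta e j (t + 2*pi) - theta e j t"])
  then show ?thesis by (simp add: theta_0 theta_2pi)
qed

text \<open>The value is \<open>- Q' / (2 sqrt LL)\<close>. Differentiating
  \<open>FF\<^sup>2 = Q - A\<^sup>2\<close> yields it only away from the zeros of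
  \<open>sin\<close>; the direct computation covers the turning points as well.\<close>

lemma FF_deriv: "(FF e has_real_derivative vv e t * (2 * E - 3 * K * vv e t) / (2 * sqrt (LL e t))) (at t)"
proof -
  have L: "LL e t > 0" by (rule LL_pos[OF e0 e1])
  have "(FF e has_real_derivative hh e * cos t * sqrt (LL e t)
      + hh e * sin t * (K * hh e * sin t / (2 * sqrt (LL e t)))) (at t)"
  proof -
    have a: "((\<lambda>t. sqrt (LL e t)) has_real_derivative inverse (sqrt (LL e t)) / 2 * (K * hh e * sin t)) (at t)"
      by (rule DERIV_chain2[OF DERIV_real_sqrt[OF L] LL_deriv])
    have b: "((\<lambda>t. hh e * sin t) has_real_derivative hh e * cos t) (at t)"
      by (rule DERIV_cmult[OF DERIV_sin])
    show ?thesis unfolding FF_def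
      by (rule DERIV_cong[OF DERIV_mult[OF b a]]) (simp add: inverse_eq_divide mult_ac)
  qed
  moreover have "hh e * cos t * sqrt (LL e t) + hh e * sin t * (K * hh e * sin t / (2 * sqrt (LL e t)))
      = (2 * (hh e * cos t) * LL e t + K * ((hh e)\<^sup>2 * (sin t)\<^sup>2)) / (2 * sqrt (LL e t))"
    using L by (simp add: field_simps power2_eq_square)
  moreover have "2 * (hh e * cos t) * LL e t + K * ((hh e)\<^sup>2 * (sin t)\<^sup>2) = vv e t * (2 * E - 3 * K * vv e t)"
  proof -
    define y where "y = hh e * cos t"
    have s: "(hh e)\<^sup>2 * (sin t)\<^sup>2 = (hh e)\<^sup>2 - y\<^sup>2"
      unfolding y_def sin_squared_eq by (simp add: power_mult_distrib algebra_simps)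
    have "2 * y * (E - 3 * K\<^sup>2 * e\<^sup>2 - K * y) + K * (e\<^sup>2 * (2 * E - 3 * K\<^sup>2 * e\<^sup>2) - y\<^sup>2)
        = (K * e\<^sup>2 + y) * (2 * E - 3 * K * (K * e\<^sup>2 + y))" by algebra
    then have "2 * y * (E - 3 * K\<^sup>2 * e\<^sup>2 - K * y) + K * ((hh e)\<^sup>2 - y\<^sup>2)
        = (K * e\<^sup>2 + y) * (2 * E - 3 * K * (K * e\<^sup>2 + y))" unfolding hh_sq[OF e0 e1] .
    then show ?thesis unfolding s vv_def LL_def by (simp add: y_def mult.assoc)
  qed
  ultimately show ?thesis by simp
qed

lemma QQ_FF: "QQ (vv e t) = (AA e)\<^sup>2 + (FF e t)\<^sup>2"
  unfolding QQ_vv[OF e0 e1] FF_def using LL_pos[OF e0 e1, of t] by (simp add: power_mult_distrib)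

lemma sum_rate: "rate e 1 t + rate e 2 t + rate e 3 t
   = - (AA e * (vv e t * (2 * E - 3 * K * vv e t)) / (2 * sqrt (LL e t) * QQ (vv e t)))"
proof -
  define x1 x2 x3 l where "x1 = xx e 1 t" and "x2 = xx e 2 t" and "x3 = xx e 3 t" and "l = sqrt (LL e t)"
  have pos: "x1 > 0" "x2 > 0" "x3 > 0" "l > 0"
    unfolding x1_def x2_def x3_def l_def using xx_pos[OF e0 e1] LL_pos[OF e0 e1] by auto
  have Q: "QQ (vv e t) = x1 * x2 * x3"
    unfolding x1_def x2_def x3_def xx_def prod_xx_poly ..
  have S: "vv e t * (2 * E - 3 * K * vv e t) = - (c 1 * (x2 * x3) + c 2 * (x1 * x3) + c 3 * (x1 * x2))"
    unfolding x1_def x2_def x3_def xx_def sum_c_prod by simp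
  have r: "c 1 * AA e / (2 * x1 * l) = AA e * (c 1 * (x2 * x3)) / (2 * l * (x1 * x2 * x3))"
    "c 2 * AA e / (2 * x2 * l) = AA e * (c 2 * (x1 * x3)) / (2 * l * (x1 * x2 * x3))"
    "c 3 * AA e / (2 * x3 * l) = AA e * (c 3 * (x1 * x2)) / (2 * l * (x1 * x2 * x3))"
    using pos by (simp_all add: mult_ac)
  show ?thesis unfolding rate_def Q S x1_def[symmetric] x2_def[symmetric] x3_def[symmetric] l_def[symmetric] r
    unfolding minus_add_distrib[symmetric] mult_minus_right minus_divide_left[symmetric]
    by (simp only: distrib_left add_divide_distrib minus_minus)
qed

lemma sum_c_rate: "c 1 * rate e 1 t + c 2 * rate e 2 t + c 3 * rate e 3 t
   = AA e * (2 * E - 3 * K * vv e t) / (2 * sqrt (LL e t) * QQ (vv e t))"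
proof -
  define x1 x2 x3 l where "x1 = xx e 1 t" and "x2 = xx e 2 t" and "x3 = xx e 3 t" and "l = sqrt (LL e t)"
  have pos: "x1 > 0" "x2 > 0" "x3 > 0" "l > 0"
    unfolding x1_def x2_def x3_def l_def using xx_pos[OF e0 e1] LL_pos[OF e0 e1] by auto
  have Q: "QQ (vv e t) = x1 * x2 * x3"
    unfolding x1_def x2_def x3_def xx_def prod_xx_poly ..
  have S: "2 * E - 3 * K * vv e t = (c 1)\<^sup>2 * (x2 * x3) + (c 2)\<^sup>2 * (x1 * x3) + (c 3)\<^sup>2 * (x1 * x2)"
    unfolding x1_def x2_def x3_def xx_def sum_c2_prod by simp
  have q: "c j * (c j * AA e / z) = AA e * (c j)\<^sup>2 / z" for j z by (simp add: power2_eq_square)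
  have r': "AA e * (c 1)\<^sup>2 / (2 * x1 * l) = AA e * ((c 1)\<^sup>2 * (x2 * x3)) / (2 * l * (x1 * x2 * x3))"
    "AA e * (c 2)\<^sup>2 / (2 * x2 * l) = AA e * ((c 2)\<^sup>2 * (x1 * x3)) / (2 * l * (x1 * x2 * x3))"
    "AA e * (c 3)\<^sup>2 / (2 * x3 * l) = AA e * ((c 3)\<^sup>2 * (x1 * x2)) / (2 * l * (x1 * x2 * x3))"
    using pos by (simp_all add: mult_ac)
  show ?thesis unfolding rate_def Q S x1_def[symmetric] x2_def[symmetric] x3_def[symmetric] l_def[symmetric] q r'
    by (simp only: distrib_left add_divide_distrib)
qed

text \<open>Both sides have the same derivative, because \<open>Q = AA\<^sup>2 + FF\<^sup>2\<close>
  and the derivative of \<open>FF\<close> is \<open>- Q' / (2 sqrt LL)\<close>. The right side is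
  the argument of \<open>AA - \<i> FF\<close>; it returns to 0 after a full period, so the monodromy
  has determinant 1.\<close>

lemma sum_theta: "theta e 1 t + theta e 2 t + theta e 3 t = - arctan (FF e t / AA e)"
proof -
  let ?f = "\<lambda>t. theta e 1 t + theta e 2 t + theta e 3 t + arctan (FF e t / AA e)"
  have A: "AA e > 0" by (rule AA_pos[OF e0 e1])
  have "(?f has_real_derivative 0) (at t)" for t
  proof -
    let ?d = "vv e t * (2 * E - 3 * K * vv e t) / (2 * sqrt (LL e t))"
    let ?W = "AA e * (vv e t * (2 * E - 3 * K * vv e t)) / (2 * sqrt (LL e t) * QQ (vv e t))"
    have q: "inverse (1 + (FF e t / AA e)\<^sup>2) * (d / AA e) = AA e * d / QQ (vv e t)" for d
    proof -
      have "(AA e)\<^sup>2 + (FF e t)\<^sup>2 > 0" using A by (simp add: add_pos_nonneg)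
      then show ?thesis unfolding QQ_FF using A
        by (simp add: divide_simps power_divide) (simp add: power2_eq_square)
    qed
    have "(?f has_real_derivative rate e 1 t + rate e 2 t + rate e 3 t
        + inverse (1 + (FF e t / AA e)\<^sup>2) * (?d / AA e)) (at t)"
      by (intro DERIV_add theta_deriv DERIV_chain2[where f=arctan] DERIV_arctan DERIV_cdivide FF_deriv)
    then have "(?f has_real_derivative - ?W + AA e * ?d / QQ (vv e t)) (at t)"
      unfolding q sum_rate .
    moreover have "AA e * ?d / QQ (vv e t) = ?W" by simp
    ultimately have "(?f has_real_derivative - ?W + ?W) (at t)" by (simp only:)
    then show ?thesis by (simp only: left_minus)
  qed
  then have "?f t = ?f 0" by (rule DERIV_isconst_all[rule_format, of ?f])
  then show ?thesis by (simp add: theta_0 FF_def)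
qed

lemma sum_beta: "beta e 1 + beta e 2 + beta e 3 = 0"
  using sum_theta[of "2 * pi"] by (simp add: theta_2pi FF_def)

end

text \<open>The inner product of \<open>c\<close> with the phase increments of one period. When
  \<open>c\<close> is orthogonal to the circle weights, this is the part of the monodromy that the
  circle group cannot undo.\<close>

definition Phi :: "real \<Rightarrow> real" where
  "Phi e = c 1 * beta e 1 + c 2 * beta e 2 + c 3 * beta e 3"

text \<open>The \<open>e\<^sup>2\<close> coefficients of \<open>majorant\<close>:
  \<open>quad0\<close> comes from \<open>AA\<close> and the constant part of \<open>LL\<close>,
  \<open>quad2\<close> from the terms quadratic in \<open>v\<close>.\<close>

definition quad0 :: real where "quad0 = 2 * K\<^sup>2 / E - 2 * E\<^sup>2"
definition quad2 :: real where "quad2 = 2 * E - 5 * K\<^sup>2 / (2 * E\<^sup>2)"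
text \<open>Up to the factor \<open>sqrt E / 2\<close>, a bound for the weighted integrand of
  \<open>Phi\<close> at \<open>v = e * y\<close>. The inverse square root of \<open>LL\<close> is
  bounded by \<open>inverse_sqrt_upper\<close>, \<open>AA\<close> by the arithmetic mean of 1 and
  its square, and \<open>1 / (1 - q)\<close> by a truncated geometric series with its last term
  doubled.\<close>

definition majorant :: "real \<Rightarrow> real \<Rightarrow> real" where
  "majorant e y =
     (let s = K * (e * y) / E; n = 2 * K\<^sup>2 * e\<^sup>2 / E; q = E * (e * y)\<^sup>2 - K * (e * y)^3
      in (2 - s - 3 * s\<^sup>2) * (1 + (n + s)/2 + (n + s)\<^sup>2/2) * ((1 + A2 e) / 2) * (1 + q + 2 * q\<^sup>2))"

text \<open>Beyond order \<open>e\<^sup>2\<close> the majorant is \<open>e^3\<close> times a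
  polynomial in \<open>(e, y)\<close>. That polynomial is bounded on a compact rectangle, so
  \<open>C\<close> needs no explicit value.\<close>

lemma majorant_bound:
  assumes "Y \<ge> 0"
  obtains C where "C \<ge> 0"
    "\<And>e y. 0 \<le> e \<Longrightarrow> e \<le> 1 \<Longrightarrow> \<bar>y\<bar> \<le> Y \<Longrightarrow> majorant e y \<le> 2 + e\<^sup>2 * (quad0 + quad2 * y\<^sup>2) + C * e^3"
proof -
  define k n0 where "k = K / E" and "n0 = 2 * K\<^sup>2 / E"
  define al1 r1 r2 r3 where
    "al1 = (\<lambda>y. n0 - 5/2 * (k * y)\<^sup>2)" and
    "r1 = (\<lambda>e y. 2 * (k * y) * n0 + n0\<^sup>2 * e - 1/2 * ((k * y) * n0) - 1/2 * ((k * y) * (k * y + n0 * e)\<^sup>2)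
        - 3/2 * (k * y)\<^sup>2 * (k * y + n0 * e) - 3/2 * e * (k * y)\<^sup>2 * (k * y + n0 * e)\<^sup>2)" and
    "r2 = (\<lambda>e. 4 * E * K\<^sup>2 * e - 4 * K^4 * e^3)" and
    "r3 = (\<lambda>e y. - K * y^3 + 2 * e * (E * y\<^sup>2 - K * e * y^3)\<^sup>2)"
  define be2 where "be2 = (\<lambda>y. 2 * - E\<^sup>2 + 1 * al1 y)"
  define r12 where "r12 = (\<lambda>e y. 2 * r2 e + 1 * r1 e y + e * al1 y * - E\<^sup>2
      + e\<^sup>2 * (al1 y * r2 e + - E\<^sup>2 * r1 e y) + e^3 * r1 e y * r2 e)"
  define R where "R = (\<lambda>(e, y). (2 * 1) * r3 e y + 1 * r12 e y + e * be2 y * (E * y\<^sup>2)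
      + e\<^sup>2 * (be2 y * r3 e y + (E * y\<^sup>2) * r12 e y) + e^3 * r12 e y * r3 e y)"
  have maj: "majorant e y = 2 + e\<^sup>2 * (quad0 + quad2 * y\<^sup>2) + e^3 * R (e, y)" for e y
  proof -
    have s: "K * (e * y) / E = e * (k * y)" "2 * K\<^sup>2 * e\<^sup>2 / E = e\<^sup>2 * n0" by (simp_all add: k_def n0_def)
    have f1: "(2 - e * (k * y) - 3 * (e * (k * y))\<^sup>2) * (1 + (e\<^sup>2 * n0 + e * (k * y))/2 + (e\<^sup>2 * n0 + e * (k * y))\<^sup>2/2)
        = 2 + e\<^sup>2 * al1 y + e^3 * r1 e y"
      unfolding al1_def r1_def by (simp add: field_simps power2_eq_square power3_eq_cube)
    have f2: "(1 + A2 e) / 2 = 1 + e\<^sup>2 * (- E\<^sup>2) + e^3 * r2 e"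
      unfolding A2_def r2_def by (simp add: field_simps power_def)
    have f3: "1 + (E * (e * y)\<^sup>2 - K * (e * y)^3) + 2 * (E * (e * y)\<^sup>2 - K * (e * y)^3)\<^sup>2
        = 1 + e\<^sup>2 * (E * y\<^sup>2) + e^3 * r3 e y"
      unfolding r3_def by (simp add: field_simps power_def)
    have q: "2 * 1 * (E * y\<^sup>2) + 1 * (2 * - E\<^sup>2 + 1 * al1 y) = quad0 + quad2 * y\<^sup>2"
      unfolding quad0_def quad2_def al1_def k_def n0_def
      by (simp add: field_simps power2_eq_square)
    show ?thesis unfolding majorant_def Let_def s
        second_order_remainder_mult[OF second_order_remainder_mult[OF f1 f2] f3] q
      unfolding R_def r12_def be2_def by simp
  qed
  have "continuous_on ({0..1} \<times> {-Y..Y}) R"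
    unfolding R_def r12_def r1_def r2_def r3_def be2_def al1_def case_prod_beta
    by (intro continuous_on_add continuous_on_diff continuous_on_mult continuous_on_power continuous_on_const
        continuous_on_fst continuous_on_snd continuous_on_id)
  then have "compact (R ` ({0..1} \<times> {-Y..Y}))"
    by (intro compact_continuous_image compact_Times) auto
  then obtain B where B: "\<And>x. x \<in> R ` ({0..1} \<times> {-Y..Y}) \<Longrightarrow> norm x \<le> B"
    using compact_imp_bounded bounded_iff by metis
  show thesis
  proof (rule that[of "max B 0"])
    show "majorant e y \<le> 2 + e\<^sup>2 * (quad0 + quad2 * y\<^sup>2) + max B 0 * e^3"
      if "0 \<le> e" "e \<le> 1" "\<bar>y\<bar> \<le> Y" for e y
    proof -
      have "(e, y) \<in> {0..1} \<times> {-Y..Y}" using that by auto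
      then have "R (e, y) \<le> max B 0" using B[OF imageI] by fastforce
      then have "e^3 * R (e, y) \<le> e^3 * max B 0" using that by (intro mult_left_mono) auto
      then show ?thesis unfolding maj by (simp add: mult.commute)
    qed
  qed simp
qed

section \<open>An upper bound for the period\<close>

context
  fixes e :: real
  assumes e0: "0 \<le> e" and e1: "e \<le> emax"
begin

lemma rate_integrable: "rate e j integrable_on {0..2*pi}"
  by (rule integrable_continuous_real[OF rate_continuous[OF e0 e1]])

lemma Phi_integral:
  "((\<lambda>t. AA e * (2 * E - 3 * K * vv e t) / (2 * sqrt (LL e t) * QQ (vv e t))) has_integral Phi e) {0..2*pi}"
proof -
  have "((\<lambda>t. c 1 * rate e 1 t + c 2 * rate e 2 t + c 3 * rate e 3 t) has_integral Phi e) {0..2*pi}"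
    unfolding Phi_def beta_def
    by (intro has_integral_add has_integral_mult_right integrable_integral rate_integrable)
  then show ?thesis unfolding sum_c_rate[OF e0 e1] .
qed

text \<open>The three rates together integrate to the sum of the increments \<open>beta\<close>,
  which is 0; up to sign their sum is the integrand of \<open>Phi_integral\<close> multiplied by
  \<open>v\<close>.\<close>

lemma vv_moment_zero:
  "((\<lambda>t. - (AA e * (vv e t * (2 * E - 3 * K * vv e t)) / (2 * sqrt (LL e t) * QQ (vv e t)))) has_integral 0) {0..2*pi}"
proof -
  have "((\<lambda>t. rate e 1 t + rate e 2 t + rate e 3 t) has_integral beta e 1 + beta e 2 + beta e 3) {0..2*pi}"
    unfolding beta_def by (intro has_integral_add integrable_integral rate_integrable)
  then show ?thesis unfolding sum_rate[OF e0 e1] sum_beta[OF e0 e1] .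
qed

text \<open>The weight \<open>1 + K v / E\<close> costs nothing because the first moment vanishes; it cancels the first
  order term of the integrand at \<open>e = 0\<close>.\<close>
lemma Phi_integral_weighted:
  "((\<lambda>t. AA e * (2 * E - 3 * K * vv e t) * (1 + K * vv e t / E) / (2 * sqrt (LL e t) * QQ (vv e t)))
     has_integral Phi e) {0..2*pi}"
proof -
  have "((\<lambda>t. AA e * (2 * E - 3 * K * vv e t) / (2 * sqrt (LL e t) * QQ (vv e t))
      + (- (K / E)) * - (AA e * (vv e t * (2 * E - 3 * K * vv e t)) / (2 * sqrt (LL e t) * QQ (vv e t))))
      has_integral Phi e + (- (K / E)) * 0) {0..2*pi}"
    by (rule has_integral_add[OF Phi_integral has_integral_mult_right[OF vv_moment_zero]])
  moreover have "AA e * a / d + (- (K / E)) * - (AA e * (v * a) / d) = AA e * a * (1 + K * v / E) / d" for a d v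
    by (simp add: distrib_left add_divide_distrib mult_ac)
  ultimately show ?thesis by simp
qed

lemma vv_scaled: "vv e t = e * (K * e + sqrt (2 * E - 3 * K\<^sup>2 * e\<^sup>2) * cos t)"
  unfolding vv_def hh_def by (simp add: algebra_simps power2_eq_square)

lemma integrand_le_majorant:
  "AA e * (2 * E - 3 * K * vv e t) * (1 + K * vv e t / E) / (2 * sqrt (LL e t) * QQ (vv e t))
     \<le> sqrt E / 2 * majorant e (K * e + sqrt (2 * E - 3 * K\<^sup>2 * e\<^sup>2) * cos t)"
proof -
  define v s n q where "v = vv e t" and "s = K * v / E" and "n = 2 * K\<^sup>2 * e\<^sup>2 / E" and "q = E * v\<^sup>2 - K * v^3"
  have E: "E > 0" by (rule E_pos)
  have "\<bar>K * hh e * cos t\<bar> \<le> E / 10"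
    using mult_mono[OF K_hh_le[OF e0 e1] abs_cos_le_one[of t]] E by (simp add: abs_mult)
  then have "\<bar>K * v\<bar> \<le> E / 1000 + E / 10"
    using Ke2_le[OF e0 e1] zero_le_power2[of "K * e"]
    unfolding v_def vv_def distrib_left mult.assoc[symmetric] power2_eq_square[of K, symmetric] power_mult_distrib
    by linarith
  then have s: "\<bar>s\<bar> \<le> 1/9" unfolding s_def using E by (simp add: field_simps)
  have n: "0 \<le> n" "n \<le> 1/100" unfolding n_def using Ke2_le[OF e0 e1] E by (simp_all add: field_simps)
  have v2: "E * v\<^sup>2 \<le> 1/100"
  proof -
    have "v\<^sup>2 \<le> 2 * ((K * e\<^sup>2)\<^sup>2 + (hh e * cos t)\<^sup>2)"
      unfolding v_def vv_def using sum_squares_bound[of "K * e\<^sup>2" "hh e * cos t"] by (simp add: power2_sum)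
    also have "(hh e * cos t)\<^sup>2 \<le> 2 * E * e\<^sup>2 * 1"
      unfolding power_mult_distrib using hh_sq_le[OF e0 e1] E
      by (intro mult_mono) (auto simp: abs_square_le_1)
    also have "(K * e\<^sup>2)\<^sup>2 = (K\<^sup>2 * e\<^sup>2) * e\<^sup>2" by (simp add: power_mult_distrib power2_eq_square)
    also have "\<dots> \<le> (E / 1000) * e\<^sup>2" using Ke2_le[OF e0 e1] by (intro mult_right_mono) auto
    finally have "v\<^sup>2 \<le> 1/500 * (E * e\<^sup>2) + 4 * (E * e\<^sup>2)" by (simp add: algebra_simps)
    moreover have "E * e\<^sup>2 \<ge> 0" using E by simp
    ultimately have "v\<^sup>2 \<le> 5 * (E * e\<^sup>2)" by linarith
    then have "E * v\<^sup>2 \<le> E * (5 * (E * e\<^sup>2))" using E by (intro mult_left_mono) auto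
    also have "\<dots> = 5 * (E\<^sup>2 * e\<^sup>2)" by (simp add: power2_eq_square)
    finally show ?thesis using Ee2_le[OF e0 e1] by linarith
  qed
  have q: "\<bar>q\<bar> \<le> 1/2"
  proof -
    have "q = (E * v\<^sup>2) * (1 - s)" unfolding q_def s_def using E by (simp add: field_simps power2_eq_square power3_eq_cube)
    then have "\<bar>q\<bar> = (E * v\<^sup>2) * \<bar>1 - s\<bar>" using E by (simp add: abs_mult)
    also have "\<dots> \<le> 1/100 * 2" using v2 s E by (intro mult_mono) auto
    finally show ?thesis by simp
  qed
  have Q: "QQ v = 1 - q" unfolding QQ_def q_def by simp
  have Lv: "LL e t = E * (1 - (n + s))"
    unfolding LL_def n_def s_def v_def vv_def using E by (simp add: field_simps power2_eq_square)
  \<comment> \<open>Here \<open>2 - s\<close> will meet the factor \<open>1 + s/2\<close> from the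
    square root, and the terms linear in \<open>s\<close> cancel.\<close>
  have m: "(2 * E - 3 * K * v) * (1 + K * v / E) = E * (2 - s - 3 * s\<^sup>2)"
    unfolding s_def using E by (simp add: field_simps power2_eq_square)
  have s2: "s\<^sup>2 \<le> 1/81" using power_mono[of "\<bar>s\<bar>" "1/9" 2] s by (simp add: power_divide)
  have pos: "2 - s - 3 * s\<^sup>2 \<ge> 0" using s s2 by linarith
  have A: "AA e \<le> (1 + A2 e) / 2"
    using sum_squares_bound[of 1 "AA e"] AA_sq[OF e0 e1] by simp
  have iQ: "1 / (1 - q) \<le> 1 + q + 2 * q\<^sup>2"
  proof -
    have "(1 + q + 2 * q\<^sup>2) * (1 - q) = 1 + q\<^sup>2 * (1 - 2 * q)" by (simp add: algebra_simps power2_eq_square)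
    moreover have "q\<^sup>2 * (1 - 2 * q) \<ge> 0" using q by (intro mult_nonneg_nonneg) auto
    moreover have "1 - q > 0" using q by linarith
    ultimately show ?thesis unfolding pos_divide_le_eq[OF \<open>1 - q > 0\<close>] by linarith
  qed
  have iL: "1 / sqrt (1 - (n + s)) \<le> 1 + (n + s)/2 + (n + s)\<^sup>2/2"
    using s n by (intro inverse_sqrt_upper) linarith
  have sE: "E / sqrt E = sqrt E" using E by (simp add: real_div_sqrt)
  have "AA e * (2 * E - 3 * K * v) * (1 + K * v / E) / (2 * sqrt (LL e t) * QQ v)
      = AA e * (E * (2 - s - 3 * s\<^sup>2)) / (2 * (sqrt E * sqrt (1 - (n + s))) * (1 - q))"
    unfolding Q Lv mult.assoc[of "AA e"] m real_sqrt_mult ..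
  also have "\<dots> = (E / sqrt E) / 2 * ((2 - s - 3 * s\<^sup>2) * (1 / sqrt (1 - (n + s))) * AA e * (1 / (1 - q)))"
    by (simp add: mult_ac)
  also have "\<dots> \<le> (E / sqrt E) / 2 * ((2 - s - 3 * s\<^sup>2) * (1 + (n + s)/2 + (n + s)\<^sup>2/2) * ((1 + A2 e) / 2) * (1 + q + 2 * q\<^sup>2))"
    using E pos iL A iQ AA_pos[OF e0 e1] q s n A2_lower[OF e0 e1]
    by (intro mult_left_mono mult_mono mult_nonneg_nonneg) (auto intro: order_trans[OF _ iL])
  also have "\<dots> = sqrt E / 2 * majorant e (K * e + sqrt (2 * E - 3 * K\<^sup>2 * e\<^sup>2) * cos t)"
    unfolding sE majorant_def Let_def vv_scaled[symmetric] s_def n_def q_def v_def ..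
  finally show ?thesis unfolding v_def .
qed

end

lemma Phi_0: "Phi 0 = 2 * pi * sqrt E"
proof -
  have i: "AA 0 * (2 * E - 3 * K * vv 0 t) / (2 * sqrt (LL 0 t) * QQ (vv 0 t)) = sqrt E" for t
    using E_pos by (simp add: AA_def A2_def vv_def hh_def LL_def QQ_def real_div_sqrt)
  have "((\<lambda>t. sqrt E) has_integral Phi 0) {0..2*pi}"
    using Phi_integral[of 0] emax_pos unfolding i by simp
  moreover have "((\<lambda>t. sqrt E) has_integral (2*pi - 0) * sqrt E) {0..2*pi}"
    using has_integral_const_real[of "sqrt E" 0 "2*pi"] by simp
  ultimately show ?thesis by (metis diff_zero has_integral_unique)
qed

text \<open>The mean of \<open>(y t)\<^sup>2\<close> is \<open>E\<close> up to order
  \<open>e\<^sup>2\<close>, so the bound has mean \<open>2 - e\<^sup>2 K\<^sup>2 / (2 E)\<close> up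
  to order \<open>e^3\<close>, before the factor \<open>sqrt E / 2\<close>. It drops below the value
  at 0 because \<open>K\<close> is nonzero.\<close>

lemma Phi_nonconst: "\<exists>e. 0 < e \<and> e \<le> emax \<and> Phi e < Phi 0"
proof -
  define Y where "Y = \<bar>K\<bar> + sqrt (2 * E)"
  have "Y \<ge> 0" unfolding Y_def using E_pos by simp
  then obtain C where C: "C \<ge> 0"
    "\<And>e y. 0 \<le> e \<Longrightarrow> e \<le> 1 \<Longrightarrow> \<bar>y\<bar> \<le> Y \<Longrightarrow> majorant e y \<le> 2 + e\<^sup>2 * (quad0 + quad2 * y\<^sup>2) + C * e^3"
    using majorant_bound by metis
  define D where "D = 2 * C + \<bar>quad2\<bar> * K\<^sup>2"
  have D: "D \<ge> 0" unfolding D_def using C(1) by simp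
  have KE: "K\<^sup>2 / E > 0" using K_nz E_pos by simp
  \<comment> \<open>\<open>D * e\<close> will bound the error terms against the gain
    \<open>K\<^sup>2 / E\<close>. With \<open>D + 1\<close> in the denominator the quotient is
    defined also for \<open>D = 0\<close>, and the comparison is strict.\<close>
  define e where "e = min (min emax 1) (K\<^sup>2 / E / (D + 1))"
  have e: "0 < e" "e \<le> emax" "e \<le> 1" "e \<le> K\<^sup>2 / E / (D + 1)"
    unfolding e_def using emax_pos divide_pos_pos[OF KE, of "D + 1"] D by auto
  define eta where "eta = sqrt (2 * E - 3 * K\<^sup>2 * e\<^sup>2)"
  have eta2: "eta\<^sup>2 = 2 * E - 3 * K\<^sup>2 * e\<^sup>2"
    unfolding eta_def using Ke2_le[of e] e E_pos by (simp add: mult.assoc)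
  define y where "y = (\<lambda>t. K * e + eta * cos t)"
  have yY: "\<bar>y t\<bar> \<le> Y" for t
  proof -
    have "\<bar>K * e\<bar> \<le> \<bar>K\<bar>" using e by (simp add: abs_mult mult_left_le)
    moreover have "\<bar>eta * cos t\<bar> \<le> sqrt (2 * E) * 1"
      unfolding abs_mult eta_def using E_pos Ke2_le[of e] e by (intro mult_mono) (auto simp: mult.assoc)
    ultimately show ?thesis unfolding y_def Y_def by linarith
  qed
  have bound: "((\<lambda>t. sqrt E / 2 * (2 + e\<^sup>2 * (quad0 + quad2 * (y t)\<^sup>2) + C * e^3)) has_integral
      sqrt E / 2 * (4 * pi + e\<^sup>2 * (2 * pi * quad0 + quad2 * (2 * pi * (K * e)\<^sup>2 + pi * eta\<^sup>2)) + 2 * pi * C * e^3)) {0..2*pi}"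
  proof -
    have const: "((\<lambda>t. k) has_integral 2 * pi * k) {0..2*pi}" for k :: real
      using has_integral_const_real[of k 0 "2*pi"] by simp
    have "((\<lambda>t. (2 + e\<^sup>2 * (quad0 + quad2 * (K * e)\<^sup>2) + C * e^3) + (e\<^sup>2 * quad2 * 2 * (K * e) * eta) * cos t
        + (e\<^sup>2 * quad2 * eta\<^sup>2) * (cos t)\<^sup>2) has_integral
        2 * pi * (2 + e\<^sup>2 * (quad0 + quad2 * (K * e)\<^sup>2) + C * e^3) + (e\<^sup>2 * quad2 * 2 * (K * e) * eta) * 0
        + (e\<^sup>2 * quad2 * eta\<^sup>2) * pi) {0..2*pi}"
      by (intro has_integral_add has_integral_mult_right cos_integrals const)
    then have "((\<lambda>t. 2 + e\<^sup>2 * (quad0 + quad2 * (y t)\<^sup>2) + C * e^3) has_integral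
      (4 * pi + e\<^sup>2 * (2 * pi * quad0 + quad2 * (2 * pi * (K * e)\<^sup>2 + pi * eta\<^sup>2)) + 2 * pi * C * e^3)) {0..2*pi}"
      unfolding y_def power2_sum power_mult_distrib by (simp add: algebra_simps)
    then show ?thesis by (rule has_integral_mult_right)
  qed
  have "Phi e \<le> sqrt E / 2 * (4 * pi + e\<^sup>2 * (2 * pi * quad0 + quad2 * (2 * pi * (K * e)\<^sup>2 + pi * eta\<^sup>2)) + 2 * pi * C * e^3)"
  proof (rule has_integral_le[OF Phi_integral_weighted bound])
    fix t assume "t \<in> {0..2*pi}"
    have "AA e * (2 * E - 3 * K * vv e t) * (1 + K * vv e t / E) / (2 * sqrt (LL e t) * QQ (vv e t))
        \<le> sqrt E / 2 * majorant e (y t)"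
      unfolding y_def eta_def using e by (intro integrand_le_majorant) auto
    also have "\<dots> \<le> sqrt E / 2 * (2 + e\<^sup>2 * (quad0 + quad2 * (y t)\<^sup>2) + C * e^3)"
      using e yY C(2) E_pos by (intro mult_left_mono) auto
    finally show "AA e * (2 * E - 3 * K * vv e t) * (1 + K * vv e t / E) / (2 * sqrt (LL e t) * QQ (vv e t))
        \<le> sqrt E / 2 * (2 + e\<^sup>2 * (quad0 + quad2 * (y t)\<^sup>2) + C * e^3)" .
  qed (use e in auto)
  also have "\<dots> < sqrt E / 2 * (4 * pi)"
  proof -
    have q: "2 * quad0 + 2 * E * quad2 = - (K\<^sup>2 / E)"
      unfolding quad0_def quad2_def using E_pos by (simp add: field_simps power2_eq_square)
    have s: "2 * pi * quad0 + quad2 * (2 * pi * (K * e)\<^sup>2 + pi * eta\<^sup>2)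
        = pi * ((2 * quad0 + 2 * E * quad2) - quad2 * K\<^sup>2 * e\<^sup>2)"
      unfolding eta2 by (simp add: algebra_simps power_mult_distrib)
    have "4 * pi + e\<^sup>2 * (2 * pi * quad0 + quad2 * (2 * pi * (K * e)\<^sup>2 + pi * eta\<^sup>2)) + 2 * pi * C * e^3
        = 4 * pi + (pi * e\<^sup>2) * (- (K\<^sup>2 / E) - quad2 * K\<^sup>2 * e\<^sup>2 + 2 * C * e)"
      unfolding s q by (simp add: algebra_simps power2_eq_square power3_eq_cube)
    moreover have "- (K\<^sup>2 / E) - quad2 * K\<^sup>2 * e\<^sup>2 + 2 * C * e < 0"
    proof -
      have "- quad2 * K\<^sup>2 * e\<^sup>2 \<le> \<bar>quad2\<bar> * K\<^sup>2 * e"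
        using e by (intro mult_mono mult_right_mono) (auto simp: power2_eq_square mult_left_le)
      then have "- (K\<^sup>2 / E) - quad2 * K\<^sup>2 * e\<^sup>2 + 2 * C * e \<le> - (K\<^sup>2 / E) + D * e"
        unfolding D_def by (simp add: algebra_simps)
      moreover have "(D + 1) * e \<le> K\<^sup>2 / E"
        using e(4) D by (subst (asm) pos_le_divide_eq) (simp_all add: mult.commute)
      ultimately show ?thesis using e(1) by (simp add: algebra_simps)
    qed
    ultimately have "4 * pi + e\<^sup>2 * (2 * pi * quad0 + quad2 * (2 * pi * (K * e)\<^sup>2 + pi * eta\<^sup>2)) + 2 * pi * C * e^3 < 4 * pi"
      using e(1) by (simp add: mult_less_0_iff)
    then show ?thesis using E_pos by (intro mult_strict_left_mono) auto
  qed
  finally show ?thesis using e unfolding Phi_0 by (intro exI[of _ e]) simp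
qed

section \<open>Rational values of the period\<close>

lemma beta_continuous: "continuous_on {0..emax} (\<lambda>e. beta e j)"
proof -
  have ne: "LL (fst p) (snd p) \<noteq> 0" "xx (fst p) j (snd p) \<noteq> 0" if "p \<in> {0..emax} \<times> cbox 0 (2*pi)" for p
    using that LL_pos[of "fst p" "snd p"] xx_pos[of "fst p" j "snd p"] by auto
  have "continuous_on S (\<lambda>p. AA (fst p))" "continuous_on S (\<lambda>p. LL (fst p) (snd p))"
      "continuous_on S (\<lambda>p. xx (fst p) j (snd p))" for S
    unfolding AA_def A2_def LL_def xx_def vv_def hh_def by (intro continuous_intros)+
  then have "continuous_on ({0..emax} \<times> cbox 0 (2*pi)) (\<lambda>(e, t). rate e j t)"
    unfolding case_prod_beta rate_def
    by (intro continuous_intros ballI) (use ne in auto)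
  then have "continuous_on {0..emax} (\<lambda>e. integral (cbox 0 (2*pi)) (rate e j))"
    by (rule integral_continuous_on_param)
  then show ?thesis unfolding beta_def by simp
qed

lemma Phi_continuous: "continuous_on {0..emax} Phi"
  unfolding Phi_def by (intro continuous_intros beta_continuous)

text \<open>A strictly increasing sequence of rationals between the two values of
  \<open>Phi / (2 * pi)\<close> is hit by the intermediate value theorem. Different values force
  different parameters, and values below \<open>Phi 0\<close> force \<open>es k\<close> to be
  nonzero.\<close>

lemma infinite_rational_Phi:
  "\<exists>es :: nat \<Rightarrow> real. inj es \<and> (\<forall>k. 0 < es k \<and> es k \<le> emax \<and> Phi (es k) / (2 * pi) \<in> \<rat>)"
proof -
  obtain e where e: "0 < e" "e \<le> emax" "Phi e < Phi 0" using Phi_nonconst by auto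
  define a b where "a = Phi e / (2*pi)" and "b = Phi 0 / (2*pi)"
  have ab: "a < b" unfolding a_def b_def using e by (simp add: divide_strict_right_mono)
  have "\<exists>q. \<forall>k::nat. (q k \<in> \<rat> \<and> a < q k \<and> q k < b) \<and> q k < q (Suc k)"
  proof (rule dependent_nat_choice)
    show "\<exists>x. x \<in> \<rat> \<and> a < x \<and> x < b" using Rats_dense_in_real[OF ab] by auto
    show "\<exists>y. (y \<in> \<rat> \<and> a < y \<and> y < b) \<and> x < y" if "x \<in> \<rat> \<and> a < x \<and> x < b" for x and n :: nat
      using Rats_dense_in_real[of x b] that by force
  qed
  then obtain q where q: "q k \<in> \<rat> \<and> a < q k \<and> q k < b" and qS: "q k < q (Suc k)" for k :: nat by metis
  have "\<exists>x. 0 \<le> x \<and> x \<le> e \<and> Phi x = 2 * pi * q k" for k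
  proof -
    have "continuous_on {0..e} Phi" by (rule continuous_on_subset[OF Phi_continuous]) (use e in auto)
    moreover have "Phi e \<le> 2 * pi * q k" "2 * pi * q k \<le> Phi 0"
      using q[of k] unfolding a_def b_def by (simp_all add: field_simps)
    ultimately show ?thesis using IVT2'[of Phi e "2 * pi * q k" 0] e by auto
  qed
  then obtain es where es: "0 \<le> es k" "es k \<le> e" "Phi (es k) = 2 * pi * q k" for k by metis
  have "strict_mono q" using qS by (simp add: strict_mono_Suc_iff)
  have "inj es"
  proof (rule injI)
    fix x y assume "es x = es y"
    then have "q x = q y" using es(3)[of x] es(3)[of y] by simp
    then show "x = y" using \<open>strict_mono q\<close> by (simp add: strict_mono_eq)
  qed
  moreover have "0 < es k" for k
  proof -
    have "es k \<noteq> 0" using es(3)[of k] q[of k] unfolding b_def by auto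
    then show ?thesis using es(1)[of k] by simp
  qed
  moreover have "es k \<le> emax" "Phi (es k) / (2 * pi) \<in> \<rat>" for k
    using es(2,3)[of k] e(2) q[of k] by auto
  ultimately show ?thesis by blast
qed

end

section \<open>The Legendrian curve\<close>

locale circle_weights =
  fixes b :: "3 \<Rightarrow> int"
  assumes b_distinct: "b 1 \<noteq> b 2" "b 1 \<noteq> b 3" "b 2 \<noteq> b 3"
    and b_gcd: "gcd (gcd (b 1) (b 2)) (b 3) = 1"
    and b_sum: "b 1 + b 2 + b 3 = 0"
begin

text \<open>The cross product of \<open>b\<close> with \<open>(1,1,1)\<close>. Orthogonality to both
  makes \<open>1 + ci j * v\<close> compatible with squared norm 3 and zero moment map.\<close>

definition ci :: "3 \<Rightarrow> int" where
  "ci j = (if j = 1 then b 2 - b 3 else if j = 2 then b 3 - b 1 else b 1 - b 2)"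

lemma ci_simps: "ci 1 = b 2 - b 3" "ci 2 = b 3 - b 1" "ci 3 = b 1 - b 2"
  by (simp_all add: ci_def)

sublocale zero_sum_triple "\<lambda>j. real_of_int (ci j)"
  using b_distinct by unfold_locales (simp_all add: ci_simps)

definition act :: "real \<Rightarrow> C3 \<Rightarrow> C3" where
  "act s z = (\<chi> j. cis (real_of_int (b j) * s) * z $ j)"

definition oth :: "C3 \<Rightarrow> 3 \<Rightarrow> complex" where
  "oth z j = (if j = 1 then z $ 2 * z $ 3 else if j = 2 then z $ 3 * z $ 1 else z $ 1 * z $ 2)"

lemma oth_simps: "oth z 1 = z $ 2 * z $ 3" "oth z 2 = z $ 3 * z $ 1" "oth z 3 = z $ 1 * z $ 2"
  by (simp_all add: oth_def)

definition X :: "C3 \<Rightarrow> C3" where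
  "X z = (\<chi> j. \<i> * of_int (b j) * z $ j)"

definition Y :: "C3 \<Rightarrow> C3" where
  "Y z = (\<chi> j. \<i> * of_int (ci j) * cnj (oth z j))"

definition ww :: "real \<Rightarrow> real \<Rightarrow> C3" where
  "ww e t = (\<chi> j. of_real (sqrt (xx e j t)) * cis (theta e j t))"

lemma act_nth [simp]: "act s z $ j = cis (real_of_int (b j) * s) * z $ j"
  by (simp add: act_def)

lemma act_add: "act s (act s' z) = act (s + s') z"
  by (simp add: vec_eq_iff cis_mult distrib_left flip: mult.assoc)

lemma act_0 [simp]: "act 0 z = z"
  by (simp add: vec_eq_iff)

lemma act_scaleR: "act s (r *\<^sub>R z) = r *\<^sub>R act s z"
  by (simp add: vec_eq_iff)

lemma norm_act [simp]: "norm (act s z) = norm z"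
proof -
  have "(norm (act s z))\<^sup>2 = (norm z)\<^sup>2" unfolding norm_C3 by (simp add: norm_mult)
  then show ?thesis by simp
qed

lemma Gmat_mult: "Gmat (b 1) (b 2) (b 3) s *v z = act s z"
proof -
  have v: "(vector [b 1, b 2, b 3] :: int^3) $ i = b i" for i :: 3
    using exhaust_3[of i] by auto
  show ?thesis
    unfolding vec_eq_iff Gmat_def matrix_vector_mult_def v
    by (simp add: if_distrib[of "\<lambda>x. x * _"] cis_conv_exp cong: if_cong)
qed

context
  fixes e :: real
  assumes e0: "0 \<le> e" and e1: "e \<le> emax"
begin

lemma cmod_ww: "(cmod (ww e t $ j))\<^sup>2 = xx e j t"
  using xx_pos[OF e0 e1, of j t] by (simp add: ww_def norm_mult)

lemma ww_nz: "ww e t $ j \<noteq> 0"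
  using cmod_ww[of t j] xx_pos[OF e0 e1, of j t] by auto

lemma norm_ww: "(norm (ww e t))\<^sup>2 = 3"
proof -
  have "(norm (ww e t))\<^sup>2 = 3 + (ci 1 + ci 2 + ci 3) * vv e t"
    unfolding norm_C3 cmod_ww xx_def by (simp add: algebra_simps)
  then show ?thesis by (simp add: ci_simps)
qed

lemma moment_ww: "(\<Sum>j\<in>UNIV. of_int (b j) * (cmod (ww e t $ j))\<^sup>2) = 0"
proof -
  have b3: "b 3 = - b 1 - b 2" using b_sum by simp
  show ?thesis
    unfolding cmod_ww xx_def sum_3 ci_simps b3 by (simp add: algebra_simps)
qed

text \<open>The modulus comes from \<open>QQ_FF\<close> and the argument from
  \<open>sum_theta\<close>; the result is the conservation of the real part.\<close>

lemma ww_prod: "ww e t $ 1 * ww e t $ 2 * ww e t $ 3 = Complex (AA e) (- FF e t)"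
proof -
  have A: "AA e > 0" by (rule AA_pos[OF e0 e1])
  have "ww e t $ 1 * ww e t $ 2 * ww e t $ 3
      = of_real (sqrt (xx e 1 t * xx e 2 t * xx e 3 t)) * cis (theta e 1 t + theta e 2 t + theta e 3 t)"
    by (simp add: ww_def real_sqrt_mult cis_mult[symmetric])
  also have "xx e 1 t * xx e 2 t * xx e 3 t = (AA e)\<^sup>2 * (1 + (FF e t / AA e)\<^sup>2)"
    using prod_xx_poly[of "vv e t"] QQ_FF[OF e0 e1, of t] A unfolding xx_def by (simp add: field_simps)
  also have "sqrt \<dots> = AA e * sqrt (1 + (FF e t / AA e)\<^sup>2)" using A by (simp add: real_sqrt_mult)
  also have "theta e 1 t + theta e 2 t + theta e 3 t = - arctan (FF e t / AA e)" by (rule sum_theta[OF e0 e1])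
  finally have *: "ww e t $ 1 * ww e t $ 2 * ww e t $ 3
      = of_real (AA e * sqrt (1 + (FF e t / AA e)\<^sup>2)) * cis (- arctan (FF e t / AA e))" .
  have s: "sqrt (1 + (FF e t / AA e)\<^sup>2) \<noteq> 0" by (smt (verit) real_sqrt_eq_0_iff zero_le_power2)
  show ?thesis unfolding * using A s
    by (simp add: complex_eq_iff cos_arctan sin_arctan)
qed

lemma ww_oth: "ww e t $ j * oth (ww e t) j = Complex (AA e) (- FF e t)"
  using exhaust_3[of j] ww_prod[of t] by (auto simp: oth_simps mult_ac)

text \<open>The curve follows \<open>Y\<close>, with the factor of the time change from flow time to
  the angle \<open>t\<close>.\<close>

lemma ww_deriv:
  "((\<lambda>t. ww e t $ j) has_vector_derivative of_real (1 / (2 * sqrt (LL e t))) * Y (ww e t) $ j) (at t)"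
proof -
  define x l th where "x = xx e j t" and "l = sqrt (LL e t)" and "th = theta e j t"
  have x: "x > 0" and l: "l > 0" unfolding x_def l_def using xx_pos[OF e0 e1] LL_pos[OF e0 e1] by auto
  have 1: "((\<lambda>t. sqrt (xx e j t)) has_real_derivative inverse (sqrt x) / 2 * - (ci j * hh e * sin t)) (at t)"
    unfolding x_def by (rule DERIV_chain2[OF DERIV_real_sqrt[OF xx_pos[OF e0 e1]] xx_deriv])
  have 2: "((\<lambda>t. of_real (sqrt (xx e j t)) :: complex) has_vector_derivative
      of_real (inverse (sqrt x) / 2 * - (ci j * hh e * sin t))) (at t)"
    by (rule has_vector_derivative_of_real[OF 1])
  have 3: "((\<lambda>t. cis (theta e j t)) has_vector_derivative rate e j t *\<^sub>R (\<i> * cis th)) (at t)"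
    unfolding th_def by (rule has_vector_derivative_cis[OF theta_deriv[OF e0 e1]])
  have "((\<lambda>t. ww e t $ j) has_vector_derivative
      of_real (sqrt x) * (rate e j t *\<^sub>R (\<i> * cis th))
      + of_real (inverse (sqrt x) / 2 * - (ci j * hh e * sin t)) * cis th) (at t)"
    using has_vector_derivative_mult[OF 2 3] unfolding x_def th_def by (simp add: ww_def)
  moreover have "of_real (sqrt x) * (rate e j t *\<^sub>R (\<i> * cis th))
      + of_real (inverse (sqrt x) / 2 * - (ci j * hh e * sin t)) * cis th
      = of_real (1 / (2 * l)) * Y (ww e t) $ j"
  proof -
    have w: "ww e t $ j = of_real (sqrt x) * cis th" by (simp add: ww_def x_def th_def)
    have sx: "complex_of_real (sqrt x) \<noteq> 0" "complex_of_real (sqrt x) * complex_of_real (sqrt x) = of_real x"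
      using x by (simp_all flip: of_real_mult)
    \<comment> \<open>Multiplying and dividing by \<open>ww e t $ j\<close> expresses the conjugate
      of \<open>oth\<close> through the product of all three coordinates, which
      \<open>ww_oth\<close> gives.\<close>
    have "ww e t $ j * cnj (ww e t $ j) = of_real x"
      using cmod_ww[of t j] by (simp add: x_def complex_norm_square[symmetric])
    then have "cnj (oth (ww e t) j) = ww e t $ j * cnj (ww e t $ j * oth (ww e t) j) / of_real x"
      using x by (simp add: field_simps)
    then have o: "cnj (oth (ww e t) j) = of_real (sqrt x) * cis th * Complex (AA e) (FF e t) / of_real x"
      unfolding ww_oth unfolding w by (simp add: complex_cnj)
    have sxx: "sqrt x * (sqrt x * y) = x * y" for y using x by (simp flip: mult.assoc)
    show ?thesis
      unfolding Y_def vec_lambda_beta o rate_def x_def[symmetric] l_def[symmetric] FF_def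
      using x l sx
      by (simp add: complex_eq_iff field_simps sxx)
  qed
  ultimately show ?thesis unfolding l_def by simp
qed

end

section \<open>The orthogonal frame \<open>z\<close>, \<open>X z\<close>, \<open>Y z\<close> and the
  arithmetic of the weights\<close>

lemma ci_nz: "ci j \<noteq> 0"
  using exhaust_3[of j] b_distinct by (auto simp: ci_simps)

lemma act_prod: "act s z $ 1 * act s z $ 2 * act s z $ 3 = z $ 1 * z $ 2 * z $ 3"
proof -
  have "cis (b 1 * s) * cis (b 2 * s) * cis (b 3 * s) = cis (of_int (b 1 + b 2 + b 3) * s)"
    by (simp add: cis_mult distrib_right)
  then have "cis (b 1 * s) * cis (b 2 * s) * cis (b 3 * s) = 1" unfolding b_sum by simp
  moreover have "act s z $ 1 * act s z $ 2 * act s z $ 3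
      = (cis (b 1 * s) * cis (b 2 * s) * cis (b 3 * s)) * (z $ 1 * z $ 2 * z $ 3)"
    by (simp add: mult_ac)
  ultimately show ?thesis by simp
qed

lemma X_nth [simp]: "X z $ j = \<i> * of_int (b j) * z $ j"
  by (simp add: X_def)

lemma Y_nth [simp]: "Y z $ j = \<i> * of_int (ci j) * cnj (oth z j)"
  by (simp add: Y_def)

lemma X_act: "X (act s z) = act s (X z)"
  by (simp add: vec_eq_iff)

lemma oth_act: "oth (act s z) j = cis (- (real_of_int (b j) * s)) * oth z j"
proof -
  have "real_of_int (b 1) + real_of_int (b 2) + real_of_int (b 3) = 0"
    using b_sum by (metis of_int_0 of_int_add)
  then have s: "real_of_int (b 1) = - real_of_int (b 2) - real_of_int (b 3)" by simp
  have k: "cis (b 2 * s) * cis (b 3 * s) = cis (- (b 1 * s))" "cis (b 3 * s) * cis (b 1 * s) = cis (- (b 2 * s))"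
    "cis (b 1 * s) * cis (b 2 * s) = cis (- (b 3 * s))"
    unfolding cis_mult s by (simp_all add: algebra_simps)
  consider "j = 1" | "j = 2" | "j = 3" using exhaust_3[of j] by blast
  then show ?thesis
  proof cases
    case 1
    show ?thesis unfolding 1 oth_simps act_nth k[symmetric] by (simp only: mult_ac)
  next
    case 2
    show ?thesis unfolding 2 oth_simps act_nth k[symmetric] by (simp only: mult_ac)
  next
    case 3
    show ?thesis unfolding 3 oth_simps act_nth k[symmetric] by (simp only: mult_ac)
  qed
qed

lemma Y_act: "Y (act s z) = act s (Y z)"
proof -
  have "cnj (oth (act s z) j) = cis (b j * s) * cnj (oth z j)" for j
    unfolding oth_act by (simp add: cis_cnj)
  then show ?thesis by (simp add: vec_eq_iff)
qed

lemma self_inner_X: "z \<bullet> X z = 0"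
  by (simp add: inner_C3 algebra_simps)

lemma self_inner_Y: "z \<bullet> Y z = 0"
proof -
  have "z \<bullet> Y z = Re (- \<i> * of_int (ci 1 + ci 2 + ci 3) * (z $ 1 * z $ 2 * z $ 3))"
    by (simp add: inner_C3 oth_simps algebra_simps)
  then show ?thesis by (simp add: ci_simps)
qed

lemma X_inner_Y: "X z \<bullet> Y z = 0"
proof -
  have "X z \<bullet> Y z = Re (of_int (b 1 * ci 1 + b 2 * ci 2 + b 3 * ci 3) * (z $ 1 * z $ 2 * z $ 3))"
    by (simp add: inner_C3 oth_simps algebra_simps)
  then show ?thesis by (simp add: ci_simps algebra_simps)
qed

lemma XX_inner_X: "X (X z) \<bullet> X z = 0"
  by (simp add: inner_C3 algebra_simps)

lemma XX_inner_Y: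
  assumes "Im (z $ 1 * z $ 2 * z $ 3) = 0"
  shows "X (X z) \<bullet> Y z = 0"
proof -
  have "X (X z) \<bullet> Y z = Re (\<i> * of_int ((b 1)\<^sup>2 * ci 1 + (b 2)\<^sup>2 * ci 2 + (b 3)\<^sup>2 * ci 3) * (z $ 1 * z $ 2 * z $ 3))"
    by (simp add: inner_C3 oth_simps algebra_simps power2_eq_square)
  moreover have "Re (\<i> * of_int m * P) = - of_int m * Im P" for m P by simp
  ultimately show ?thesis using assms by (metis mult_zero_right)
qed

text \<open>The determinant pairs \<open>Y z\<close> with the cross product of \<open>z\<close> and
  \<open>X z\<close>, which is the conjugate of \<open>Y z\<close>. So \<open>Omega\<close> is real
  and nonnegative on the frame: this is the phase 1 condition.\<close>

lemma Omega_X_Y: "Omega z (X z) (Y z) = of_real (Y z \<bullet> Y z)"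
proof -
  have "Omega z (X z) (Y z) = Y z $ 1 * cnj (Y z $ 1) + Y z $ 2 * cnj (Y z $ 2) + Y z $ 3 * cnj (Y z $ 3)"
    unfolding Omega_def det_3 by (simp add: oth_simps ci_simps algebra_simps)
  then show ?thesis unfolding complex_norm_square[symmetric] inner_C3 by simp
qed

lemma X_nz:
  assumes "\<And>j. z $ j \<noteq> 0"
  shows "X z \<noteq> 0"
  using assms b_distinct by (auto simp: C3_eq_iff)

lemma Y_nz:
  assumes "\<And>j. z $ j \<noteq> 0"
  shows "Y z \<noteq> 0"
  using assms b_distinct by (auto simp: C3_eq_iff oth_simps ci_simps)

text \<open>Lagrange's identity for the complex cross product of \<open>z\<close> and \<open>X z\<close>.\<close>
lemma Y_norm:
  assumes "(\<Sum>j\<in>UNIV. of_int (b j) * (cmod (z $ j))\<^sup>2) = 0"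
  shows "Y z \<bullet> Y z = (z \<bullet> z) * (X z \<bullet> X z)"
proof -
  define p q r where "p = (cmod (z $ 1))\<^sup>2" and "q = (cmod (z $ 2))\<^sup>2" and "r = (cmod (z $ 3))\<^sup>2"
  have n: "Re (u * cnj u) = (cmod u)\<^sup>2" for u by (simp add: complex_norm_square[symmetric])
  have m: "b 1 * p + b 2 * q + b 3 * r = 0" using assms unfolding sum_3 p_def q_def r_def by simp
  have zz: "z \<bullet> z = p + q + r" unfolding inner_C3 n p_def q_def r_def ..
  have XX: "X z \<bullet> X z = (b 1)\<^sup>2 * p + (b 2)\<^sup>2 * q + (b 3)\<^sup>2 * r"
    unfolding inner_C3 n p_def q_def r_def by (simp add: norm_mult power_mult_distrib)
  have YY: "Y z \<bullet> Y z = (real_of_int (ci 1))\<^sup>2 * (q * r) + (real_of_int (ci 2))\<^sup>2 * (r * p) + (real_of_int (ci 3))\<^sup>2 * (p * q)"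
    unfolding inner_C3 n p_def q_def r_def by (simp add: norm_mult power_mult_distrib oth_simps)
  have "Y z \<bullet> Y z = (z \<bullet> z) * (X z \<bullet> X z) - (b 1 * p + b 2 * q + b 3 * r)\<^sup>2"
    unfolding zz XX YY ci_simps by (simp add: power2_eq_square algebra_simps)
  then show ?thesis unfolding m by simp
qed

text \<open>\<open>(1,1,1)\<close>, \<open>ci\<close> and \<open>b\<close> form an orthogonal basis.
  This serves twice: for phase increments modulo the circle group and for the diagonal of a
  Hermitian form vanishing on the cone.\<close>

lemma perpendicular_multiple:
  fixes u :: "3 \<Rightarrow> real"
  assumes s: "u 1 + u 2 + u 3 = 0" and cu: "ci 1 * u 1 + ci 2 * u 2 + ci 3 * u 3 = 0"
  shows "\<exists>x::real. \<forall>j. u j = x * real_of_int (b j)"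
proof -
  define p q r where "p = real_of_int (b 1)" and "q = real_of_int (b 2)" and "r = real_of_int (b 3)"
  have r: "r = - p - q" unfolding p_def q_def r_def using b_sum by (simp flip: of_int_minus of_int_diff)
  have u3: "u 3 = - u 1 - u 2" using s by simp
  have "(q - r) * u 1 + (r - p) * u 2 + (p - q) * u 3 = 0"
    using cu unfolding ci_simps p_def q_def r_def by simp
  then have eq: "q * u 1 = p * u 2" unfolding r u3 by (simp add: algebra_simps)
  have pq: "p \<noteq> q" unfolding p_def q_def using b_distinct by simp
  show ?thesis
  proof (cases "p = 0")
    case False
    define x where "x = u 1 / p"
    have "u 1 = x * p" "u 2 = x * q" "u 3 = x * r"
      using eq False unfolding r u3 x_def by (simp_all add: field_simps)
    then have "u j = x * b j" for j using exhaust_3[of j] unfolding p_def q_def r_def by auto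
    then show ?thesis by blast
  next
    case True
    with pq have "q \<noteq> 0" by simp
    define x where "x = u 2 / q"
    have "u 1 = x * p" "u 2 = x * q" "u 3 = x * r"
      using eq True \<open>q \<noteq> 0\<close> unfolding r u3 x_def by (simp_all add: field_simps)
    then have "u j = x * b j" for j using exhaust_3[of j] unfolding p_def q_def r_def by auto
    then show ?thesis by blast
  qed
qed

lemma third_index:
  assumes "i \<noteq> (j::3)"
  obtains m where "m \<noteq> i" "m \<noteq> j" "\<And>x. x = i \<or> x = j \<or> x = m" "b m = - b i - b j"
    "b i \<noteq> b j" "b m \<noteq> b i" "b m \<noteq> b j"
proof -
  have all: "x = 1 \<or> x = 2 \<or> x = 3" for x :: 3 by (rule exhaust_3)
  consider "i = 1" "j = 2" | "i = 2" "j = 1" | "i = 1" "j = 3" | "i = 3" "j = 1" | "i = 2" "j = 3" | "i = 3" "j = 2"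
    using assms all[of i] all[of j] by blast
  then show thesis
  proof cases
    case 1 show thesis by (rule that[of 3]) (use 1 all b_sum b_distinct in auto)
  next
    case 2 show thesis by (rule that[of 3]) (use 2 all b_sum b_distinct in auto)
  next
    case 3 show thesis by (rule that[of 2]) (use 3 all b_sum b_distinct in auto)
  next
    case 4 show thesis by (rule that[of 2]) (use 4 all b_sum b_distinct in auto)
  next
    case 5 show thesis by (rule that[of 1]) (use 5 all b_sum b_distinct in auto)
  next
    case 6 show thesis by (rule that[of 1]) (use 6 all b_sum b_distinct in auto)
  qed
qed

text \<open>If one weight is 0, the other two are opposite; the equality \<open>ci m = ci i\<close>
  then makes the coordinates \<open>i\<close> and \<open>m\<close> of the curve equal in
  modulus.\<close>

lemma ci_middle:
  assumes "i \<noteq> j" "m \<noteq> i" "m \<noteq> j" "b j = 0"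
  shows "ci m = ci i" "ci j = - 2 * ci i"
proof -
  have "ci m = ci i \<and> ci j = - 2 * ci i"
    using assms exhaust_3[of i] exhaust_3[of j] exhaust_3[of m] b_sum
    by (auto simp: ci_simps)
  then show "ci m = ci i" "ci j = - 2 * ci i" by auto
qed

text \<open>Two differences of distinct weights can agree only if the three weights form an
  arithmetic progression; as they sum to 0, its middle term is 0.\<close>

lemma frequency_pairs:
  assumes ij: "i \<noteq> j" and m: "m \<noteq> i" "m \<noteq> j" "\<And>x. x = i \<or> x = j \<or> x = m" "b m = - b i - b j"
    "b i \<noteq> b j" "b m \<noteq> b i" "b m \<noteq> b j"
  shows "{p. b (snd p) - b (fst p) = b j - b i} =
    (if b j = 0 then {(i, j), (j, m)} else if b i = 0 then {(i, j), (m, i)} else {(i, j)})"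
proof (rule set_eqI)
  fix p :: "3 \<times> 3"
  obtain k l where p: "p = (k, l)" by (cases p)
  have "k = i \<or> k = j \<or> k = m" "l = i \<or> l = j \<or> l = m" using m(3) by blast+
  then show "p \<in> {p. b (snd p) - b (fst p) = b j - b i} \<longleftrightarrow>
      p \<in> (if b j = 0 then {(i, j), (j, m)} else if b i = 0 then {(i, j), (m, i)} else {(i, j)})"
    using ij m(1,2,4-7) unfolding p by (elim disjE) (auto split: if_splits)
qed

lemma commuting_diagonal:
  assumes "\<And>s. A ** Gmat (b 1) (b 2) (b 3) s = Gmat (b 1) (b 2) (b 3) s ** A" and ij: "i \<noteq> j"
  shows "A $ i $ j = 0"
proof -
  have v: "(vector [b 1, b 2, b 3] :: int^3) $ i = b i" for i :: 3
    using exhaust_3[of i] by auto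
  have G: "Gmat (b 1) (b 2) (b 3) s $ i $ j = (if i = j then cis (of_int (b i) * s) else 0)" for s i j
    unfolding Gmat_def v by (simp add: cis_conv_exp)
  \<comment> \<open>For this \<open>s\<close> the circle element acts on the coordinates
    \<open>i\<close> and \<open>j\<close> with opposite signs, so commuting kills the entry.\<close>
  define s where "s = pi / (of_int (b i) - of_int (b j))"
  have "b i \<noteq> b j" using ij b_distinct exhaust_3[of i] exhaust_3[of j] by auto
  then have bs: "of_int (b i) * s = of_int (b j) * s + pi" unfolding s_def by (simp add: field_simps)
  have "(A ** Gmat (b 1) (b 2) (b 3) s) $ i $ j = A $ i $ j * cis (of_int (b j) * s)"
    unfolding matrix_matrix_mult_def by (simp add: G if_distrib cong: if_cong)
  moreover have "(Gmat (b 1) (b 2) (b 3) s ** A) $ i $ j = cis (of_int (b i) * s) * A $ i $ j"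
    unfolding matrix_matrix_mult_def by (simp add: G if_distrib[of "\<lambda>x. x * _"] cong: if_cong)
  ultimately have "A $ i $ j * cis (of_int (b j) * s) = cis (of_int (b i) * s) * A $ i $ j"
    using assms(1) by metis
  also have "cis (of_int (b i) * s) = - cis (of_int (b j) * s)" unfolding bs by (simp add: cis_mult[symmetric])
  finally show ?thesis by simp
qed

end

section \<open>The cone and its link\<close>

text \<open>After \<open>n\<close> periods the curve returns up to the circle element with parameter
  \<open>sg\<close>. Minimality of \<open>n\<close> makes the torus parametrization injective and
  separates the monodromy cosets from the circle group.\<close>

locale closed_weights = circle_weights +
  fixes e sg :: real and n :: nat
  assumes e_pos: "0 < e" and e_le: "e \<le> emax"
    and n_pos: "0 < n"
    and closing: "\<And>j. cis (of_nat n * beta e j) = cis (of_int (b j) * sg)"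
    and minimal: "\<And>k s. 0 < k \<Longrightarrow> k < n \<Longrightarrow> \<exists>j. cis (of_nat k * beta e j) \<noteq> cis (of_int (b j) * s)"
begin

lemma e_nonneg: "0 \<le> e"
  using e_pos by simp

abbreviation w :: "real \<Rightarrow> C3" where "w \<equiv> ww e"

lemma theta_shift_int: "theta e j (t + 2 * pi * of_int k) = theta e j t + of_int k * beta e j"
proof (induction k rule: int_induct[where k=0])
  case base
  then show ?case by simp
next
  case (step1 i)
  have "t + 2 * pi * of_int (i + 1) = (t + 2 * pi * of_int i) + 2 * pi" by (simp add: algebra_simps)
  then have "theta e j (t + 2 * pi * of_int (i + 1)) = theta e j (t + 2 * pi * of_int i) + beta e j"
    using theta_shift[OF e_nonneg e_le] by (simp only:)
  then show ?case using step1 by (simp add: distrib_right)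
next
  case (step2 i)
  have "t + 2 * pi * of_int i = (t + 2 * pi * of_int (i - 1)) + 2 * pi" by (simp add: algebra_simps)
  then have "theta e j (t + 2 * pi * of_int i) = theta e j (t + 2 * pi * of_int (i - 1)) + beta e j"
    using theta_shift[OF e_nonneg e_le] by (simp only:)
  then show ?case using step2 by (simp add: left_diff_distrib)
qed

lemma w_shift_int: "w (t + 2 * pi * of_int k) $ j = cis (of_int k * beta e j) * w t $ j"
proof -
  have "cos (t + 2 * pi * of_int k) = cos t" using sin_cos_eq_iff[of "t + 2 * pi * of_int k" t] by blast
  then have "xx e j (t + 2 * pi * of_int k) = xx e j t" by (simp add: xx_def vv_def)
  then show ?thesis by (simp add: ww_def theta_shift_int cis_mult[symmetric])
qed

lemma xx_eq_imp_cos_eq: "xx e j t = xx e j t' \<Longrightarrow> cos t = cos t'"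
  using ci_nz[of j] hh_pos[OF e_nonneg e_le e_pos] by (simp add: xx_def vv_def)

text \<open>The circle changes neither the moduli nor the product of the coordinates. The moduli
  determine \<open>cos t\<close>, and the imaginary part of the product then determines
  \<open>sin t\<close>; the remaining phases give the relation on \<open>beta\<close>.\<close>

lemma act_w_eq_imp:
  assumes "act s (w t) = act s' (w t')"
  shows "\<exists>k::int. t = t' + 2 * pi * of_int k \<and> (\<forall>j. cis (of_int k * beta e j) = cis (of_int (b j) * (s' - s)))"
proof -
  have "cmod (act s (w t) $ 1) = cmod (act s' (w t') $ 1)" using assms by simp
  then have "cmod (w t $ 1) = cmod (w t' $ 1)" by (simp add: norm_mult)
  then have "xx e 1 t = xx e 1 t'" using cmod_ww[OF e_nonneg e_le] by metis
  then have c: "cos t = cos t'" by (rule xx_eq_imp_cos_eq)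
  have "w t $ 1 * w t $ 2 * w t $ 3 = w t' $ 1 * w t' $ 2 * w t' $ 3"
    using act_prod[of s "w t"] act_prod[of s' "w t'"] assms by metis
  then have "FF e t = FF e t'" unfolding ww_prod[OF e_nonneg e_le] by simp
  moreover have "LL e t = LL e t'" by (simp add: LL_def c)
  ultimately have "sin t = sin t'"
    using LL_pos[OF e_nonneg e_le, of t'] hh_pos[OF e_nonneg e_le e_pos] by (simp add: FF_def)
  with c obtain k :: int where k: "t = t' + 2 * pi * of_int k" using sin_cos_eq_iff by blast
  have "cis (of_int k * beta e j) = cis (of_int (b j) * (s' - s))" for j
  proof -
    have "cis (b j * s) * (cis (of_int k * beta e j) * w t' $ j) = cis (b j * s') * w t' $ j"
      using arg_cong[OF assms, of "\<lambda>z. z $ j"] unfolding k by (simp only: act_nth w_shift_int)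
    then have "cis (b j * s) * cis (of_int k * beta e j) = cis (b j * s')"
      using ww_nz[OF e_nonneg e_le] by (simp flip: mult.assoc)
    then have "cis (- (b j * s)) * (cis (b j * s) * cis (of_int k * beta e j)) = cis (- (b j * s)) * cis (b j * s')"
      by simp
    then show ?thesis by (simp add: cis_mult flip: mult.assoc) (simp add: algebra_simps)
  qed
  with k show ?thesis by blast
qed

lemma closing_int: "cis (of_int (int n * l) * beta e j) = cis (of_int (b j) * (of_int l * sg))"
proof -
  have "cis (of_int (int n * l) * beta e j) = cis (of_nat n * beta e j) powi l"
    by (simp add: cis_power_int mult_ac)
  also have "\<dots> = cis (of_int (b j) * (of_int l * sg))"
    unfolding closing by (simp add: cis_power_int mult_ac)
  finally show ?thesis .
qed

text \<open>Otherwise the remainder of \<open>k\<close> modulo \<open>n\<close> would be a smaller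
  closing number, after removing multiples of \<open>sg\<close>.\<close>

lemma closing_dvd:
  assumes "\<And>j. cis (of_int k * beta e j) = cis (of_int (b j) * s)"
  shows "int n dvd k"
proof (rule ccontr)
  assume nd: "\<not> int n dvd k"
  define r q where "r = k mod int n" and "q = k div int n"
  have k: "k = int n * q + r" by (simp add: r_def q_def)
  have "r \<noteq> 0" using nd mod_eq_0_iff_dvd[of k "int n"] unfolding r_def by blast
  moreover have "0 \<le> r" "r < int n" unfolding r_def using n_pos by (auto intro: pos_mod_sign pos_mod_bound)
  ultimately have r: "0 < r" "r < int n" by auto
  have "cis (of_nat (nat r) * beta e j) = cis (of_int (b j) * (s - of_int q * sg))" for j
  proof -
    have "cis (of_int (int n * q) * beta e j) * cis (of_int r * beta e j) = cis (of_int (b j) * s)"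
      using assms[of j] unfolding k by (simp add: cis_mult algebra_simps)
    then have "cis (of_int (b j) * (of_int q * sg)) * cis (of_int r * beta e j) = cis (of_int (b j) * s)"
      unfolding closing_int .
    then have "cis (- (of_int (b j) * (of_int q * sg))) * (cis (of_int (b j) * (of_int q * sg)) * cis (of_int r * beta e j))
        = cis (- (of_int (b j) * (of_int q * sg))) * cis (of_int (b j) * s)" by simp
    then show ?thesis using r by (simp add: cis_mult flip: mult.assoc) (simp add: algebra_simps)
  qed
  then show False using minimal[of "nat r"] r by force
qed

text \<open>A Bezout combination of the weights equals 1, so the circle acts effectively.\<close>

lemma act_trivial_imp:
  assumes "\<And>j. cis (of_int (b j) * s) = 1"
  shows "\<exists>k::int. s = 2 * pi * of_int k"
proof -
  have "\<forall>j. \<exists>k::int. of_int (b j) * s = 2 * pi * of_int k"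
    using assms cis_eq_iff[of _ 0] by fastforce
  then obtain m :: "3 \<Rightarrow> int" where m: "\<And>j. of_int (b j) * s = 2 * pi * of_int (m j)" by metis
  obtain x y where xy: "x * b 1 + y * b 2 = gcd (b 1) (b 2)" using bezout_int by blast
  obtain p q where pq: "p * gcd (b 1) (b 2) + q * b 3 = 1" using bezout_int b_gcd by metis
  have "s = of_int (p * (x * b 1 + y * b 2) + q * b 3) * s" unfolding xy pq by simp
  also have "\<dots> = of_int (p * x) * (of_int (b 1) * s) + of_int (p * y) * (of_int (b 2) * s) + of_int q * (of_int (b 3) * s)"
    by (simp add: algebra_simps)
  also have "\<dots> = 2 * pi * of_int (p * x * m 1 + p * y * m 2 + q * m 3)"
    unfolding m by (simp add: algebra_simps)
  finally show ?thesis by blast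
qed

text \<open>The term \<open>sg * t / (2 * pi)\<close> undoes the monodromy, so that \<open>W\<close> is \<open>2\<pi>\<close>-periodic in both arguments.\<close>
definition W :: "real \<Rightarrow> real \<Rightarrow> C3" where
  "W s t = act (s - sg * t / (2 * pi)) (w (of_nat n * t))"

lemma W_cis_cong:
  assumes "cis s = cis s'" "cis t = cis t'"
  shows "W s t = W s' t'"
proof -
  obtain k l :: int where k: "s = s' + 2 * pi * of_int k" and l: "t = t' + 2 * pi * of_int l"
    using assms cis_eq_iff by metis
  have nt: "of_nat n * t = of_nat n * t' + 2 * pi * of_int (int n * l)" by (simp add: l algebra_simps)
  have st: "s - sg * t / (2 * pi) = (s' - sg * t' / (2 * pi)) + 2 * pi * of_int k - of_int l * sg"
    by (simp add: k l field_simps)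
  have "W s t $ j = W s' t' $ j" for j
  proof -
    have "W s t $ j = cis (b j * ((s' - sg * t' / (2 * pi)) + 2 * pi * of_int k - of_int l * sg))
        * (cis (of_int (b j) * (of_int l * sg)) * w (of_nat n * t') $ j)"
      unfolding W_def act_nth nt st w_shift_int closing_int ..
    also have "\<dots> = cis (b j * ((s' - sg * t' / (2 * pi)) + 2 * pi * of_int k)) * w (of_nat n * t') $ j"
      by (simp add: cis_mult flip: mult.assoc) (simp add: algebra_simps)
    also have "cis (b j * ((s' - sg * t' / (2 * pi)) + 2 * pi * of_int k)) = cis (b j * (s' - sg * t' / (2 * pi)))"
      unfolding cis_eq_iff by (intro exI[of _ "b j * k"]) (simp add: algebra_simps)
    finally show ?thesis by (simp add: W_def)
  qed
  then show ?thesis by (simp add: vec_eq_iff)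
qed

lemma W_eq_imp:
  assumes "W s t = W s' t'"
  shows "cis s = cis s'" "cis t = cis t'"
proof -
  obtain k :: int where k: "of_nat n * t = of_nat n * t' + 2 * pi * of_int k"
    and kb: "\<And>j. cis (of_int k * beta e j) = cis (of_int (b j) * ((s' - sg * t' / (2 * pi)) - (s - sg * t / (2 * pi))))"
    using act_w_eq_imp[OF assms[unfolded W_def]] by auto
  obtain l where l: "k = int n * l" using closing_dvd[OF kb] by (auto simp: dvd_def)
  have "of_nat n * (t - t' - 2 * pi * of_int l) = 0" using k unfolding l by (simp add: algebra_simps)
  then have t: "t = t' + 2 * pi * of_int l" using n_pos by simp
  then show "cis t = cis t'" unfolding cis_eq_iff by blast
  have arg: "(s' - sg * t' / (2 * pi)) - (s - sg * t / (2 * pi)) = s' - s + of_int l * sg"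
    by (simp add: t field_simps)
  have "cis (of_int (b j) * (s - s')) = 1" for j
  proof -
    have "cis (of_int (b j) * (of_int l * sg)) = cis (of_int (b j) * (s' - s + of_int l * sg))"
      using kb[of j] unfolding l closing_int arg .
    then have "cis (of_int (b j) * (s - s') ) * cis (of_int (b j) * (of_int l * sg))
        = cis (of_int (b j) * (s - s') ) * cis (of_int (b j) * (s' - s + of_int l * sg))" by simp
    also have "\<dots> = cis (of_int (b j) * (of_int l * sg))" by (simp add: cis_mult) (simp add: algebra_simps)
    finally show ?thesis by simp
  qed
  then obtain m :: int where "s - s' = 2 * pi * of_int m" using act_trivial_imp by blast
  then show "cis s = cis s'" unfolding cis_eq_iff by (intro exI[of _ m]) simp
qed

text \<open>Swept out by the whole curve, before any reduction to the torus, so that the set depends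
  on \<open>b\<close> and \<open>e\<close> alone.\<close>

definition N :: "C3 set" where
  "N = {r *\<^sub>R act s (w t) | r s t. 0 \<le> r}"

lemma act_w_W: "act s (w t) = W (s + sg * t / (2 * pi * of_nat n)) (t / of_nat n)"
  using n_pos by (simp add: W_def field_simps)

lemma N_W: "N = {r *\<^sub>R W s t | r s t. 0 \<le> r}"
  unfolding N_def using act_w_W W_def by metis

text \<open>The jump of \<open>Arg\<close> is harmless, since \<open>W\<close> depends on its
  arguments only through \<open>cis\<close>; at the vertex the norm factor removes the
  angles.\<close>

definition FT :: "complex \<times> complex \<Rightarrow> C3" where
  "FT p = norm (fst p) *\<^sub>R W (Arg (fst p)) (Arg (snd p))"

lemma norm_W: "norm (W s t) = sqrt 3"
  unfolding W_def norm_act using norm_ww[OF e_nonneg e_le] by (metis norm_ge_zero real_sqrt_unique)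

lemma norm_FT: "norm (FT p) = sqrt 3 * norm (fst p)"
  by (simp add: FT_def norm_W)

lemma FT_polar:
  assumes "r \<ge> 0"
  shows "FT (of_real r * cis s, of_real r * cis t) = r *\<^sub>R W s t"
proof (cases "r = 0")
  case True
  then show ?thesis by (simp add: FT_def)
next
  case False
  then have r: "r > 0" using assms by simp
  have "cis (Arg (of_real r * cis x)) = cis x" for x
    using r by (subst cis_Arg) (auto simp: sgn_mult sgn_of_real sgn_cis)
  then have "W (Arg (of_real r * cis s)) (Arg (of_real r * cis t)) = W s t" by (intro W_cis_cong)
  then show ?thesis using r by (simp add: FT_def norm_mult)
qed

lemma FT_image: "FT ` cone_T2 = N"
proof
  show "FT ` cone_T2 \<subseteq> N"
    unfolding N_W FT_def by fastforce
  show "N \<subseteq> FT ` cone_T2"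
  proof
    fix z assume "z \<in> N"
    then obtain r s t where "0 \<le> r" "z = r *\<^sub>R W s t" unfolding N_W by blast
    then show "z \<in> FT ` cone_T2" using FT_polar polar_in_cone_T2 by (metis image_eqI)
  qed
qed

lemma FT_inj: "inj_on FT cone_T2"
proof (rule inj_onI)
  fix p q assume "p \<in> cone_T2" "q \<in> cone_T2" and eq: "FT p = FT q"
  then obtain r s t r' s' t' where p: "r \<ge> 0" "p = (of_real r * cis s, of_real r * cis t)" "r = norm (fst p)"
    and q: "r' \<ge> 0" "q = (of_real r' * cis s', of_real r' * cis t')" "r' = norm (fst q)"
    by (metis cone_T2_polar)
  have rr: "r = r'" using arg_cong[OF eq, of norm] unfolding norm_FT p(3) q(3) by simp
  show "p = q"
  proof (cases "r = 0")
    case True then show ?thesis using p(2) q(2) rr by simp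
  next
    case False
    have "r *\<^sub>R W s t = r *\<^sub>R W s' t'" using eq FT_polar p(1) q(1) unfolding p(2) q(2) rr by metis
    then have "W s t = W s' t'" using False by simp
    then show ?thesis using W_eq_imp p(2) q(2) rr by metis
  qed
qed

lemma w_continuous: "continuous_on S w"
proof -
  have "continuous_on UNIV (\<lambda>t. w t $ j)" for j
    using ww_deriv[OF e_nonneg e_le]
    by (meson continuous_at_imp_continuous_on has_vector_derivative_continuous)
  then have "continuous_on UNIV (\<lambda>t. \<chi> j. w t $ j)" by (rule continuous_on_vec_lambda)
  then have "continuous_on UNIV w" by simp
  then show ?thesis by (rule continuous_on_subset) simp
qed

lemma W_continuous: "continuous_on S (\<lambda>p. W (fst p) (snd p))"
proof -
  have "continuous_on S (\<lambda>p::real\<times>real. w (of_nat n * snd p))"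
    by (rule continuous_on_compose2[OF w_continuous[of UNIV]]) (auto intro!: continuous_intros)
  then have "continuous_on S (\<lambda>p::real\<times>real. w (of_nat n * snd p) $ j)" for j
    by (rule continuous_on_component)
  then show ?thesis unfolding W_def act_def
    by (intro continuous_on_vec_lambda continuous_on_mult) (auto intro!: continuous_intros)
qed

text \<open>At the vertex the norm alone gives the limit. Elsewhere a nearby formula with rotated
  arguments avoids the branch cuts.\<close>

lemma FT_continuous: "continuous_on cone_T2 FT"
  unfolding continuous_on_eq_continuous_within
proof
  fix p assume p: "p \<in> cone_T2"
  show "continuous (at p within cone_T2) FT"
  proof (cases "fst p = 0")
    case True
    then have 0: "FT p = 0" by (simp add: FT_def)
    have "((\<lambda>q. sqrt 3 * norm (fst q)) \<longlongrightarrow> sqrt 3 * norm (fst p)) (at p within cone_T2)"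
      by (intro tendsto_intros)
    then have "(FT \<longlongrightarrow> 0) (at p within cone_T2)"
      using True by (intro Lim_null_comparison[of FT "\<lambda>q. sqrt 3 * norm (fst q)"]) (auto simp: norm_FT)
    then show ?thesis unfolding continuous_within 0 .
  next
    case False
    define z u where "z = fst p" and "u = snd p"
    have z: "z \<noteq> 0" and u: "u \<noteq> 0" using False p unfolding z_def u_def cone_T2_def by auto
    \<comment> \<open>Dividing by \<open>z\<close> and \<open>u\<close> puts the base point at
      argument 0, far from the cut; by \<open>W_cis_cong\<close> the value is still that of
      \<open>FT\<close>.\<close>
    define f where "f = (\<lambda>q. norm (fst q) *\<^sub>R W (Arg (fst q / z) + Arg z) (Arg (snd q / u) + Arg u))"
    have "continuous (at p) (\<lambda>q. (Arg (fst q / z) + Arg z, Arg (snd q / u) + Arg u))"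
    proof (intro continuous_intros)
      show "continuous (at p) (\<lambda>q. Arg (fst q / z))"
        by (rule continuous_within_compose3[where g=Arg and f="\<lambda>q. fst q / z"])
           (use z in \<open>auto intro!: continuous_at_Arg continuous_intros simp: z_def\<close>)
      show "continuous (at p) (\<lambda>q. Arg (snd q / u))"
        by (rule continuous_within_compose3[where g=Arg and f="\<lambda>q. snd q / u"])
           (use u in \<open>auto intro!: continuous_at_Arg continuous_intros simp: u_def\<close>)
    qed
    moreover have "isCont (\<lambda>p. W (fst p) (snd p)) x" for x
      using W_continuous[of UNIV] by (cases x) (simp add: continuous_on_eq_continuous_at)
    ultimately have "continuous (at p) (\<lambda>q. W (Arg (fst q / z) + Arg z) (Arg (snd q / u) + Arg u))"
      using continuous_at_compose[of p "\<lambda>q. (Arg (fst q / z) + Arg z, Arg (snd q / u) + Arg u)" "\<lambda>p. W (fst p) (snd p)"]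
      by (simp add: o_def)
    then have "continuous (at p within cone_T2) (\<lambda>q. W (Arg (fst q / z) + Arg z) (Arg (snd q / u) + Arg u))"
      by (rule continuous_at_imp_continuous_within)
    moreover have "continuous (at p within cone_T2) (\<lambda>q. norm (fst q))"
      by (intro continuous_intros)
    ultimately have fc: "continuous (at p within cone_T2) f"
      unfolding f_def by (rule continuous_scaleR[rotated])
    have cisA: "cis (Arg (x / y) + Arg y) = cis (Arg x)" if "x \<noteq> 0" "y \<noteq> 0" for x y
      using that by (simp add: cis_mult[symmetric] cis_Arg sgn_divide sgn_eq_0_iff)
    have "f q = FT q" if "fst q \<noteq> 0" "snd q \<noteq> 0" for q
      unfolding f_def FT_def using that z u by (intro arg_cong2[of _ _ _ _ "(*\<^sub>R)"] W_cis_cong cisA) auto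
    moreover have "eventually (\<lambda>q. fst q \<noteq> 0 \<and> snd q \<noteq> 0) (at p within cone_T2)"
    proof (rule eventually_conj)
      show "eventually (\<lambda>q. fst q \<noteq> 0) (at p within cone_T2)"
        using tendsto_imp_eventually_ne[OF tendsto_fst[OF tendsto_ident_at]] z unfolding z_def by blast
      show "eventually (\<lambda>q. snd q \<noteq> 0) (at p within cone_T2)"
        using tendsto_imp_eventually_ne[OF tendsto_snd[OF tendsto_ident_at]] u unfolding u_def by blast
    qed
    ultimately have ev: "eventually (\<lambda>q. f q = FT q) (at p within cone_T2)" and fp: "f p = FT p"
      using z u unfolding z_def u_def by (auto elim: eventually_mono)
    have "(f \<longlongrightarrow> FT p) (at p within cone_T2)" using fc unfolding continuous_within fp .
    then show ?thesis unfolding continuous_within by (rule Lim_transform_eventually[OF _ ev])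
  qed
qed

text \<open>\<open>FT\<close> is proper, because the norm of \<open>FT p\<close> controls that of
  \<open>p\<close> on the model cone. This yields both the closedness of \<open>N\<close> and the
  continuity of the inverse.\<close>

lemma FT_closed_map:
  assumes "closedin (top_of_set cone_T2) V"
  shows "closed (FT ` V)"
proof -
  have "closedin (top_of_set UNIV) (FT ` V)"
  proof (rule proper_map[OF assms])
    fix U :: "C3 set" assume "compact U"
    then obtain B where B: "\<And>x. x \<in> U \<Longrightarrow> norm x \<le> B" using compact_imp_bounded bounded_iff by metis
    have "closed (cone_T2 \<inter> FT -` U)"
      using continuous_on_closed_vimage[OF closed_cone_T2] FT_continuous \<open>compact U\<close> compact_imp_closed
      by (metis inf_commute)
    moreover have "bounded (cone_T2 \<inter> FT -` U)"
      unfolding bounded_iff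
    proof (intro exI ballI)
      fix p assume p: "p \<in> cone_T2 \<inter> FT -` U"
      have "norm p \<le> norm (fst p) + norm (snd p)"
        using norm_Pair_le[of "fst p" "snd p"] by simp
      also have "\<dots> = 2 * norm (fst p)" using p by (auto simp: cone_T2_def)
      also have "\<dots> \<le> 2 * (sqrt 3 * norm (fst p))" by (simp add: mult_le_cancel_right1)
      also have "\<dots> \<le> 2 * B" using B[of "FT p"] p by (simp add: norm_FT)
      finally show "norm p \<le> 2 * B" .
    qed
    ultimately show "compact (cone_T2 \<inter> FT -` U)" by (simp add: compact_eq_bounded_closed)
  qed simp
  then show ?thesis by simp
qed

lemma closed_N: "closed N"
  using FT_closed_map[of cone_T2] FT_image by simp

definition FTinv :: "C3 \<Rightarrow> complex \<times> complex" where
  "FTinv = (SOME g. homeomorphism cone_T2 N FT g)"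

lemma FT_homeomorphism: "homeomorphism cone_T2 N FT FTinv"
proof -
  have "\<exists>g. homeomorphism cone_T2 N FT g"
  proof (rule homeomorphism_injective_closed_map[OF FT_continuous FT_image FT_inj])
    fix U assume U: "closedin (top_of_set cone_T2) U"
    then have "FT ` U \<subseteq> N" using closedin_imp_subset[OF U] FT_image by blast
    then show "closedin (top_of_set N) (FT ` U)" by (rule closed_subset[OF _ FT_closed_map[OF U]])
  qed blast
  then show ?thesis unfolding FTinv_def by (rule someI_ex)
qed

lemma N_homeomorphic: "N homeomorphic cone_T2"
  using FT_homeomorphism homeomorphic_def homeomorphic_sym by blast

lemma is_cone_N: "is_cone N"
proof -
  have "0 \<in> N" unfolding N_def by (rule CollectI, rule exI[of _ 0]) auto
  moreover have sub: "(\<lambda>z. t *\<^sub>R z) ` N \<subseteq> N" if "t > 0" for t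
  proof
    fix z assume "z \<in> (\<lambda>z. t *\<^sub>R z) ` N"
    then obtain z' where "z' \<in> N" "z = t *\<^sub>R z'" by blast
    then obtain r s u where r: "0 \<le> r" "z = t *\<^sub>R (r *\<^sub>R act s (w u))" unfolding N_def by blast
    then show "z \<in> N" unfolding N_def using that by (intro CollectI exI[of _ "t * r"] exI[of _ s] exI[of _ u]) simp
  qed
  moreover have "N \<subseteq> (\<lambda>z. t *\<^sub>R z) ` N" if "t > 0" for t
  proof
    fix z assume "z \<in> N"
    then have "(1 / t) *\<^sub>R z \<in> N" using sub[of "1 / t"] that by auto
    then show "z \<in> (\<lambda>z. t *\<^sub>R z) ` N" using that by (intro image_eqI[of _ _ "(1 / t) *\<^sub>R z"]) auto
  qed
  ultimately show ?thesis unfolding is_cone_def by blast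
qed

lemma W_nz: "W s t $ j \<noteq> 0"
  by (simp add: W_def ww_nz[OF e_nonneg e_le])

lemma moment_W: "(\<Sum>j\<in>UNIV. of_int (b j) * (cmod (W s t $ j))\<^sup>2) = 0"
  using moment_ww[OF e_nonneg e_le, of "of_nat n * t"] by (simp add: W_def norm_mult)

section \<open>Charts and tangent spaces\<close>

definition param :: "real^3 \<Rightarrow> C3" where
  "param p = (p $ 1) *\<^sub>R W (p $ 2) (p $ 3)"

definition gg :: "real \<Rightarrow> real" where
  "gg t = 1 / (2 * sqrt (LL e t))"

lemma gg_pos: "gg t > 0"
  using LL_pos[OF e_nonneg e_le] by (simp add: gg_def)

lemma w_deriv: "((\<lambda>t. w t $ j) has_vector_derivative of_real (gg t) * Y (w t) $ j) (at t)"
  using ww_deriv[OF e_nonneg e_le] by (simp add: gg_def)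

text \<open>The derivative is written as a polynomial in \<open>gg\<close> and \<open>sin\<close>,
  so that \<open>gg\<close> can belong to a differentially closed algebra.\<close>

lemma gg_deriv: "(gg has_real_derivative - 2 * gg t ^ 3 * (K * hh e * sin t)) (at t)"
proof -
  have L: "LL e t > 0" by (rule LL_pos[OF e_nonneg e_le])
  define l where "l = sqrt (LL e t)"
  have l: "l > 0" using L by (simp add: l_def)
  have 1: "((\<lambda>t. sqrt (LL e t)) has_real_derivative inverse l / 2 * (K * hh e * sin t)) (at t)"
    unfolding l_def by (rule DERIV_chain2[OF DERIV_real_sqrt[OF L] LL_deriv])
  have 2: "((\<lambda>t. inverse (sqrt (LL e t))) has_real_derivative
      - (inverse l * (inverse l / 2 * (K * hh e * sin t)) * inverse l)) (at t)"
    using DERIV_inverse'[OF 1] l unfolding l_def by simp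
  have g: "gg = (\<lambda>t. 1/2 * inverse (sqrt (LL e t)))" by (simp add: gg_def fun_eq_iff inverse_eq_divide)
  have "(gg has_real_derivative 1/2 * - (inverse l * (inverse l / 2 * (K * hh e * sin t)) * inverse l)) (at t)"
    unfolding g by (rule DERIV_cmult[OF 2])
  then show ?thesis
    by (rule DERIV_cong) (simp add: gg_def l_def[symmetric] power3_eq_cube inverse_eq_divide)
qed

text \<open>The angle \<open>p $ 3\<close> moves along the curve, which gives the \<open>Y\<close>
  term with chain factor \<open>n * gg\<close>, and also along the orbit through the correction by
  \<open>sg\<close>, which gives the second \<open>X\<close> term.\<close>

lemma param_derivative:
  "(param has_derivative (\<lambda>v. (v $ 1) *\<^sub>R W (p $ 2) (p $ 3) + (v $ 2) *\<^sub>R ((p $ 1) *\<^sub>R X (W (p $ 2) (p $ 3)))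
     + (v $ 3) *\<^sub>R ((- (p $ 1) * sg / (2 * pi)) *\<^sub>R X (W (p $ 2) (p $ 3))
         + (p $ 1 * n * gg (n * p $ 3)) *\<^sub>R Y (W (p $ 2) (p $ 3))))) (at p)"
proof (rule has_derivative_vec_componentwise)
  fix j :: 3
  define ph where "ph = (\<lambda>p::real^3. b j * (p $ 2 - sg * p $ 3 / (2 * pi)))"
  have 1: "(ph has_derivative ph) (at p)"
    by (rule bounded_linear_imp_has_derivative, unfold ph_def linear_conv_bounded_linear[symmetric])
       (intro linearI; simp add: algebra_simps add_divide_distrib)
  have c: "((\<lambda>p. cis (ph p)) has_derivative (\<lambda>v. ph v *\<^sub>R (\<i> * cis (ph p)))) (at p)"
    by (rule has_derivative_cis[OF 1])
  have 3: "((\<lambda>p::real^3. real n * p $ 3) has_derivative (\<lambda>v. real n * v $ 3)) (at p)"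
    by (rule bounded_linear_imp_has_derivative) (auto intro!: bounded_linear_intros)
  have wd: "((\<lambda>p. w (n * p $ 3) $ j) has_derivative
      (\<lambda>v. (n * v $ 3) *\<^sub>R (of_real (gg (n * p $ 3)) * Y (w (n * p $ 3)) $ j))) (at p)"
    using has_derivative_compose[OF 3, of "\<lambda>t. w t $ j"] w_deriv[of j "n * p $ 3"]
    by (simp add: has_vector_derivative_def)
  have r: "((\<lambda>p::real^3. p $ 1) has_derivative (\<lambda>v. v $ 1)) (at p)"
    by (rule bounded_linear_imp_has_derivative) (auto intro!: bounded_linear_intros)
  have eq: "(\<lambda>p. param p $ j) = (\<lambda>p. (p $ 1) *\<^sub>R (cis (ph p) * w (n * p $ 3) $ j))"
    by (simp add: param_def W_def ph_def fun_eq_iff)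
  have D: "((\<lambda>p. param p $ j) has_derivative (\<lambda>v. (p $ 1) *\<^sub>R (cis (ph p) * ((n * v $ 3) *\<^sub>R (of_real (gg (n * p $ 3)) * Y (w (n * p $ 3)) $ j))
      + (ph v *\<^sub>R (\<i> * cis (ph p))) * w (n * p $ 3) $ j) + (v $ 1) *\<^sub>R (cis (ph p) * w (n * p $ 3) $ j))) (at p)"
    unfolding eq by (rule has_derivative_scaleR[OF r has_derivative_mult[OF c wd]])
  have cW: "W (p $ 2) (p $ 3) $ j = cis (ph p) * w (n * p $ 3) $ j"
    and cX: "X (W (p $ 2) (p $ 3)) $ j = \<i> * of_int (b j) * (cis (ph p) * w (n * p $ 3) $ j)"
    and cY: "Y (W (p $ 2) (p $ 3)) $ j = cis (ph p) * Y (w (n * p $ 3)) $ j"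
    unfolding W_def ph_def Y_act by simp_all
  have alg: "r *\<^sub>R (C * ((m * v3) *\<^sub>R (of_real g * yj)) + ((of_int \<beta> * (v2 - sg * v3 / (2 * pi))) *\<^sub>R (\<i> * C)) * wj)
      + v1 *\<^sub>R (C * wj)
      = v1 *\<^sub>R (C * wj) + v2 *\<^sub>R (r *\<^sub>R (\<i> * of_int \<beta> * (C * wj)))
        + v3 *\<^sub>R ((- r * sg / (2 * pi)) *\<^sub>R (\<i> * of_int \<beta> * (C * wj)) + (r * m * g) *\<^sub>R (C * yj))"
    for r m g v1 v2 v3 :: real and C yj wj :: complex and \<beta> :: int
    by (simp add: scaleR_conv_of_real algebra_simps)
  show "((\<lambda>p. param p $ j) has_derivative (\<lambda>v. ((v $ 1) *\<^sub>R W (p $ 2) (p $ 3) + (v $ 2) *\<^sub>R ((p $ 1) *\<^sub>R X (W (p $ 2) (p $ 3)))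
     + (v $ 3) *\<^sub>R ((- (p $ 1) * sg / (2 * pi)) *\<^sub>R X (W (p $ 2) (p $ 3))
         + (p $ 1 * n * gg (n * p $ 3)) *\<^sub>R Y (W (p $ 2) (p $ 3)))) $ j)) (at p)"
    unfolding vector_add_component vector_scaleR_component cW cX cY alg[symmetric]
    using D unfolding ph_def .
qed

definition phase :: "real^3 \<Rightarrow> real" where
  "phase p = p $ 2 - sg * p $ 3 / (2 * pi)"

lemma phase_bounded_linear: "bounded_linear phase"
  unfolding phase_def linear_conv_bounded_linear[symmetric]
  by (intro linearI; simp add: algebra_simps add_divide_distrib)

text \<open>Conjugates of the curve occur because \<open>Y\<close> is antiholomorphic;
  \<open>gg\<close> is the speed factor, and \<open>sin\<close> and \<open>cos\<close> enter through
  the derivative of \<open>gg\<close>.\<close>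

definition gens :: "(real^3 \<Rightarrow> complex) set" where
  "gens = {\<lambda>p. of_real (p $ 1)} \<union> range (\<lambda>j p. cis (of_int (b j) * phase p))
     \<union> range (\<lambda>j p. w (of_nat n * p $ 3) $ j) \<union> range (\<lambda>j p. cnj (w (of_nat n * p $ 3) $ j))
     \<union> {\<lambda>p. of_real (gg (of_nat n * p $ 3)), \<lambda>p. of_real (sin (of_nat n * p $ 3)), \<lambda>p. of_real (cos (of_nat n * p $ 3))}"

lemma gens_members:
  "(\<lambda>p. of_real (p $ 1)) \<in> generated_algebra gens"
  "(\<lambda>p. cis (of_int (b j) * phase p)) \<in> generated_algebra gens"
  "(\<lambda>p. w (of_nat n * p $ 3) $ j) \<in> generated_algebra gens"
  "(\<lambda>p. cnj (w (of_nat n * p $ 3) $ j)) \<in> generated_algebra gens"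
  "(\<lambda>p. of_real (gg (of_nat n * p $ 3))) \<in> generated_algebra gens"
  "(\<lambda>p. of_real (sin (of_nat n * p $ 3))) \<in> generated_algebra gens"
  "(\<lambda>p. of_real (cos (of_nat n * p $ 3))) \<in> generated_algebra gens"
  by ((rule generated_algebra.gen; unfold gens_def; blast))+

lemma oth_algebra:
  "(\<lambda>p. oth (w (of_nat n * p $ 3)) j) \<in> generated_algebra gens"
  "(\<lambda>p. cnj (oth (w (of_nat n * p $ 3)) j)) \<in> generated_algebra gens"
  using exhaust_3[of j] by (auto simp: oth_simps intro!: generated_algebra.mult gens_members)

lemma gens_derivative:
  assumes "f \<in> gens"
  shows "\<exists>f'. (\<forall>x. (f has_derivative f' x) (at x)) \<and> (\<forall>v. (\<lambda>x. f' x v) \<in> generated_algebra gens)"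
proof -
  have l1: "bounded_linear (\<lambda>p::real^3. p $ 1)" by (rule bounded_linear_vec_nth)
  have l3: "bounded_linear (\<lambda>p::real^3. of_nat n * p $ 3)"
    by (rule bounded_linear_compose[OF bounded_linear_mult_right bounded_linear_vec_nth])
  have Yalg: "(\<lambda>p. of_real (gg (of_nat n * p $ 3)) * Y (w (of_nat n * p $ 3)) $ j) \<in> generated_algebra gens" for j
    unfolding Y_nth by (intro generated_algebra.mult generated_algebra.const gens_members oth_algebra)
  have Yalg': "(\<lambda>p. cnj (of_real (gg (of_nat n * p $ 3)) * Y (w (of_nat n * p $ 3)) $ j)) \<in> generated_algebra gens" for j
  proof -
    have "(\<lambda>p. of_real (gg (of_nat n * p $ 3)) * ((- \<i> * of_int (ci j)) * oth (w (of_nat n * p $ 3)) j)) \<in> generated_algebra gens"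
      by (intro generated_algebra.mult generated_algebra.const gens_members oth_algebra)
    then show ?thesis by simp
  qed
  consider "f = (\<lambda>p. of_real (p $ 1))" | j where "f = (\<lambda>p. cis (of_int (b j) * phase p))"
    | j where "f = (\<lambda>p. w (of_nat n * p $ 3) $ j)" | j where "f = (\<lambda>p. cnj (w (of_nat n * p $ 3) $ j))"
    | "f = (\<lambda>p. of_real (gg (of_nat n * p $ 3)))" | "f = (\<lambda>p. of_real (sin (of_nat n * p $ 3)))"
    | "f = (\<lambda>p. of_real (cos (of_nat n * p $ 3)))"
    using assms unfolding gens_def by blast
  then show ?thesis
  proof cases
    case 1
    show ?thesis unfolding 1
      by (rule generator_compose_linear[OF l1, of of_real "\<lambda>t. 1"])
         (auto intro!: generated_algebra.const derivative_eq_intros)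
  next
    case (2 j)
    have "((\<lambda>t. cis (of_int (b j) * t)) has_vector_derivative of_int (b j) *\<^sub>R (\<i> * cis (of_int (b j) * t))) (at t)" for t
      by (rule has_vector_derivative_cis[OF DERIV_cmult_Id])
    moreover have "(\<lambda>p. of_int (b j) *\<^sub>R (\<i> * cis (of_int (b j) * phase p))) \<in> generated_algebra gens"
      unfolding scaleR_conv_of_real by (intro generated_algebra.mult generated_algebra.const gens_members)
    ultimately show ?thesis unfolding 2 by (rule generator_compose_linear[OF phase_bounded_linear])
  next
    case (3 j)
    show ?thesis unfolding 3 by (rule generator_compose_linear[OF l3 w_deriv Yalg])
  next
    case (4 j)
    show ?thesis unfolding 4
      by (rule generator_compose_linear[OF l3 has_vector_derivative_cnj[OF w_deriv] Yalg'])
  next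
    case 5
    have "((\<lambda>t. complex_of_real (gg t)) has_vector_derivative of_real (- 2 * gg t ^ 3 * (K * hh e * sin t))) (at t)" for t
      by (rule has_vector_derivative_of_real[OF gg_deriv])
    moreover have "(\<lambda>p. complex_of_real (- 2 * gg (of_nat n * p $ 3) ^ 3 * (K * hh e * sin (of_nat n * p $ 3)))) \<in> generated_algebra gens"
      unfolding of_real_mult power3_eq_cube by (intro generated_algebra.mult generated_algebra.const gens_members)
    ultimately show ?thesis unfolding 5 by (rule generator_compose_linear[OF l3])
  next
    case 6
    show ?thesis unfolding 6
      by (rule generator_compose_linear[OF l3 has_vector_derivative_of_real[OF DERIV_sin] gens_members(7)])
  next
    case 7
    have "(\<lambda>p. complex_of_real (-1 * sin (of_nat n * p $ 3))) \<in> generated_algebra gens"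
      unfolding of_real_mult by (intro generated_algebra.mult generated_algebra.const gens_members)
    then have "(\<lambda>p. complex_of_real (- sin (of_nat n * p $ 3))) \<in> generated_algebra gens" by simp
    then show ?thesis unfolding 7
      by (rule generator_compose_linear[OF l3 has_vector_derivative_of_real[OF DERIV_cos]])
  qed
qed

lemma param_smooth: "smooth_on V param"
proof (rule smooth_on_generated_algebra[OF gens_derivative])
  fix i :: 3
  have "(\<lambda>p. of_real (p $ 1) * (cis (of_int (b i) * phase p) * w (of_nat n * p $ 3) $ i)) \<in> generated_algebra gens"
    by (intro generated_algebra.mult gens_members)
  then show "(\<lambda>p. param p $ i) \<in> generated_algebra gens"
    by (simp add: param_def W_def phase_def scaleR_conv_of_real[where 'a=complex])
qed

lemma param_derivative_inj:
  assumes "p $ 1 > 0"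
  shows "\<exists>D. (param has_derivative D) (at p) \<and> inj D \<and> range D = span {W (p $ 2) (p $ 3), X (W (p $ 2) (p $ 3)), Y (W (p $ 2) (p $ 3))}"
proof (intro exI conjI)
  show "(param has_derivative (\<lambda>v. (v $ 1) *\<^sub>R W (p $ 2) (p $ 3) + (v $ 2) *\<^sub>R ((p $ 1) *\<^sub>R X (W (p $ 2) (p $ 3)))
     + (v $ 3) *\<^sub>R ((- (p $ 1) * sg / (2 * pi)) *\<^sub>R X (W (p $ 2) (p $ 3))
         + (p $ 1 * n * gg (n * p $ 3)) *\<^sub>R Y (W (p $ 2) (p $ 3))))) (at p)"
    by (rule param_derivative)
  have nz: "p $ 1 \<noteq> 0" "p $ 1 * n * gg (n * p $ 3) \<noteq> 0"
    using assms n_pos gg_pos[of "n * p $ 3"] by auto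
  have W0: "W (p $ 2) (p $ 3) \<noteq> 0" using W_nz[of "p $ 2" "p $ 3" 1] by auto
  show "inj (\<lambda>v::real^3. (v $ 1) *\<^sub>R W (p $ 2) (p $ 3) + (v $ 2) *\<^sub>R ((p $ 1) *\<^sub>R X (W (p $ 2) (p $ 3)))
     + (v $ 3) *\<^sub>R ((- (p $ 1) * sg / (2 * pi)) *\<^sub>R X (W (p $ 2) (p $ 3))
         + (p $ 1 * n * gg (n * p $ 3)) *\<^sub>R Y (W (p $ 2) (p $ 3))))"
    by (intro inj_three nz W0 X_nz Y_nz W_nz self_inner_X self_inner_Y X_inner_Y)
  show "range (\<lambda>v::real^3. (v $ 1) *\<^sub>R W (p $ 2) (p $ 3) + (v $ 2) *\<^sub>R ((p $ 1) *\<^sub>R X (W (p $ 2) (p $ 3)))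
     + (v $ 3) *\<^sub>R ((- (p $ 1) * sg / (2 * pi)) *\<^sub>R X (W (p $ 2) (p $ 3))
         + (p $ 1 * n * gg (n * p $ 3)) *\<^sub>R Y (W (p $ 2) (p $ 3)))) = span {W (p $ 2) (p $ 3), X (W (p $ 2) (p $ 3)), Y (W (p $ 2) (p $ 3))}"
    by (rule range_three[OF nz])
qed

text \<open>Polar coordinates with angles within \<open>pi\<close> of those of \<open>z0\<close>
  identify \<open>V\<close> with an open part \<open>Ob\<close> of the model cone, cut along two
  rays. The homeomorphism \<open>FT\<close> carries \<open>Ob\<close> to a relatively open part of
  \<open>N\<close> and supplies the continuous inverse.\<close>

lemma chart_exists:
  assumes z0: "z0 \<in> N" "z0 \<noteq> 0"
  obtains U V p0 where "chart3 N z0 U V param" "inv_into V param z0 = p0" "p0 $ 1 > 0"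
proof -
  obtain r0 s0 t0 where r0: "0 \<le> r0" and z0W: "z0 = r0 *\<^sub>R W s0 t0" using z0(1) unfolding N_W by blast
  have r0p: "r0 > 0" using r0 z0(2) z0W by (cases "r0 = 0") auto
  define V :: "(real^3) set" where "V = {p. p $ 1 > 0 \<and> \<bar>p $ 2 - s0\<bar> < pi \<and> \<bar>p $ 3 - t0\<bar> < pi}"
  define Ob where "Ob = {q \<in> cone_T2. fst q * cis (- s0) \<notin> \<real>\<^sub>\<le>\<^sub>0 \<and> snd q * cis (- t0) \<notin> \<real>\<^sub>\<le>\<^sub>0}"
  define P where "P = (\<lambda>p::real^3. (of_real (p $ 1) * cis (p $ 2), of_real (p $ 1) * cis (p $ 3)) :: complex \<times> complex)"
  define Q :: "complex \<times> complex \<Rightarrow> real^3" where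
    "Q = (\<lambda>q. vector [norm (fst q), s0 + Arg (fst q * cis (- s0)), t0 + Arg (snd q * cis (- t0))])"
  define p0 :: "real^3" where "p0 = vector [r0, s0, t0]"
  have Q_nth: "Q q $ 1 = norm (fst q)" "Q q $ 2 = s0 + Arg (fst q * cis (- s0))" "Q q $ 3 = t0 + Arg (snd q * cis (- t0))" for q
    by (simp_all add: Q_def)
  have Arg_lt: "\<bar>Arg z\<bar> < pi" if "z \<notin> \<real>\<^sub>\<le>\<^sub>0" for z
    using Arg_le_pi[of z] mpi_less_Arg[of z] Arg_eq_pi_iff[of z] that
    by (smt (verit) Arg_eq_pi complex_nonpos_Reals_iff complex_is_Real_iff)
  have openV: "open V"
  proof -
    have "V = {p. 0 < p $ 1} \<inter> {p. \<bar>p $ 2 - s0\<bar> < pi} \<inter> {p. \<bar>p $ 3 - t0\<bar> < pi}" unfolding V_def by auto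
    also have "open \<dots>" by (intro open_Int open_Collect_less continuous_intros)
    finally show ?thesis .
  qed
  have param_FT: "param p = FT (P p)" if "p $ 1 \<ge> 0" for p
    using FT_polar[OF that] by (simp add: param_def P_def)
  have rot: "of_real r * cis s * cis (- s') = rcis r (s - s')" for r s s'
    by (simp add: rcis_def cis_mult mult.assoc)
  have notneg: "of_real r * cis s * cis (- s') \<notin> \<real>\<^sub>\<le>\<^sub>0" if "r > 0" "\<bar>s - s'\<bar> < pi" for r s s'
  proof
    define y where "y = of_real r * cis s * cis (- s')"
    assume "of_real r * cis s * cis (- s') \<in> \<real>\<^sub>\<le>\<^sub>0"
    then have y: "Re y \<le> 0" "Im y = 0" by (simp_all add: y_def complex_nonpos_Reals_iff)
    have "y \<noteq> 0" unfolding y_def using that by simp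
    then have "Re y < 0" using y by (metis complex_eq_iff order_less_le zero_complex.simps)
    then have "Arg y = pi" using y by (simp add: Arg_eq_pi)
    moreover have "Arg y = s - s'" unfolding y_def rot using that by (intro Arg_rcis) auto
    ultimately show False using that by simp
  qed
  have PV: "P p \<in> Ob" if "p \<in> V" for p
    unfolding Ob_def P_def using that notneg polar_in_cone_T2 by (auto simp: V_def)
  have QP: "Q (P p) = p" if "p \<in> V" for p
  proof -
    have "Arg (of_real (p $ 1) * cis (p $ 2) * cis (- s0)) = p $ 2 - s0"
      "Arg (of_real (p $ 1) * cis (p $ 3) * cis (- t0)) = p $ 3 - t0"
      unfolding rot using that by (intro Arg_rcis; auto simp: V_def)+
    then show ?thesis using that by (simp add: vec_eq_iff forall_3 Q_nth P_def norm_mult V_def)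
  qed
  have Qrange: "Q q \<in> V" and PQ: "P (Q q) = q" if "q \<in> Ob" for q
  proof -
    have nz: "fst q \<noteq> 0" "snd q \<noteq> 0" using that by (auto simp: Ob_def)
    show "Q q \<in> V" unfolding V_def mem_Collect_eq Q_nth using that nz Arg_lt by (simp add: Ob_def)
    have "norm (fst q) = norm (snd q)" using that by (auto simp: Ob_def cone_T2_def)
    then show "P (Q q) = q" unfolding P_def Q_nth using cis_Arg_rotate[OF nz(1)] cis_Arg_rotate[OF nz(2)]
      by (simp add: prod_eq_iff)
  qed
  have imgV: "param ` V = FT ` Ob"
  proof -
    have "P ` V = Ob" using PV Qrange PQ by (metis (no_types, lifting) image_eqI subsetI subset_antisym image_subsetI)
    moreover have "param ` V = (\<lambda>p. FT (P p)) ` V" by (rule image_cong) (auto simp: V_def param_FT)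
    ultimately show ?thesis by (metis image_image)
  qed
  have "openin (top_of_set cone_T2) Ob"
  proof -
    have "Ob = cone_T2 \<inter> ({q. fst q * cis (- s0) \<in> - \<real>\<^sub>\<le>\<^sub>0} \<inter> {q. snd q * cis (- t0) \<in> - \<real>\<^sub>\<le>\<^sub>0})"
      by (auto simp: Ob_def)
    moreover have "open ({q::complex\<times>complex. fst q * cis (- s0) \<in> - \<real>\<^sub>\<le>\<^sub>0} \<inter> {q. snd q * cis (- t0) \<in> - \<real>\<^sub>\<le>\<^sub>0})"
      by (intro open_Int open_vimage[of "- \<real>\<^sub>\<le>\<^sub>0", unfolded vimage_def] continuous_intros) auto
    ultimately show ?thesis by (metis openin_open)
  qed
  then have "openin (top_of_set N) (FT ` Ob)" by (rule homeomorphism_imp_open_map[OF FT_homeomorphism])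
  then obtain U where U: "open U" "FT ` Ob = N \<inter> U" by (auto simp: openin_open)
  have p0V: "p0 \<in> V" using r0p by (simp add: V_def p0_def)
  have param_p0: "param p0 = z0" by (simp add: param_def p0_def z0W)
  have FTinvFT: "FTinv (FT q) = q" if "q \<in> cone_T2" for q
    using FT_homeomorphism that by (simp add: homeomorphism_def)
  have injV: "inj_on param V"
  proof (rule inj_onI)
    fix p q assume pq: "p \<in> V" "q \<in> V" "param p = param q"
    then have "FT (P p) = FT (P q)" using param_FT by (simp add: V_def)
    then have "P p = P q" using PV[OF pq(1)] PV[OF pq(2)] FT_inj unfolding Ob_def by (auto dest: inj_onD)
    then show "p = q" using QP pq by metis
  qed
  have inv_eq: "inv_into V param z = Q (FTinv z)" if "z \<in> N \<inter> U" for z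
  proof -
    have "z \<in> FT ` Ob" using that unfolding U(2) .
    then obtain q where q: "q \<in> Ob" "z = FT q" by (rule imageE)
    have "Q q $ 1 \<ge> 0" unfolding Q_nth by simp
    then have "param (Q q) = z" unfolding q(2) using param_FT[of "Q q"] PQ[OF q(1)] by (simp only:)
    moreover have "inv_into V param (param (Q q)) = Q q" by (rule inv_into_f_f[OF injV Qrange[OF q(1)]])
    moreover have "FTinv z = q" unfolding q(2) using q(1) by (intro FTinvFT) (simp add: Ob_def)
    ultimately show ?thesis by (simp only:)
  qed
  have Qcont: "continuous_on Ob Q"
  proof -
    have a: "continuous_on Ob (\<lambda>q. Arg (fst q * cis (- s0)))"
      by (rule continuous_on_compose2[OF continuous_on_Arg]) (auto intro!: continuous_intros simp: Ob_def)
    have b: "continuous_on Ob (\<lambda>q. Arg (snd q * cis (- t0)))"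
      by (rule continuous_on_compose2[OF continuous_on_Arg]) (auto intro!: continuous_intros simp: Ob_def)
    have "continuous_on Ob (\<lambda>q. Q q $ i)" for i
      using exhaust_3[of i] a b by (auto simp: Q_nth intro!: continuous_on_add continuous_on_const continuous_on_norm continuous_on_fst continuous_on_id)
    then have "continuous_on Ob (\<lambda>q. \<chi> i. Q q $ i)" by (rule continuous_on_vec_lambda)
    then show ?thesis by simp
  qed
  have "continuous_on (N \<inter> U) (\<lambda>z. Q (FTinv z))"
  proof (rule continuous_on_compose2[OF Qcont])
    show "continuous_on (N \<inter> U) FTinv"
      using FT_homeomorphism continuous_on_subset by (metis homeomorphism_def inf_le1)
    show "FTinv ` (N \<inter> U) \<subseteq> Ob" unfolding U(2)[symmetric] using FTinvFT by (auto simp: Ob_def)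
  qed
  then have cinv: "continuous_on (N \<inter> U) (inv_into V param)"
    by (rule continuous_on_eq) (simp add: inv_eq)
  have "chart3 N z0 U V param"
    unfolding chart3_def
    using U(1) openV param_smooth imgV U(2) injV cinv
  proof (intro conjI ballI)
    show "z0 \<in> U" using imgV U(2) p0V param_p0 by blast
    show "\<exists>\<phi>'. (param has_derivative \<phi>') (at x) \<and> inj \<phi>'" if "x \<in> V" for x
      using param_derivative_inj[of x] that unfolding V_def by blast
  qed auto
  moreover have "inv_into V param z0 = p0" using inv_into_f_f[OF injV p0V] unfolding param_p0 .
  moreover have "p0 $ 1 > 0" using r0p by (simp add: p0_def)
  ultimately show thesis by (rule that)
qed

lemma SL_point_N:
  assumes "z0 \<in> N" "z0 \<noteq> 0"
  shows "SL_point N z0"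
proof -
  obtain U V p where ch: "chart3 N z0 U V param" "inv_into V param z0 = p" "p $ 1 > 0"
    using chart_exists[OF assms] by metis
  define z where "z = W (p $ 2) (p $ 3)"
  obtain D where D: "(param has_derivative D) (at p)" "range D = span {z, X z, Y z}"
    using param_derivative_inj[OF ch(3)] unfolding z_def by blast
  have zz: "z \<bullet> z = 3" using norm_W[of "p $ 2" "p $ 3"] unfolding z_def dot_square_norm by simp
  have Xp: "X z \<bullet> X z > 0" using X_nz[of z] W_nz unfolding z_def by simp
  have YX: "Y z \<bullet> Y z = 3 * (X z \<bullet> X z)" using Y_norm[of z] moment_W zz unfolding z_def by simp
  \<comment> \<open>\<open>z\<close> has squared norm 3 and \<open>Y z\<close> has squared norm 3
    times that of \<open>X z\<close>, so these factors normalize the frame; the same scaling turns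
    \<open>Omega\<close> into 1.\<close>
  define a d where "a = 1 / sqrt 3" and "d = 1 / sqrt (X z \<bullet> X z)"
  define e1 e2 e3 where "e1 = a *\<^sub>R z" and "e2 = d *\<^sub>R X z" and "e3 = (a * d) *\<^sub>R Y z"
  have a2: "a * a = 1 / 3" unfolding a_def by simp
  have d2: "d * d = 1 / (X z \<bullet> X z)" unfolding d_def using Xp by simp
  have "span {e1, e2, e3} = span {z, X z, Y z}"
  proof -
    have pos: "a \<noteq> 0" "d \<noteq> 0" unfolding a_def d_def using Xp by auto
    have "{e1, e2, e3} \<subseteq> span {z, X z, Y z}"
      unfolding e1_def e2_def e3_def by (auto intro: span_scale span_base)
    moreover have "{z, X z, Y z} \<subseteq> span {e1, e2, e3}"
    proof -
      have "z = (1 / a) *\<^sub>R e1" "X z = (1 / d) *\<^sub>R e2" "Y z = (1 / (a * d)) *\<^sub>R e3"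
        using pos unfolding e1_def e2_def e3_def by simp_all
      then show ?thesis by (metis empty_subsetI insert_subset insertI1 insertI2 span_base span_scale)
    qed
    ultimately show ?thesis by (metis span_minimal subset_antisym subspace_span)
  qed
  moreover have "e1 \<bullet> e1 = 1" unfolding e1_def using zz a2 by (simp flip: mult.assoc)
  moreover have "e2 \<bullet> e2 = 1" unfolding e2_def using d2 Xp by (simp flip: mult.assoc)
  moreover have "e3 \<bullet> e3 = 1"
  proof -
    have "e3 \<bullet> e3 = (a * a) * (d * d) * (Y z \<bullet> Y z)" unfolding e3_def by (simp add: mult_ac)
    then show ?thesis unfolding YX a2 d2 using Xp by simp
  qed
  moreover have "e1 \<bullet> e2 = 0" "e1 \<bullet> e3 = 0" "e2 \<bullet> e3 = 0"
    unfolding e1_def e2_def e3_def by (simp_all add: self_inner_X self_inner_Y X_inner_Y)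
  moreover have "Re (Omega e1 e2 e3) = 1"
  proof -
    have "Omega e1 e2 e3 = of_real ((a * d * (a * d)) * (Y z \<bullet> Y z))"
      unfolding e1_def e2_def e3_def Omega_scaleR Omega_X_Y by simp
    moreover have "a * d * (a * d) = (a * a) * (d * d)" by simp
    ultimately show ?thesis unfolding YX a2 d2 using Xp by simp
  qed
  ultimately show ?thesis unfolding SL_point_def using ch(1,2) D by metis
qed

lemma SL_cone_N: "SL_cone N"
  unfolding SL_cone_def using is_cone_N SL_point_N by blast

lemma smooth_point_N: "z0 \<in> N \<Longrightarrow> z0 \<noteq> 0 \<Longrightarrow> smooth_point3 N z0"
  unfolding smooth_point3_def using chart_exists by metis

section \<open>The singularity at the vertex\<close>

lemma act_has_derivative: "((\<lambda>s. act s z) has_vector_derivative X (act s z)) (at s)"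
  unfolding has_vector_derivative_def
proof (rule has_derivative_vec_componentwise)
  fix j :: 3
  have "((\<lambda>s. cis (of_int (b j) * s)) has_vector_derivative of_int (b j) *\<^sub>R (\<i> * cis (of_int (b j) * s))) (at s)"
    by (rule has_vector_derivative_cis[OF DERIV_cmult_Id])
  then have "((\<lambda>s. cis (of_int (b j) * s) * z $ j) has_vector_derivative
      (of_int (b j) *\<^sub>R (\<i> * cis (of_int (b j) * s))) * z $ j) (at s)"
    by (rule has_vector_derivative_mult_left)
  then show "((\<lambda>x. act x z $ j) has_derivative (\<lambda>v. (v *\<^sub>R X (act s z)) $ j)) (at s)"
    unfolding has_vector_derivative_def vector_scaleR_component act_nth X_nth
    by (simp add: scaleR_conv_of_real mult_ac)
qed

lemma w_has_derivative: "(w has_vector_derivative gg t *\<^sub>R Y (w t)) (at t)"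
  unfolding has_vector_derivative_def
proof (rule has_derivative_vec_componentwise)
  fix j :: 3
  show "((\<lambda>x. w x $ j) has_derivative (\<lambda>v. (v *\<^sub>R gg t *\<^sub>R Y (w t)) $ j)) (at t)"
    using w_deriv[of j t] unfolding has_vector_derivative_def vector_scaleR_component
    by (simp only: scaleR_conv_of_real[of "gg t"])
qed

lemma w_in_N: "w t \<in> N"
  unfolding N_def by (intro CollectI exI[of _ 1] exI[of _ 0] exI[of _ t]) simp

lemma act_in_N: "z \<in> N \<Longrightarrow> act s z \<in> N"
proof -
  assume "z \<in> N"
  then obtain r s' t where "0 \<le> r" "z = r *\<^sub>R act s' (w t)" unfolding N_def by blast
  then show ?thesis unfolding N_def
    by (intro CollectI exI[of _ r] exI[of _ "s + s'"] exI[of _ t]) (simp add: act_scaleR act_add)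
qed

text \<open>If the vertex were smooth, the cone would lie in a real \<open>3\<close>-space; but \<open>z\<close>, \<open>X z\<close>, \<open>Y z\<close>
  and \<open>X (X z)\<close> are independent for \<open>z = w 0\<close>.\<close>
lemma zero_not_smooth: "\<not> smooth_point3 N 0"
proof
  assume "smooth_point3 N 0"
  then obtain D :: "real^3 \<Rightarrow> C3" where D: "linear D" "N \<subseteq> range D"
    unfolding smooth_point3_def using cone_subset_tangent[OF is_cone_N] by blast
  define V where "V = range D"
  have V: "subspace V" unfolding V_def using D(1) by (intro linear_subspace_image) auto
  define z where "z = w 0"
  have NV: "x \<in> V" if "x \<in> N" for x using that D(2) V_def by blast
  have z: "z \<in> V" using NV w_in_N z_def by simp
  have "X (act s z) \<in> V" for s
    using derivative_in_subspace[OF V _ act_has_derivative[of z s]] NV act_in_N w_in_N z_def by blast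
  then have actX: "act s (X z) \<in> V" for s by (simp add: X_act)
  have Xz: "X z \<in> V" using actX[of 0] by simp
  have XXz: "X (X z) \<in> V"
    using derivative_in_subspace[OF V actX act_has_derivative[of "X z" 0]] by simp
  have "gg 0 *\<^sub>R Y z \<in> V"
    using derivative_in_subspace[OF V _ w_has_derivative[of 0]] NV w_in_N z_def by blast
  then have Yz: "Y z \<in> V" using subspace_scale[OF V, of "gg 0 *\<^sub>R Y z" "1 / gg 0"] gg_pos[of 0] by simp
  have znz: "z $ j \<noteq> 0" for j unfolding z_def by (rule ww_nz[OF e_nonneg e_le])
  have z0: "z \<noteq> 0" using znz[of 1] by auto
  \<comment> \<open>Subtracting the projection to \<open>z\<close> suffices: \<open>X (X z)\<close>
    is already orthogonal to \<open>X z\<close>, and to \<open>Y z\<close> because the coordinate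
    product of \<open>w 0\<close> is real. If the difference vanished, all
    \<open>(b j)\<^sup>2\<close> would be equal, impossible for three distinct integers.\<close>
  define k where "k = (X (X z) \<bullet> z) / (z \<bullet> z)"
  define u where "u = X (X z) - k *\<^sub>R z"
  have u: "u \<in> V" unfolding u_def using XXz z V by (intro subspace_diff subspace_scale)
  have u0: "u \<noteq> 0"
  proof
    assume "u = 0"
    then have "X (X z) $ j = (k *\<^sub>R z) $ j" for j unfolding u_def by simp
    then have "- (of_int (b j))\<^sup>2 * z $ j = of_real k * z $ j" for j
      by (simp add: scaleR_conv_of_real[where 'a=complex] power2_eq_square mult_ac)
    then have "- (of_int (b j))\<^sup>2 = complex_of_real k" for j using znz[of j] by (metis mult_right_cancel)
    then have "(b 1)\<^sup>2 = (b 2)\<^sup>2" "(b 1)\<^sup>2 = (b 3)\<^sup>2"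
      by (metis neg_equal_iff_equal of_int_eq_iff of_int_power)+
    then show False using b_distinct b_sum by (auto simp: power2_eq_iff)
  qed
  have Im0: "Im (z $ 1 * z $ 2 * z $ 3) = 0"
    unfolding z_def ww_prod[OF e_nonneg e_le] by (simp add: FF_def)
  have orth: "z \<bullet> X z = 0" "z \<bullet> Y z = 0" "X z \<bullet> Y z = 0" "u \<bullet> z = 0" "u \<bullet> X z = 0" "u \<bullet> Y z = 0"
    using z0 unfolding u_def k_def
    by (simp_all add: self_inner_X self_inner_Y X_inner_Y XX_inner_X XX_inner_Y[OF Im0] inner_diff_left)
  have nz: "X z \<noteq> 0" "Y z \<noteq> 0" using X_nz Y_nz znz by blast+
  have "pairwise orthogonal {z, X z, Y z, u}"
    using orth by (auto simp: pairwise_def orthogonal_def inner_commute)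
  then have "independent {z, X z, Y z, u}"
    using z0 nz u0 by (intro pairwise_orthogonal_independent) auto
  moreover have "{z, X z, Y z, u} \<subseteq> V" using z Xz Yz u by simp
  moreover have "card {z, X z, Y z, u} = 4"
  proof -
    have "z \<noteq> X z" "z \<noteq> Y z" "X z \<noteq> Y z" "u \<noteq> z" "u \<noteq> X z" "u \<noteq> Y z"
      using orth z0 nz u0 by (metis inner_eq_zero_iff)+
    then show ?thesis by auto
  qed
  ultimately have "4 \<le> dim V" using independent_card_le_dim by metis
  moreover have "dim V \<le> dim (UNIV :: (real^3) set)" unfolding V_def by (rule dim_image_le[OF D(1)])
  ultimately show False by simp
qed

section \<open>Symmetries\<close>

text \<open>As \<open>b j = 0\<close>, the coordinates \<open>i\<close> and \<open>m\<close> have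
  equal moduli, so dividing by the moduli leaves \<open>P cis g = - R\<close> for the phase
  difference \<open>g\<close>. The sign of \<open>ci j\<close> is opposite to that of
  \<open>ci i = ci m\<close>, so all terms in the derivative of \<open>g\<close> have the same sign
  and \<open>g\<close> is not stationary at 0; this forces \<open>P = 0\<close>.\<close>

lemma phase_relation_trivial:
  assumes ijm: "i \<noteq> j" "m \<noteq> i" "m \<noteq> j" "b j = 0"
    and eq: "\<And>t. cnj (w t $ i) * P * w t $ j + cnj (w t $ j) * R * w t $ m = 0"
  shows "P = 0" "R = 0"
proof -
  have cm: "ci m = ci i" and cj: "ci j = - 2 * ci i" using ci_middle[OF ijm] by auto
  define g where "g = (\<lambda>t. 2 * theta e j t - theta e i t - theta e m t)"
  have g': "(g has_real_derivative 2 * rate e j t - rate e i t - rate e m t) (at t)" for t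
    unfolding g_def by (intro DERIV_diff DERIV_cmult theta_deriv[OF e_nonneg e_le])
  have const: "P * cis (g t) = - R" for t
  proof -
    define x y where "x = sqrt (xx e i t)" and "y = sqrt (xx e j t)"
    have xy: "x \<noteq> 0" "y \<noteq> 0" unfolding x_def y_def
      using xx_pos[OF e_nonneg e_le, of i t] xx_pos[OF e_nonneg e_le, of j t] by auto
    have wm: "w t $ m = of_real x * cis (theta e m t)" unfolding x_def ww_def using cm by (simp add: xx_def)
    have "of_real (x * y) * (P * (cis (- theta e i t) * cis (theta e j t)) + R * (cis (- theta e j t) * cis (theta e m t))) = 0"
      using eq[of t] unfolding wm by (simp add: ww_def cis_cnj x_def y_def algebra_simps)
    then have "P * cis (theta e j t - theta e i t) + R * cis (theta e m t - theta e j t) = 0"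
      using xy by (simp add: cis_mult)
    then have "cis (theta e j t - theta e m t) * (P * cis (theta e j t - theta e i t) + R * cis (theta e m t - theta e j t)) = 0"
      by simp
    then have "P * (cis (theta e j t - theta e m t) * cis (theta e j t - theta e i t))
        + R * (cis (theta e j t - theta e m t) * cis (theta e m t - theta e j t)) = 0"
      by (simp add: algebra_simps)
    moreover have "cis (theta e j t - theta e m t) * cis (theta e j t - theta e i t) = cis (g t)"
      unfolding cis_mult g_def by (simp add: algebra_simps)
    moreover have "cis (theta e j t - theta e m t) * cis (theta e m t - theta e j t) = 1"
      unfolding cis_mult by simp
    ultimately show ?thesis by (simp add: eq_neg_iff_add_eq_0)
  qed
  have "((\<lambda>t. P * cis (g t)) has_vector_derivative
      P * ((2 * rate e j 0 - rate e i 0 - rate e m 0) *\<^sub>R (\<i> * cis (g 0)))) (at 0)"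
    by (intro has_vector_derivative_mult_right has_vector_derivative_cis g')
  then have "P * ((2 * rate e j 0 - rate e i 0 - rate e m 0) *\<^sub>R (\<i> * cis (g 0))) = 0"
    unfolding const using vector_derivative_unique_at has_vector_derivative_const by blast
  then have "P = 0 \<or> 2 * rate e j 0 - rate e i 0 - rate e m 0 = 0" by auto
  moreover have "2 * rate e j 0 - rate e i 0 - rate e m 0 \<noteq> 0"
  proof -
    define a x y z where "a = AA e / (2 * sqrt (LL e 0))" and "x = xx e i 0" and "y = xx e j 0" and "z = xx e m 0"
    have a: "a > 0" unfolding a_def using AA_pos[OF e_nonneg e_le] LL_pos[OF e_nonneg e_le] by simp
    have pos: "x > 0" "y > 0" "z > 0" unfolding x_def y_def z_def using xx_pos[OF e_nonneg e_le] by auto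
    have "rate e l 0 = a * ci l / xx e l 0" for l unfolding rate_def a_def by (simp add: mult_ac)
    then have "2 * rate e j 0 - rate e i 0 - rate e m 0 = - (a * ci i * (4 / y + 1 / x + 1 / z))"
      unfolding x_def y_def z_def by (simp add: cm cj algebra_simps)
    moreover have "4 / y + 1 / x + 1 / z > 0" using pos by (intro add_pos_pos) auto
    ultimately show ?thesis using a ci_nz[of i] by simp
  qed
  ultimately show P: "P = 0" by simp
  have "w 0 $ j \<noteq> 0" "w 0 $ m \<noteq> 0" using ww_nz[OF e_nonneg e_le] by auto
  then show "R = 0" using eq[of 0] unfolding P by simp
qed

text \<open>The Fourier coefficients along circle orbits separate the matrix entries, except that two
  off-diagonal entries share a frequency when some \<open>b j\<close> vanishes; then the phases along the curve
  separate them.\<close>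
lemma hermitian_form_vanishing:
  fixes H :: "3 \<Rightarrow> 3 \<Rightarrow> complex"
  assumes herm: "\<And>i j. H j i = cnj (H i j)"
    and zero: "\<And>z. z \<in> N \<Longrightarrow> (\<Sum>i\<in>UNIV. \<Sum>j\<in>UNIV. cnj (z $ i) * H i j * z $ j) = 0"
  shows "\<exists>x::real. \<forall>i j. H i j = (if i = j then of_real (x * b j) else 0)"
proof -
  define T where "T = (\<lambda>t p. cnj (w t $ fst p) * H (fst p) (snd p) * w t $ snd p)"
  define f where "f = (\<lambda>p::3\<times>3. b (snd p) - b (fst p))"
  have freq: "sum (T t) {p. f p = k} = 0" for t k
  proof (cases "k \<in> range f")
    case True
    have "(\<Sum>k\<in>range f. (sum (T t) {p. f p = k}) * cis (of_int k * s)) = 0" for s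
    proof -
      have "(\<Sum>k\<in>range f. (sum (T t) {p. f p = k}) * cis (of_int k * s))
          = (\<Sum>k\<in>range f. \<Sum>p | p \<in> UNIV \<and> f p = k. T t p * cis (of_int (f p) * s))"
        by (intro sum.cong refl) (auto simp: sum_distrib_right intro!: sum.cong)
      also have "\<dots> = (\<Sum>p\<in>UNIV. T t p * cis (of_int (f p) * s))"
        by (rule sum.image_gen[symmetric]) simp
      also have "\<dots> = (\<Sum>i\<in>UNIV. \<Sum>j\<in>UNIV. T t (i, j) * cis (of_int (f (i, j)) * s))"
        unfolding sum.cartesian_product by (simp add: case_prod_beta')
      also have "\<dots> = (\<Sum>i\<in>UNIV. \<Sum>j\<in>UNIV. cnj (act s (w t) $ i) * H i j * act s (w t) $ j)"
      proof (intro sum.cong refl)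
        fix i j
        have "cis (of_int (f (i, j)) * s) = cnj (cis (b i * s)) * cis (b j * s)"
          unfolding cis_cnj cis_mult f_def by (simp add: algebra_simps)
        then show "T t (i, j) * cis (of_int (f (i, j)) * s) = cnj (act s (w t) $ i) * H i j * act s (w t) $ j"
          unfolding T_def by (simp add: mult_ac)
      qed
      also have "\<dots> = 0" by (intro zero act_in_N w_in_N)
      finally show ?thesis .
    qed
    then have "\<forall>k\<in>range f. sum (T t) {p. f p = k} = 0"
      by (intro exponential_sum_zero) auto
    then show ?thesis using True by blast
  next
    case False
    then have "{p. f p = k} = {}" by blast
    then show ?thesis by (simp only: sum.empty)
  qed
  have off: "H i j = 0" if ij: "i \<noteq> j" for i j
  proof -
    obtain m where m: "m \<noteq> i" "m \<noteq> j" "\<And>x. x = i \<or> x = j \<or> x = m" "b m = - b i - b j"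
      "b i \<noteq> b j" "b m \<noteq> b i" "b m \<noteq> b j" using third_index[OF ij] by metis
    have fr: "sum (T t) (if b j = 0 then {(i, j), (j, m)} else if b i = 0 then {(i, j), (m, i)} else {(i, j)}) = 0" for t
      using freq[of t "b j - b i"] unfolding f_def frequency_pairs[OF ij m] .
    consider "b j = 0" | "b j \<noteq> 0" "b i = 0" | "b j \<noteq> 0" "b i \<noteq> 0" by blast
    then show ?thesis
    proof cases
      case 1
      have "cnj (w t $ i) * H i j * w t $ j + cnj (w t $ j) * H j m * w t $ m = 0" for t
        using fr[of t] 1 ij by (simp add: T_def)
      then show ?thesis using phase_relation_trivial(1)[OF ij m(1,2) 1] by blast
    next
      case 2
      have "cnj (w t $ m) * H m i * w t $ i + cnj (w t $ i) * H i j * w t $ j = 0" for t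
        using fr[of t] 2 m(1) by (simp add: T_def add.commute)
      then show ?thesis using phase_relation_trivial(2)[of m i j] 2 m(1,2) ij by blast
    next
      case 3
      then show ?thesis using fr[of 0] ww_nz[OF e_nonneg e_le] by (simp add: T_def)
    qed
  qed
  have diag_real: "H i i = of_real (Re (H i i))" for i
    using herm[of i i] by (simp add: complex_eq_iff)
  have diag0: "(\<Sum>i\<in>UNIV. Re (H i i) * xx e i t) = 0" for t
  proof -
    have "{p. f p = 0} = (\<lambda>i. (i, i)) ` UNIV"
    proof -
      have "b k = b l \<Longrightarrow> k = l" for k l
        using b_distinct exhaust_3[of k] exhaust_3[of l] by auto
      then show ?thesis unfolding f_def by auto
    qed
    then have "(\<Sum>i\<in>UNIV. T t (i, i)) = 0"
      using freq[of t 0] by (simp add: sum.reindex inj_on_def o_def)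
    moreover have "T t (i, i) = of_real (Re (H i i) * xx e i t)" for i
    proof -
      have "T t (i, i) = H i i * (w t $ i * cnj (w t $ i))" by (simp add: T_def)
      then show ?thesis using diag_real[of i] cmod_ww[OF e_nonneg e_le, of t i]
        unfolding complex_norm_square[symmetric] by (metis of_real_mult)
    qed
    ultimately have "of_real (\<Sum>i\<in>UNIV. Re (H i i) * xx e i t) = (0::complex)" by simp
    then show ?thesis by (simp only: of_real_eq_0_iff)
  qed
  define u where "u = (\<lambda>i. Re (H i i))"
  define p q where "p = u 1 + u 2 + u 3" and "q = ci 1 * u 1 + ci 2 * u 2 + ci 3 * u 3"
  have lin: "p + q * vv e t = 0" for t
    using diag0[of t] unfolding sum_3 xx_def p_def q_def u_def by (simp add: algebra_simps)
  \<comment> \<open>\<open>v\<close> takes two different values at the turning points 0 and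
    \<open>pi\<close>, so an affine function of \<open>v\<close> that vanishes along the curve is
    zero.\<close>
  have "q * (vv e 0 - vv e pi) = 0" using lin[of 0] lin[of pi] by (simp only: right_diff_distrib)
  moreover have "vv e 0 - vv e pi \<noteq> 0" using hh_pos[OF e_nonneg e_le e_pos] by (simp add: vv_def)
  ultimately have q: "q = 0" by simp
  then have "p = 0" using lin[of 0] by simp
  with q obtain x :: real where x: "\<And>j. u j = x * real_of_int (b j)"
    using perpendicular_multiple[of u] unfolding p_def q_def by blast
  have "H i j = (if i = j then of_real (x * b j) else 0)" for i j
  proof (cases "i = j")
    case True
    have "H j j = of_real (u j)" unfolding u_def by (rule diag_real)
    then show ?thesis using True x[of j] by simp
  qed (simp add: off)
  then show ?thesis by blast
qed

lemma N_component_zero: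
  assumes "z \<in> N" "z $ j = 0"
  shows "z = 0"
proof -
  obtain r s t where z: "z = r *\<^sub>R act s (w t)" using assms(1) unfolding N_def by blast
  then have "r = 0" using assms(2) ww_nz[OF e_nonneg e_le, of t j] by simp
  then show ?thesis using z by simp
qed

lemma moment_N:
  assumes "z \<in> N"
  shows "(\<Sum>j\<in>UNIV. of_int (b j) * (cmod (z $ j))\<^sup>2) = 0"
proof -
  obtain r s t where z: "z = r *\<^sub>R act s (w t)" using assms unfolding N_def by blast
  have "(\<Sum>j\<in>UNIV. of_int (b j) * (cmod (z $ j))\<^sup>2) = r\<^sup>2 * (\<Sum>j\<in>UNIV. of_int (b j) * (cmod (w t $ j))\<^sup>2)"
    unfolding z by (simp add: norm_mult power_mult_distrib sum_distrib_left mult_ac)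
  then show ?thesis using moment_ww[OF e_nonneg e_le] by simp
qed

text \<open>A translation in the symmetry group would make \<open>N\<close> invariant under \<open>c\<close>; then \<open>N\<close> contains
  \<open>act \<pi> c + c\<close>, whose \<open>j\<close>-th component vanishes exactly when \<open>b j\<close> is odd.\<close>
lemma Sym_translation_zero:
  assumes "(A, c) \<in> Sym N"
  shows "c = 0"
proof (rule ccontr)
  assume c0: "c \<noteq> 0"
  have im: "(\<lambda>z. A *v z + c) ` N = N" using assms by (simp add: Sym_def)
  have N0: "0 \<in> N" and sc: "\<And>t z. t > 0 \<Longrightarrow> z \<in> N \<Longrightarrow> t *\<^sub>R z \<in> N"
    using is_cone_N unfolding is_cone_def by blast+
  have lin: "A *v (r *\<^sub>R z) = r *\<^sub>R (A *v z)" for r z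
    by (simp add: vec_eq_iff matrix_vector_mult_def scaleR_sum_right)
  have Ac: "A *v u + c \<in> N" if "u \<in> N" for u
    using imageI[OF that, of "\<lambda>z. A *v z + c"] unfolding im .
  have cN: "c \<in> N" using Ac[OF N0] by simp
  have plus: "z + c \<in> N" if "z \<in> N" for z
  proof -
    have "z \<in> (\<lambda>z. A *v z + c) ` N" unfolding im by (rule that)
    then obtain v where v: "v \<in> N" "z = A *v v + c" by (rule imageE)
    \<comment> \<open>Half of \<open>v\<close> is sent to \<open>A v / 2 + c\<close>; doubling this
      inside the cone gives \<open>A v + 2 c\<close>, which is \<open>z + c\<close>.\<close>
    have "A *v ((1/2) *\<^sub>R v) + c \<in> N" by (intro Ac sc v(1)) simp
    then have "2 *\<^sub>R (A *v ((1/2) *\<^sub>R v) + c) \<in> N" by (intro sc) auto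
    then have "A *v v + 2 *\<^sub>R c \<in> N" by (simp add: lin scaleR_add_right)
    then show ?thesis unfolding v(2) by (simp add: scaleR_2 add.assoc)
  qed
  have zN: "act pi c + c \<in> N" by (rule plus[OF act_in_N[OF cN]])
  have cis_pi: "cis (of_int k * pi) = (if even k then 1 else -1)" for k :: int
    by (simp add: complex_eq_iff mult.commute[of _ pi])
  have comp: "(act pi c + c) $ j = (if even (b j) then 2 * c $ j else 0)" for j
    by (simp add: cis_pi)
  have cnz: "c $ j \<noteq> 0" for j using N_component_zero[OF cN] c0 by blast
  have "\<exists>j. odd (b j)"
  proof (rule ccontr)
    assume "\<nexists>j. odd (b j)"
    then have "2 dvd gcd (gcd (b 1) (b 2)) (b 3)" by simp
    then show False unfolding b_gcd by simp
  qed
  then obtain j where "odd (b j)" by blast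
  then have z0: "act pi c + c = 0" using N_component_zero[OF zN, of j] comp[of j] by simp
  \<comment> \<open>One vanishing component forces the point \<open>act pi c + c\<close> to be the
    vertex, so every weight is odd; but three odd integers cannot sum to 0.\<close>
  have "odd (b j)" for j using comp[of j] cnz[of j] unfolding z0 by (auto split: if_splits)
  then have "odd (b 1 + b 2 + b 3)" by simp
  then show False unfolding b_sum by simp
qed

text \<open>Pulling the moment form back by \<open>A\<close> gives a form vanishing on the cone,
  hence \<open>x\<close> times the moment form, and comparing weights forces \<open>x\<close> to be
  1 or -1. The value 1 makes \<open>A\<close> diagonal; the value -1 is the second alternative,
  which cannot occur near the identity.\<close>

lemma Sym_shape:
  assumes A: "unitary3 A" and im: "(\<lambda>z. A *v z) ` N = N"
  shows "(\<forall>k j. k \<noteq> j \<longrightarrow> A $ k $ j = 0) \<or> (\<forall>j. b j \<noteq> 0 \<longrightarrow> A $ j $ j = 0)"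
proof -
  define H where "H = (\<lambda>i j. \<Sum>k\<in>UNIV. cnj (A $ k $ i) * of_int (b k) * A $ k $ j)"
  have herm: "H j i = cnj (H i j)" for i j unfolding H_def by (simp add: mult_ac)
  have zero: "(\<Sum>i\<in>UNIV. \<Sum>j\<in>UNIV. cnj (z $ i) * H i j * z $ j) = 0" if "z \<in> N" for z
  proof -
    have "(\<Sum>i\<in>UNIV. \<Sum>j\<in>UNIV. cnj (z $ i) * H i j * z $ j)
        = (\<Sum>k\<in>UNIV. of_int (b k) * ((\<Sum>j\<in>UNIV. A $ k $ j * z $ j) * cnj (\<Sum>i\<in>UNIV. A $ k $ i * z $ i)))"
      unfolding H_def sum_3 by (simp add: algebra_simps)
    also have "\<dots> = (\<Sum>k\<in>UNIV. of_int (b k) * ((A *v z) $ k * cnj ((A *v z) $ k)))"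
      by (simp add: matrix_vector_mult_def)
    also have "\<dots> = of_real (\<Sum>k\<in>UNIV. of_int (b k) * (cmod ((A *v z) $ k))\<^sup>2)"
      unfolding complex_norm_square[symmetric] by simp
    also have "\<dots> = 0" using moment_N[of "A *v z"] im that by (metis (no_types, lifting) image_eqI of_real_0)
    finally show ?thesis .
  qed
  obtain x :: real where x: "\<And>i j. H i j = (if i = j then of_real (x * b j) else 0)"
    using hermitian_form_vanishing[OF herm zero] by blast
  have rel: "of_int (b k) * A $ k $ j = of_real (x * b j) * A $ k $ j" for k j
  proof -
    \<comment> \<open>\<open>H\<close> is the product of the adjoint of \<open>A\<close>,
      \<open>B = diag b\<close> and \<open>A\<close>; multiplying by the unitary \<open>A\<close> on
      the left turns \<open>H = x B\<close> into \<open>B A = A (x B)\<close>.\<close>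
    have "(\<Sum>i\<in>UNIV. A $ k $ i * H i j) = (\<Sum>l\<in>UNIV. (\<Sum>i\<in>UNIV. A $ k $ i * cnj (A $ l $ i)) * (of_int (b l) * A $ l $ j))"
      unfolding H_def sum_3 by (simp add: algebra_simps)
    also have "\<dots> = of_int (b k) * A $ k $ j"
      unfolding unitary3_rows[OF A] by (simp add: if_distrib[of "\<lambda>x. x * _"] cong: if_cong)
    finally have "(\<Sum>i\<in>UNIV. A $ k $ i * H i j) = of_int (b k) * A $ k $ j" .
    moreover have "(\<Sum>i\<in>UNIV. A $ k $ i * H i j) = (\<Sum>i\<in>UNIV. if i = j then of_real (x * b j) * A $ k $ j else 0)"
      by (intro sum.cong refl) (simp add: x)
    ultimately show ?thesis by auto
  qed
  have rel': "A $ k $ j = 0 \<or> real_of_int (b k) = x * b j" for k j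
  proof -
    have "(complex_of_real (of_int (b k)) - of_real (x * b j)) * A $ k $ j = 0"
      using rel[of k j] by (simp add: left_diff_distrib)
    then show ?thesis by (metis eq_iff_diff_eq_0 mult_eq_0_iff of_real_eq_iff)
  qed
  have row: "\<exists>j. A $ k $ j \<noteq> 0" for k
  proof (rule ccontr)
    assume "\<nexists>j. A $ k $ j \<noteq> 0"
    then show False using unitary3_rows[OF A, of k k] by simp
  qed
  have col: "\<exists>k. A $ k $ j \<noteq> 0" for j
  proof (rule ccontr)
    assume "\<nexists>k. A $ k $ j \<noteq> 0"
    then show False using unitary3_columns[OF A, of j j] by simp
  qed
  \<comment> \<open>In a relation \<open>b k = x * b j\<close>, taking the largest weight once as
    the column and once as the row of a nonzero entry gives \<open>\<bar>x\<bar> \<le> 1\<close> and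
    \<open>\<bar>x\<bar> \<ge> 1\<close>.\<close>
  define M where "M = Max (range (\<lambda>j. \<bar>real_of_int (b j)\<bar>))"
  have "M \<in> range (\<lambda>j. \<bar>real_of_int (b j)\<bar>)" unfolding M_def by (intro Max_in) auto
  then obtain j0 where j0: "M = \<bar>real_of_int (b j0)\<bar>" by blast
  have le: "\<bar>real_of_int (b j)\<bar> \<le> M" for j unfolding M_def by (intro Max_ge) auto
  have Mp: "M > 0"
  proof -
    have "b 1 \<noteq> 0 \<or> b 2 \<noteq> 0" using b_distinct by auto
    then show ?thesis using le[of 1] le[of 2] by auto
  qed
  have "\<bar>x\<bar> * M \<le> 1 * M"
  proof -
    obtain k where "A $ k $ j0 \<noteq> 0" using col by blast
    then have "real_of_int (b k) = x * b j0" using rel' by blast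
    then show ?thesis using le[of k] j0 by (simp add: abs_mult)
  qed
  moreover have "1 * M \<le> \<bar>x\<bar> * M"
  proof -
    obtain j where "A $ j0 $ j \<noteq> 0" using row by blast
    then have "real_of_int (b j0) = x * b j" using rel' by blast
    then have "M = \<bar>x\<bar> * \<bar>real_of_int (b j)\<bar>" using j0 by (simp add: abs_mult)
    also have "\<dots> \<le> \<bar>x\<bar> * M" using le[of j] by (intro mult_left_mono) auto
    finally show ?thesis by simp
  qed
  ultimately have "\<bar>x\<bar> = 1" using Mp by (simp add: mult_le_cancel_right)
  then consider "x = 1" | "x = -1" by linarith
  then show ?thesis
  proof cases
    case 1
    have "b k = b l \<Longrightarrow> k = l" for k l
      using b_distinct exhaust_3[of k] exhaust_3[of l] by auto
    then show ?thesis using rel' unfolding 1 by (metis mult_1 of_int_eq_iff)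
  next
    case 2
    have "A $ j $ j = 0" if "b j \<noteq> 0" for j
      using rel'[of j j] that unfolding 2 by simp
    then show ?thesis by blast
  qed
qed

text \<open>The \<open>k\<close>-th power of the monodromy of the curve, composed with a circle element.\<close>
definition twist :: "nat \<Rightarrow> real \<Rightarrow> M3 \<times> C3" where
  "twist k s = ((\<chi> i j. if i = j then cis (of_int (b i) * s + of_nat k * beta e i) else 0), 0)"

text \<open>\<open>A\<close> preserves the moduli of \<open>w 0\<close>, so its image has the form
  \<open>act s (w t)\<close> with \<open>cos t = 1\<close>, that is \<open>t = 2 pi k\<close>. The
  entries of \<open>A\<close> are then read off as a circle element times the \<open>k\<close>-th
  power of the monodromy, and \<open>closing_int\<close> reduces \<open>k\<close> modulo
  \<open>n\<close>.\<close>

lemma diagonal_Sym_twist: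
  assumes diag: "\<And>k j. k \<noteq> j \<Longrightarrow> A $ k $ j = 0" and im: "(\<lambda>z. A *v z) ` N = N"
    and unit: "unitary3 A"
  shows "\<exists>k<n. \<exists>s. (A, 0) = twist k s"
proof -
  have Az: "(A *v z) $ j = A $ j $ j * z $ j" for z j by (rule diagonal_mult_nth) (rule diag)
  have cA: "cmod (A $ j $ j) = 1" for j by (rule unitary3_diagonal_entry[OF unit]) (rule diag)
  have "A *v w 0 \<in> N" using im w_in_N by blast
  then obtain r s t where r: "r \<ge> 0" "A *v w 0 = r *\<^sub>R act s (w t)" unfolding N_def by blast
  have cm: "cmod (w 0 $ j) = r * cmod (w t $ j)" for j
  proof -
    have "cmod ((A *v w 0) $ j) = cmod ((r *\<^sub>R act s (w t)) $ j)" using r(2) by simp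
    then show ?thesis unfolding Az using r(1) by (simp add: norm_mult cA)
  qed
  have "(norm (w 0))\<^sup>2 = r\<^sup>2 * (norm (w t))\<^sup>2"
    unfolding norm_C3 cm by (simp add: power_mult_distrib algebra_simps)
  then have "r = 1" using r(1) unfolding norm_ww[OF e_nonneg e_le] by (simp add: power2_eq_1_iff)
  then have "xx e 1 0 = xx e 1 t" using cm[of 1] cmod_ww[OF e_nonneg e_le] by (metis mult_1)
  then have "cos t = 1" using xx_eq_imp_cos_eq[of 1 0 t] by simp
  moreover from this have "sin t = 0" using sin_cos_squared_add[of t] by simp
  ultimately obtain k :: int where k: "t = 0 + 2 * pi * of_int k"
    using sin_cos_eq_iff[of t 0] by auto
  define l q where "l = nat (k mod int n)" and "q = k div int n"
  have kq: "k = int n * q + int l" unfolding l_def q_def using n_pos by simp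
  have ln: "l < n" unfolding l_def using n_pos by (simp add: nat_less_iff)
  have "A $ j $ j = cis (of_int (b j) * (s + of_int q * sg) + of_nat l * beta e j)" for j
  proof -
    have "A $ j $ j * w 0 $ j = cis (of_int (b j) * s) * (cis (of_int k * beta e j) * w 0 $ j)"
      using arg_cong[OF r(2), of "\<lambda>z. z $ j"] unfolding Az \<open>r = 1\<close> k w_shift_int[symmetric] by simp
    then have "A $ j $ j = cis (of_int (b j) * s) * cis (of_int k * beta e j)"
      using ww_nz[OF e_nonneg e_le, of 0 j] by (simp flip: mult.assoc)
    also have "of_int k * beta e j = of_int (int n * q) * beta e j + of_nat l * beta e j"
      unfolding kq by (simp add: algebra_simps)
    also have "cis \<dots> = cis (of_int (b j) * (of_int q * sg)) * cis (of_nat l * beta e j)"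
      unfolding cis_mult[symmetric] closing_int ..
    finally show ?thesis by (simp add: cis_mult algebra_simps)
  qed
  then have "(A, 0) = twist l (s + of_int q * sg)"
    unfolding twist_def using diag by (simp add: vec_eq_iff)
  then show ?thesis using ln by blast
qed

lemma twist_continuous: "continuous_on S (twist k)"
proof -
  have "continuous_on S (\<lambda>s. if i = j then cis (of_int (b i) * s + of_nat k * beta e i) else 0)" for i j :: 3
    by (cases "i = j") (auto intro!: continuous_intros)
  then show ?thesis unfolding twist_def
    by (intro continuous_on_Pair continuous_on_const continuous_on_vec_lambda)
qed

lemma twist_periodic: "twist k (s + 2 * pi * of_int m) = twist k s"
proof -
  have "cis (of_int (b i) * (s + 2 * pi * of_int m) + of_nat k * beta e i) = cis (of_int (b i) * s + of_nat k * beta e i)" for i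
    unfolding cis_eq_iff by (intro exI[of _ "b i * m"]) (simp add: algebra_simps)
  then show ?thesis unfolding twist_def by (simp cong: if_cong)
qed

lemma compact_range_twist: "compact (range (twist k))"
proof -
  have "range (twist k) = twist k ` {0..2*pi}"
  proof
    show "range (twist k) \<subseteq> twist k ` {0..2*pi}"
    proof
      fix y assume "y \<in> range (twist k)"
      then obtain s where y: "y = twist k s" by blast
      define m where "m = \<lfloor>s / (2 * pi)\<rfloor>"
      have "of_int m \<le> s / (2 * pi)" "s / (2 * pi) < of_int m + 1" unfolding m_def by linarith+
      then have "0 \<le> s - 2 * pi * of_int m" "s - 2 * pi * of_int m \<le> 2 * pi"
        by (simp_all add: field_simps)
      moreover have "twist k (s - 2 * pi * of_int m) = y" unfolding y using twist_periodic[of k s "- m"] by simp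
      ultimately show "y \<in> twist k ` {0..2*pi}" by (metis atLeastAtMost_iff image_eqI)
    qed
  qed auto
  then show ?thesis using compact_continuous_image[OF twist_continuous compact_Icc] by metis
qed

lemma twist_disjoint:
  assumes "0 < k" "k < n"
  shows "range (twist 0) \<inter> range (twist k) = {}"
proof (rule ccontr)
  assume "range (twist 0) \<inter> range (twist k) \<noteq> {}"
  then obtain y where "y \<in> range (twist 0)" "y \<in> range (twist k)" by blast
  then obtain s s' where eq: "twist 0 s = twist k s'" by (metis imageE)
  have "cis (of_nat k * beta e j) = cis (of_int (b j) * (s - s'))" for j
  proof -
    have "cis (of_int (b j) * s) = cis (of_int (b j) * s' + of_nat k * beta e j)"
      using arg_cong[OF eq, of "\<lambda>p. fst p $ j $ j"] by (simp add: twist_def)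
    then have "cis (- (of_int (b j) * s')) * cis (of_int (b j) * s)
        = cis (- (of_int (b j) * s')) * cis (of_int (b j) * s' + of_nat k * beta e j)" by simp
    then show ?thesis unfolding cis_mult by (simp add: algebra_simps)
  qed
  then show False using minimal[OF assms] by metis
qed

lemma Ggroup_twist: "Ggroup (b 1) (b 2) (b 3) = range (twist 0)"
proof -
  have v: "(vector [b 1, b 2, b 3] :: int^3) $ i = b i" for i :: 3
    using exhaust_3[of i] by auto
  have "(Gmat (b 1) (b 2) (b 3) s, 0) = twist 0 s" for s
    unfolding twist_def Gmat_def v by (simp add: cis_conv_exp cong: if_cong)
  then show ?thesis unfolding Ggroup_def by auto
qed

lemma act_image_N: "(\<lambda>z. act s z) ` N = N"
proof
  show "(\<lambda>z. act s z) ` N \<subseteq> N" using act_in_N by blast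
  show "N \<subseteq> (\<lambda>z. act s z) ` N"
  proof
    fix z assume "z \<in> N"
    then show "z \<in> (\<lambda>z. act s z) ` N"
      using act_in_N[of z "- s"] by (intro image_eqI[of _ _ "act (- s) z"]) (auto simp: act_add)
  qed
qed

lemma Ggroup_subset_Sym: "Ggroup (b 1) (b 2) (b 3) \<subseteq> Sym N"
proof
  fix g assume g: "g \<in> Ggroup (b 1) (b 2) (b 3)"
  then obtain s where gs: "g = (Gmat (b 1) (b 2) (b 3) s, 0)" unfolding Ggroup_def by blast
  define G where "G = Gmat (b 1) (b 2) (b 3) s"
  have v: "(vector [b 1, b 2, b 3] :: int^3) $ i = b i" for i :: 3
    using exhaust_3[of i] by auto
  have G: "G $ i $ j = (if i = j then cis (of_int (b i) * s) else 0)" for i j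
    unfolding G_def Gmat_def v by (simp add: cis_conv_exp)
  have "unitary3 G"
    unfolding unitary3_def adjoint3_def matrix_matrix_mult_def mat_def
    by (simp add: vec_eq_iff forall_3 sum_3 G cis_cnj cis_mult)
  moreover have "det G = 1"
  proof -
    have "det G = cis (of_int (b 1) * s) * cis (of_int (b 2) * s) * cis (of_int (b 3) * s)"
      unfolding det_3 by (simp add: G)
    also have "\<dots> = cis (of_int (b 1 + b 2 + b 3) * s)" by (simp add: cis_mult distrib_right)
    also have "\<dots> = 1" unfolding b_sum by simp
    finally show ?thesis .
  qed
  moreover have "(\<lambda>z. G *v z + 0) ` N = N"
    unfolding G_def Gmat_mult using act_image_N by simp
  ultimately show "g \<in> Sym N" unfolding gs G_def Sym_def SU3_def by simp
qed

text \<open>The modulus of a diagonal entry with nonzero weight is continuous on the component and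
  takes only the values 0 and 1, so it stays 1 and every element is diagonal. This places the
  component in finitely many compact cosets, and the one through the identity is disjoint from the
  others.\<close>

lemma Sym0_N: "Sym0 N = Ggroup (b 1) (b 2) (b 3)"
proof
  let ?C = "connected_component_set (Sym N) (mat 1, 0)"
  have one: "(mat 1, 0) \<in> Ggroup (b 1) (b 2) (b 3)"
    unfolding Ggroup_twist by (rule range_eqI[of _ _ 0]) (simp add: twist_def mat_def cong: if_cong)
  show "Ggroup (b 1) (b 2) (b 3) \<subseteq> Sym0 N"
    unfolding Sym0_def
  proof (rule connected_component_maximal[OF one _ Ggroup_subset_Sym])
    show "connected (Ggroup (b 1) (b 2) (b 3))"
      unfolding Ggroup_twist by (rule connected_continuous_image[OF twist_continuous connected_UNIV])
  qed
  have oneC: "(mat 1, 0) \<in> ?C" using one Ggroup_subset_Sym by (auto intro: connected_component_refl)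
  have con: "connected ?C" by (rule connected_connected_component)
  have CS: "?C \<subseteq> Sym N" by (rule connected_component_subset)
  have shape: "unitary3 A" "c = 0" "(\<lambda>z. A *v z) ` N = N" if "(A, c) \<in> ?C" for A c
  proof -
    have S: "(A, c) \<in> Sym N" using that CS by blast
    then show "unitary3 A" "c = 0" using Sym_translation_zero by (auto simp: Sym_def SU3_def)
    then show "(\<lambda>z. A *v z) ` N = N" using S by (simp add: Sym_def)
  qed
  obtain j where j: "b j \<noteq> 0" using b_distinct by metis
  define f where "f = (\<lambda>g :: M3 \<times> C3. cmod (fst g $ j $ j))"
  have "continuous_on ?C f" unfolding f_def
    by (intro continuous_intros continuous_on_component)
  then have "connected (f ` ?C)" using con by (intro connected_continuous_image)
  then have ivl: "\<And>x y z. x \<in> f ` ?C \<Longrightarrow> y \<in> f ` ?C \<Longrightarrow> x \<le> z \<Longrightarrow> z \<le> y \<Longrightarrow> z \<in> f ` ?C"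
    unfolding connected_iff_interval by blast
  have unit_diag: "cmod (A $ j $ j) = 1" if "unitary3 A" "\<forall>k j. k \<noteq> j \<longrightarrow> A $ k $ j = 0" for A
    using unitary3_diagonal_entry[OF that(1)] that(2) by blast
  have f01: "f g = 0 \<or> f g = 1" if "g \<in> ?C" for g
    using Sym_shape[OF shape(1,3)] unit_diag[OF shape(1)] that j unfolding f_def
    by (cases g) (metis fst_conv norm_zero)
  have f1: "f g = 1" if "g \<in> ?C" for g
  proof (rule ccontr)
    assume "f g \<noteq> 1"
    then have "0 \<in> f ` ?C" using f01[OF that] that by (metis image_eqI)
    moreover have "1 \<in> f ` ?C" using oneC by (intro image_eqI[of _ _ "(mat 1, 0)"]) (auto simp: f_def mat_def)
    ultimately have "1/2 \<in> f ` ?C" by (rule ivl) auto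
    then show False using f01 by force
  qed
  have cover: "?C \<subseteq> range (twist 0) \<union> (\<Union>k\<in>{1..<n}. range (twist k))"
  proof
    fix g assume g: "g \<in> ?C"
    obtain A c where gA: "g = (A, c)" by (cases g)
    note sh = shape[OF g[unfolded gA]]
    have "A $ j $ j \<noteq> 0" using f1[OF g] unfolding f_def gA by auto
    then have "\<And>k j. k \<noteq> j \<Longrightarrow> A $ k $ j = 0" using Sym_shape[OF sh(1,3)] j by blast
    then obtain k s where ks: "k < n" "(A, 0) = twist k s" using diagonal_Sym_twist[OF _ sh(3,1)] by blast
    then have "g \<in> range (twist k)" unfolding gA sh(2) by blast
    then show "g \<in> range (twist 0) \<union> (\<Union>k\<in>{1..<n}. range (twist k))"
      using ks(1) by (cases "k = 0") auto
  qed
  have cl: "closed (range (twist 0))" "closed (\<Union>k\<in>{1..<n}. range (twist k))"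
    by (auto intro!: closed_UN compact_imp_closed compact_range_twist)
  have dis: "range (twist 0) \<inter> (\<Union>k\<in>{1..<n}. range (twist k)) \<inter> ?C = {}"
  proof -
    define R where "R = (\<lambda>k. range (twist k))"
    have "R 0 \<inter> R k = {}" if "k \<in> {1..<n}" for k using twist_disjoint[of k] that unfolding R_def by simp
    then have "R 0 \<inter> (\<Union>k\<in>{1..<n}. R k) \<inter> ?C = {}" by blast
    then show ?thesis unfolding R_def .
  qed
  have fin: "T \<subseteq> R0" if "connected T" "R0 \<inter> R1 \<inter> T = {}" "T \<subseteq> R0 \<union> R1" "closed R0" "closed R1" "x \<in> T" "x \<in> R0"
    for T R0 R1 :: "(M3 \<times> C3) set" and x
  proof -
    have "R0 \<inter> T = {} \<or> R1 \<inter> T = {}" using that(1-5) by (rule connected_closedD)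
    then have "R1 \<inter> T = {}" using that(6,7) by blast
    then show ?thesis using that(3) by blast
  qed
  have "?C \<subseteq> range (twist 0)"
    by (rule fin[OF con dis cover cl oneC]) (use one in \<open>simp only: Ggroup_twist\<close>)
  then show "Sym0 N \<subseteq> Ggroup (b 1) (b 2) (b 3)" unfolding Sym0_def Ggroup_twist .
qed

end

section \<open>Closing of the curves and distinctness of the cones\<close>

context circle_weights
begin

text \<open>The increments split as \<open>beta = x b + y ci\<close>. The first part lies in the
  circle direction; rationality makes some multiple of the second integral up to
  \<open>2 * pi\<close>. The least closing number supplies the minimality condition.\<close>

lemma closing_exists:
  assumes e: "0 < e" "e \<le> emax" and rat: "Phi e / (2 * pi) \<in> \<rat>"
  shows "\<exists>sg n. closed_weights b e sg n"
proof -
  define P where "P = (\<lambda>n. 0 < n \<and> (\<exists>s. \<forall>j. cis (of_nat n * beta e j) = cis (of_int (b j) * s)))"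
  obtain p q :: int where q: "q > 0" and pq: "Phi e / (2 * pi) = of_int p / of_int q"
    using rat by (metis Rats_cases')
  have Phi: "Phi e * of_int q = 2 * pi * of_int p" using pq q by (simp add: field_simps)
  define m where "m = (ci 1)\<^sup>2 + (ci 2)\<^sup>2 + (ci 3)\<^sup>2"
  have m: "m > 0" "real_of_int m = 2 * E" using E_pos unfolding m_def E_def
    by (simp_all flip: of_int_power of_int_add)
  define y where "y = Phi e / of_int m"
  define u where "u = (\<lambda>j. beta e j - y * ci j)"
  have "u 1 + u 2 + u 3 = (beta e 1 + beta e 2 + beta e 3) - y * (ci 1 + ci 2 + ci 3)"
    unfolding u_def by (simp add: algebra_simps)
  then have s: "u 1 + u 2 + u 3 = 0" using sum_beta[of e] e by (simp add: ci_simps)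
  have "ci 1 * u 1 + ci 2 * u 2 + ci 3 * u 3 = Phi e - y * m"
    unfolding u_def m_def Phi_def by (simp add: algebra_simps power2_eq_square)
  also have "\<dots> = 0" unfolding y_def using m(1) by simp
  finally obtain x where x: "\<And>j. u j = x * real_of_int (b j)"
    using perpendicular_multiple[OF s] by blast
  \<comment> \<open>Since \<open>y * m = Phi e\<close>, the factor \<open>m\<close> clears the
    squared length of \<open>ci\<close> and \<open>q\<close> the denominator of
    \<open>Phi e / (2 * pi)\<close>.\<close>
  define k where "k = nat (q * m)"
  have k: "real k = of_int (q * m)" unfolding k_def using q m(1) by simp
  have "cis (of_nat k * beta e j) = cis (of_int (b j) * (k * x))" for j
  proof -
    have "beta e j = x * b j + y * ci j" using x[of j] unfolding u_def by simp
    then have "k * beta e j = b j * (k * x) + (y * m) * q * ci j" unfolding k by (simp add: algebra_simps)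
    also have "(y * m) * q = 2 * pi * of_int p" unfolding y_def using m(1) Phi by simp
    finally show ?thesis unfolding cis_eq_iff by (intro exI[of _ "p * ci j"]) simp
  qed
  moreover have "0 < k" unfolding k_def using q m(1) by simp
  ultimately have "P k" unfolding P_def by blast
  then have L: "P (LEAST n. P n)" by (rule LeastI)
  then obtain sg where sg: "\<And>j. cis (of_nat (LEAST n. P n) * beta e j) = cis (of_int (b j) * sg)"
    unfolding P_def by blast
  have "closed_weights b e sg (LEAST n. P n)"
  proof (unfold_locales)
    show "0 < (LEAST n. P n)" using L unfolding P_def by blast
    show "\<exists>j. cis (of_nat k * beta e j) \<noteq> cis (of_int (b j) * s)" if "0 < k" "k < (LEAST n. P n)" for k s
      using not_less_Least[OF that(2)] that(1) unfolding P_def by blast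
  qed (use e sg in auto)
  then show ?thesis by blast
qed

end

context closed_weights
begin

text \<open>On the sphere of radius \<open>sqrt 3\<close> the coordinate product of a point of the
  cone has constant real part \<open>AA e\<close>; the bound is attained at \<open>w 0\<close>,
  where the product is real.\<close>

lemma N_prod_lower:
  assumes "z \<in> N" "(norm z)\<^sup>2 = 3"
  shows "AA e \<le> cmod (z $ 1 * z $ 2 * z $ 3)"
proof -
  obtain r s t where r: "r \<ge> 0" "z = r *\<^sub>R act s (w t)" using assms(1) unfolding N_def by blast
  have "(norm z)\<^sup>2 = r\<^sup>2 * 3" unfolding r(2) using norm_ww[OF e_nonneg e_le, of t] by (simp add: power_mult_distrib)
  then have "r = 1" using assms(2) r(1) by (simp add: power2_eq_1_iff)
  then have "z $ 1 * z $ 2 * z $ 3 = Complex (AA e) (- FF e t)"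
    unfolding r(2) using act_prod[of s "w t"] ww_prod[OF e_nonneg e_le, of t] by simp
  then show ?thesis using abs_Re_le_cmod[of "Complex (AA e) (- FF e t)"] by simp
qed

lemma w_0_prod: "cmod (w 0 $ 1 * w 0 $ 2 * w 0 $ 3) = AA e"
  unfolding ww_prod[OF e_nonneg e_le] using AA_pos[OF e_nonneg e_le] by (simp add: FF_def complex_norm)

end

context circle_weights
begin

text \<open>Commuting with the circle makes the unitary matrix diagonal, so it preserves every
  coordinate modulus. The minima of the product on the two links therefore agree, and
  \<open>AA_inj\<close> applies.\<close>

lemma identified_imp_eq:
  assumes c: "closed_weights b e sg n" and c': "closed_weights b e' sg' n'"
    and id: "G_equiv_identified (b 1) (b 2) (b 3) (closed_weights.N b e) (closed_weights.N b e')"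
  shows "e = e'"
proof -
  interpret C: closed_weights b e sg n by (rule c)
  interpret C': closed_weights b e' sg' n' by (rule c')
  obtain A where A: "unitary3 A" "\<And>s. A ** Gmat (b 1) (b 2) (b 3) s = Gmat (b 1) (b 2) (b 3) s ** A"
    "(\<lambda>z. A *v z) ` C.N = C'.N"
    using id unfolding G_equiv_identified_def by blast
  have diag: "A $ k $ j = 0" if "k \<noteq> j" for k j by (rule commuting_diagonal[OF A(2) that])
  have cm: "cmod ((A *v z) $ j) = cmod (z $ j)" for z j
    using diagonal_mult_nth[OF diag] unitary3_diagonal_entry[OF A(1) diag] by (simp add: norm_mult)
  have nm: "(norm (A *v z))\<^sup>2 = (norm z)\<^sup>2" for z unfolding norm_C3 cm ..
  have pr: "cmod ((A *v z) $ 1 * (A *v z) $ 2 * (A *v z) $ 3) = cmod (z $ 1 * z $ 2 * z $ 3)" for z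
    unfolding norm_mult cm ..
  have "AA e' \<le> AA e"
  proof -
    have "A *v ww e 0 \<in> C'.N" unfolding A(3)[symmetric] using C.w_in_N by (rule imageI)
    moreover have "(norm (A *v ww e 0))\<^sup>2 = 3" unfolding nm by (rule norm_ww[OF C.e_nonneg C.e_le])
    ultimately show ?thesis using C'.N_prod_lower[of "A *v ww e 0"] unfolding pr C.w_0_prod by blast
  qed
  moreover have "AA e \<le> AA e'"
  proof -
    have "ww e' 0 \<in> (\<lambda>z. A *v z) ` C.N" unfolding A(3) by (rule C'.w_in_N)
    then obtain z where z: "ww e' 0 = A *v z" "z \<in> C.N" by (rule imageE)
    have "(norm z)\<^sup>2 = 3" using norm_ww[OF C'.e_nonneg C'.e_le, of 0] unfolding z(1) nm .
    then have "AA e \<le> cmod (z $ 1 * z $ 2 * z $ 3)" by (rule C.N_prod_lower[OF z(2)])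
    then show ?thesis using C'.w_0_prod unfolding z(1) pr by simp
  qed
  ultimately show ?thesis
    using AA_inj[OF C.e_nonneg C.e_le C'.e_nonneg C'.e_le] by simp
qed

end

theorem theorem8p5:
  fixes b1 b2 b3 :: int
  assumes "b1 \<noteq> b2" and "b1 \<noteq> b3" and "b2 \<noteq> b3"
    and "gcd (gcd b1 b2) b3 = 1"
    and "b1 + b2 + b3 = 0"
  shows "\<exists>F :: nat \<Rightarrow> C3 set.
           (\<forall>m n. m \<noteq> n \<longrightarrow> \<not> G_equiv_identified b1 b2 b3 (F m) (F n)) \<and>
           (\<forall>n. SL_cone (F n) \<and> closed (F n) \<and>
                Sym0 (F n) = Ggroup b1 b2 b3 \<and>
                F n homeomorphic cone_T2 \<and>
                (\<forall>p\<in>F n. \<not> smooth_point3 (F n) p \<longleftrightarrow> p = 0))"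
proof -
  define b :: "3 \<Rightarrow> int" where "b = (\<lambda>j. if j = 1 then b1 else if j = 2 then b2 else b3)"
  have b: "b 1 = b1" "b 2 = b2" "b 3 = b3" by (simp_all add: b_def)
  interpret circle_weights b by unfold_locales (use assms b in auto)
  obtain es :: "nat \<Rightarrow> real" where es: "inj es" "\<And>k. 0 < es k \<and> es k \<le> emax \<and> Phi (es k) / (2 * pi) \<in> \<rat>"
    using infinite_rational_Phi by blast
  have "\<forall>k. \<exists>sg n. closed_weights b (es k) sg n" using closing_exists es(2) by blast
  then obtain sg n where C: "\<And>k. closed_weights b (es k) (sg k) (n k)" by metis
  show ?thesis
  proof (intro exI[of _ "\<lambda>k. closed_weights.N b (es k)"] conjI allI impI)
    fix k l :: nat assume "k \<noteq> l"
    then have "es k \<noteq> es l" using es(1) by (simp add: inj_eq)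
    then show "\<not> G_equiv_identified b1 b2 b3 (closed_weights.N b (es k)) (closed_weights.N b (es l))"
      using identified_imp_eq[OF C C] unfolding b by blast
  next
    fix k
    interpret closed_weights b "es k" "sg k" "n k" by (rule C)
    show "SL_cone N" by (rule SL_cone_N)
    show "closed N" by (rule closed_N)
    show "Sym0 N = Ggroup b1 b2 b3" using Sym0_N unfolding b .
    show "N homeomorphic cone_T2" by (rule N_homeomorphic)
    show "\<forall>p\<in>N. \<not> smooth_point3 N p \<longleftrightarrow> p = 0" using smooth_point_N zero_not_smooth by blast
  qed
qed

end
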